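(* Let $\Lambda$ be a gentle algebra, let $\sigma$ be a homotopy band and let $\tau$ be a homotopy string. For $\lambda \in \mathbf{k}^*$, let $f^\bullet \colon B^\bullet_{\sigma,\lambda} \to P^\bullet_\tau$ be a graph map determined by a (possibly trivial) maximal common homotopy string $\rho$. Suppose there is an integer $\ell \geq 1$ such that $\rho$ is a proper subword of $\sigma^{\ell+1}$ and $\sigma^\ell$ is a (not necessarily proper) subword of $\rho$. Then, after suitable rotation of $\sigma$, there is a decomposition $\sigma = \beta\alpha$, with $\beta$ or $\alpha$ possibly trivial, such that $$\tau = \delta\,\sigma^\ell\beta\,\gamma \quad\text{for some } \ell \geq 1 \text{ and some homotopy strings } \gamma \text{ and } \delta .$$ In this case the mapping cone of $f^\bullet$ is $M^\bullet_{f^\bullet} \cong P^\bullet_c$, where $c = \delta\,\sigma^{\ell-1}\beta\,\gamma$.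
   Context: **Gentle algebras.** $\mathbf{k}$ is a field and $\Lambda=\mathbf{k}Q/I$ is a finite-dimensional algebra, with $Q$ a finite quiver, $I$ generated by paths of length 2, at most two arrows starting and at most two arrows ending at each vertex, and for each arrow $b$: at most one arrow $a$ with $ba$ a path not in $I$, at most one $a$ with $ba$ a path in $I$, at most one arrow $c$ with $cb$ a path not in $I$, and at most one $c$ with $cb$ a path in $I$. For a path or arrow $p$, $s(p)$ and $e(p)$ are its start and end; paths compose right to left ($qp$ is $p$ followed by $q$). $P(x)$ is the indecomposable projective at $x$; a path $p$ nonzero in $\Lambda$ induces a map $P(e(p))\to P(s(p))$, also denoted $p$; the path $qp$ induces the map "first $q$, then $p$", and products of maps below are written in this path order. **Homotopy strings and bands.** A direct homotopy letter is a nontrivial path $p$ nonzero in $\Lambda$; an inverse homotopy letter is a formal inverse $\overline p$, with $s(\overline p)=e(p)$, $e(\overline p)=s(p)$. A (finite) homotopy string is a trivial word at a vertex, or a word $\sigma=\sigma_n\cdots\sigma_1$ of homotopy letters with $s(\sigma_{i+1})=e(\sigma_i)$ such that for consecutive letters: if $\sigma_{i+1},\sigma_i$ are both direct, then $\sigma_{i+1}\sigma_i$ is zero because the length two path at the junction is in $I$; if both are inverse, the same holds for $\overline{\sigma_i}\,\overline{\sigma_{i+1}}$; if $\sigma_{i+1}=p$, $\sigma_i=\overline q$, then $p,q$ have different first arrows; if $\sigma_{i+1}=\overline p$, $\sigma_i=q$, then $p,q$ have different last arrows. This is the homotopy letter partition and $n$ is the length of $\sigma$. Infinite homotopy strings are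 defined in the same way, restricted to those whose complex below is a right bounded complex with bounded cohomology. $\sigma$ is drawn as a diagram $\bullet - \bullet - \cdots - \bullet$ labelled from left to right by $\sigma_n,\dots,\sigma_1$, a direct letter being an arrow $\rightarrow$ and an inverse letter an arrow $\leftarrow$; vertices carry cohomological degrees, arrows raising degree by one. Words are considered up to inversion. A homotopy band is a nontrivial finite homotopy string $\sigma$ starting and ending at the same vertex and in the same degree (equally many direct and inverse letters), such that $\sigma^2$ is a homotopy string whose letters are the letters of the two copies of $\sigma$ (no merging), and $\sigma$ is not a proper power; bands are considered up to rotation (cyclic permutation) and inversion. ${}^\infty\sigma^\infty$ is the infinite concatenation of copies of $\sigma$. **Complexes.** The string complex $P^\bullet_\sigma$ is the complex of projectives given by the direct sum of the $P(x)$ over the vertices $x$ of the diagram, placed in their degrees, with differential given by the letters. For a band $\sigma$ and $\lambda\in\mathbf{k}^*$, the band complex $B^\bullet_{\sigma,\lambda}$ is defined in the same way from the cyclic diagram of $\sigma$ (first and last vertex identified), the scalar $\lambda$ multiplying one direct letter. Its unfolded diagram is the repeating infinite diagram of ${}^\infty\sigma^\infty$. The cohomological grading is suppressed in the notation: a complex attached to a word describing a mapping cone has the degrees inherited from the cone. The mapping cone $M^\bullet_{f^\bullet}$ of $f^\bullet\colon P^\bullet\to Q^\bullet$ is $\Sigma P^\bullet\oplus Q^\bullet$ with differential $\left[\begin{smallmatrix}-d_P&0\\ f&d_Q\end{smallmatrix}\right]$; isomorphisms are in the bounded derived category $\mathsf{D}^b(\Lambda)$, equivalently the homotopy category of right bounded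 complexes of finitely generated projectives with bounded cohomology. **Graph maps.** Let $\rho$ be a maximal common homotopy substring (the overlap, possibly trivial), in matching degrees, of $\sigma$ and $\tau$ (of ${}^\infty\sigma^\infty$ if $\sigma$ is a band, and likewise for $\tau$). Let $\sigma_L,\sigma_R$ (resp. $\tau_L,\tau_R$) be the homotopy letters, possibly empty, immediately to the left and right of $\rho$ in $\sigma$ (resp. $\tau$). $\rho$ determines a graph map from the complex of $\sigma$ to that of $\tau$ if: at the left end, either $\sigma_L,\tau_L$ are both direct with $\sigma_L=f_L\tau_L$, or both inverse with $\overline{\tau_L}=\overline{\sigma_L}f_L$, for a nontrivial path $f_L$; or $\sigma_L$ is empty or inverse and $\tau_L$ is empty or direct (then $f_L=\varnothing$); and at the right end, either both $\sigma_R,\tau_R$ are direct with $\tau_R=\sigma_Rf_R$, or both inverse with $\overline{\sigma_R}=f_R\overline{\tau_R}$, for a nontrivial path $f_R$; or $\sigma_R$ is empty or direct and $\tau_R$ is empty or inverse ($f_R=\varnothing$). There is no condition at an end at which $\rho$ is infinite. The graph map has as components identities between corresponding vertices of $\rho$ together with $f_L,f_R$, up to the nonzero scalars forced by the band parameters, and zero elsewhere. **Convention.** In decompositions such as $\tau=\delta\sigma^\ell\beta\gamma$, the factors are subwords of the underlying walk; the last homotopy letter of one factor may merge with the first homotopy letter of the next, and factors may be trivial. *)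

theory Defs
  imports
    "Graph_Theory.Arc_Walk"
    "HOL-Library.Function_Algebras"
    "HOL-Library.Product_Plus"
begin

section \<open>Gentle algebras\<close>

text \<open>
  A quiver is a finite directed multigraph \<open>G\<close>; an arrow \<open>a\<close> goes from \<open>tail G a\<close> to
  \<open>head G a\<close>.  The pair \<open>(s, as)\<close> stands for the path that starts at \<open>s\<close> and runs through the
  arrows \<open>as\<close> in the order of travel, so that the right-to-left product \<open>q p\<close> (\<open>p\<close> followed by
  \<open>q\<close>) is stored as \<open>(s, as @ bs)\<close>.  The ideal \<open>I\<close> is given by the set \<open>R\<close> of its generators:
  \<open>(b, a) \<in> R\<close> means that the path \<open>b a\<close> (\<open>a\<close> followed by \<open>b\<close>) is one of them.
\<close>

type_synonym ('v, 'a) qpath = "'v \<times> 'a list"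

definition pstart :: "('v, 'a) qpath \<Rightarrow> 'v" where
  "pstart p = fst p"

definition pend :: "('v, 'a) pre_digraph \<Rightarrow> ('v, 'a) qpath \<Rightarrow> 'v" where
  "pend G p = (if snd p = [] then fst p else head G (last (snd p)))"

text \<open>A path lies in \<open>I\<close> iff two of its consecutive arrows form a generator.\<close>

definition nonzero_path :: "('v, 'a) pre_digraph \<Rightarrow> ('a \<times> 'a) set \<Rightarrow> ('v, 'a) qpath \<Rightarrow> bool" where
  "nonzero_path G R p \<longleftrightarrow>
     pre_digraph.awalk G (pstart p) (snd p) (pend G p) \<and> successively (\<lambda>a b. (b, a) \<notin> R) (snd p)"

definition nontrivial :: "('v, 'a) qpath \<Rightarrow> bool" where
  "nontrivial p \<longleftrightarrow> snd p \<noteq> []"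

locale gentle_algebra = fin_digraph G for G :: "('v, 'a) pre_digraph" +
  fixes R :: "('a \<times> 'a) set"
  assumes relations: "R \<subseteq> {(b, a). a \<in> arcs G \<and> b \<in> arcs G \<and> head G a = tail G b}"
    and at_most_two_out: "x \<in> verts G \<Longrightarrow> out_degree G x \<le> 2"
    and at_most_two_in: "x \<in> verts G \<Longrightarrow> in_degree G x \<le> 2"
    and before_nonzero:
      "b \<in> arcs G \<Longrightarrow> \<exists>\<^sub>\<le>\<^sub>1 a. a \<in> arcs G \<and> head G a = tail G b \<and> (b, a) \<notin> R"
    and before_zero:
      "b \<in> arcs G \<Longrightarrow> \<exists>\<^sub>\<le>\<^sub>1 a. a \<in> arcs G \<and> head G a = tail G b \<and> (b, a) \<in> R"
    and after_nonzero:
      "b \<in> arcs G \<Longrightarrow> \<exists>\<^sub>\<le>\<^sub>1 c. c \<in> arcs G \<and> head G b = tail G c \<and> (c, b) \<notin> R"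
    and after_zero:
      "b \<in> arcs G \<Longrightarrow> \<exists>\<^sub>\<le>\<^sub>1 c. c \<in> arcs G \<and> head G b = tail G c \<and> (c, b) \<in> R"
    and finite_dimensional: "finite {p. nonzero_path G R p}"

text \<open>\<open>is_prod G R q p r\<close>: the product \<open>q p\<close> is defined, nonzero, and equal to \<open>r\<close>.\<close>

definition is_prod ::
    "('v, 'a) pre_digraph \<Rightarrow> ('a \<times> 'a) set \<Rightarrow> ('v, 'a) qpath \<Rightarrow> ('v, 'a) qpath \<Rightarrow> ('v, 'a) qpath \<Rightarrow> bool" where
  "is_prod G R q p r \<longleftrightarrow>
     nonzero_path G R q \<and> nonzero_path G R p \<and> nonzero_path G R r \<and>
     pstart q = pend G p \<and> r = (pstart p, snd p @ snd q)"

text \<open>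
  Since \<open>I\<close> is generated by paths, the nonzero paths form a basis of \<open>\<Lambda> = kQ/I\<close>, and the product
  of two of them is their concatenation or zero.  An element of \<open>\<Lambda>\<close> is stored as its coefficient
  function with respect to this basis.
\<close>

definition Lam :: "('v, 'a) pre_digraph \<Rightarrow> ('a \<times> 'a) set \<Rightarrow> (('v, 'a) qpath \<Rightarrow> 'k::field) set" where
  "Lam G R = {u. \<forall>p. u p \<noteq> 0 \<longrightarrow> nonzero_path G R p}"

definition lmult ::
    "('v, 'a) pre_digraph \<Rightarrow> ('a \<times> 'a) set \<Rightarrow> (('v, 'a) qpath \<Rightarrow> 'k) \<Rightarrow> (('v, 'a) qpath \<Rightarrow> 'k)
      \<Rightarrow> ('v, 'a) qpath \<Rightarrow> 'k::field" where
  "lmult G R u v = (\<lambda>r. \<Sum>(q, p) | is_prod G R q p r. u q * v p)"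

definition path_elt :: "'k \<Rightarrow> ('v, 'a) qpath \<Rightarrow> ('v, 'a) qpath \<Rightarrow> 'k::field" where
  "path_elt c p = (\<lambda>q. if q = p then c else 0)"

text \<open>
  \<open>P(x)\<close> is the left ideal \<open>\<Lambda> e\<^sub>x\<close>.  A path \<open>p\<close> induces \<open>P(e(p)) \<rightarrow> P(s(p))\<close>, \<open>u \<mapsto> u p\<close>, so \<open>q p\<close>
  induces first \<open>q\<close>, then \<open>p\<close>.
\<close>

definition proj ::
    "('v, 'a) pre_digraph \<Rightarrow> ('a \<times> 'a) set \<Rightarrow> 'v \<Rightarrow> (('v, 'a) qpath \<Rightarrow> 'k::field) set" where
  "proj G R x = {u \<in> Lam G R. \<forall>p. u p \<noteq> 0 \<longrightarrow> pstart p = x}"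


section \<open>Complexes of modules and the homotopy category\<close>

text \<open>
  A complex of left modules whose terms are subgroups of one ambient additive group \<open>'m\<close>;
  the values of \<open>cact\<close> and \<open>cdiff\<close> outside the terms are irrelevant.
\<close>

record ('r, 'm) mod_complex =
  cterm :: "int \<Rightarrow> 'm set"
  cact :: "'r \<Rightarrow> 'm \<Rightarrow> 'm"
  cdiff :: "int \<Rightarrow> 'm \<Rightarrow> 'm"

definition graded_linear ::
    "'r set \<Rightarrow> ('r, 'm::ab_group_add) mod_complex \<Rightarrow> ('r, 'n::ab_group_add) mod_complex \<Rightarrow> int
      \<Rightarrow> (int \<Rightarrow> 'm \<Rightarrow> 'n) \<Rightarrow> bool" where
  "graded_linear A C D e f \<longleftrightarrow>
     (\<forall>m. \<forall>x\<in>cterm C m.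
        f m x \<in> cterm D (m + e) \<and>
        (\<forall>y\<in>cterm C m. f m (x + y) = f m x + f m y) \<and>
        (\<forall>r\<in>A. f m (cact C r x) = cact D r (f m x)))"

definition chain_map ::
    "'r set \<Rightarrow> ('r, 'm::ab_group_add) mod_complex \<Rightarrow> ('r, 'n::ab_group_add) mod_complex
      \<Rightarrow> (int \<Rightarrow> 'm \<Rightarrow> 'n) \<Rightarrow> bool" where
  "chain_map A C D f \<longleftrightarrow>
     graded_linear A C D 0 f \<and>
     (\<forall>m. \<forall>x\<in>cterm C m. f (m + 1) (cdiff C m x) = cdiff D m (f m x))"

definition chain_homotopic ::
    "'r set \<Rightarrow> ('r, 'm::ab_group_add) mod_complex \<Rightarrow> ('r, 'n::ab_group_add) mod_complex
      \<Rightarrow> (int \<Rightarrow> 'm \<Rightarrow> 'n) \<Rightarrow> (int \<Rightarrow> 'm \<Rightarrow> 'n) \<Rightarrow> bool" where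
  "chain_homotopic A C D f g \<longleftrightarrow>
     (\<exists>h. graded_linear A C D (-1) h \<and>
        (\<forall>m. \<forall>x\<in>cterm C m. f m x - g m x = cdiff D (m - 1) (h m x) + h (m + 1) (cdiff C m x)))"

definition homotopy_iso ::
    "'r set \<Rightarrow> ('r, 'm::ab_group_add) mod_complex \<Rightarrow> ('r, 'n::ab_group_add) mod_complex \<Rightarrow> bool" where
  "homotopy_iso A C D \<longleftrightarrow>
     (\<exists>f g. chain_map A C D f \<and> chain_map A D C g \<and>
        chain_homotopic A C C (\<lambda>m x. g m (f m x)) (\<lambda>m x. x) \<and>
        chain_homotopic A D D (\<lambda>m x. f m (g m x)) (\<lambda>m x. x))"

definition mapping_cone ::
    "('r, 'm::ab_group_add) mod_complex \<Rightarrow> ('r, 'n::ab_group_add) mod_complex \<Rightarrow> (int \<Rightarrow> 'm \<Rightarrow> 'n)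
      \<Rightarrow> ('r, 'm \<times> 'n) mod_complex" where
  "mapping_cone P Q f =
     \<lparr>cterm = (\<lambda>m. cterm P (m + 1) \<times> cterm Q m),
      cact = (\<lambda>r (x, y). (cact P r x, cact Q r y)),
      cdiff = (\<lambda>m (x, y). (- cdiff P (m + 1) x, f (m + 1) x + cdiff Q m y))\<rparr>"

definition right_bounded :: "('r, 'm::ab_group_add) mod_complex \<Rightarrow> bool" where
  "right_bounded C \<longleftrightarrow> (\<exists>N. \<forall>m>N. cterm C m = {0})"

definition bounded_cohomology :: "('r, 'm::ab_group_add) mod_complex \<Rightarrow> bool" where
  "bounded_cohomology C \<longleftrightarrow>
     (\<exists>N. \<forall>m. \<bar>m\<bar> > N \<longrightarrow> {x \<in> cterm C m. cdiff C m x = 0} = cdiff C (m - 1) ` cterm C (m - 1))"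

text \<open>
  The complex with summands \<open>P(x i)\<close> in degree \<open>dg i\<close>, for \<open>i \<in> J\<close>.  A map of such sums is a
  matrix \<open>D\<close> over \<open>\<Lambda>\<close>: \<open>D i j\<close> is the component from the summand \<open>i\<close> to the summand \<open>j\<close>, acting by
  multiplication from the right.
\<close>

definition mat_map ::
    "('v, 'a) pre_digraph \<Rightarrow> ('a \<times> 'a) set \<Rightarrow> (int \<Rightarrow> int \<Rightarrow> ('v, 'a) qpath \<Rightarrow> 'k::field)
      \<Rightarrow> (int \<Rightarrow> ('v, 'a) qpath \<Rightarrow> 'k) \<Rightarrow> int \<Rightarrow> ('v, 'a) qpath \<Rightarrow> 'k" where
  "mat_map G R D u = (\<lambda>j. \<Sum>i | u i \<noteq> 0. lmult G R (u i) (D i j))"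

definition proj_complex ::
    "('v, 'a) pre_digraph \<Rightarrow> ('a \<times> 'a) set \<Rightarrow> int set \<Rightarrow> (int \<Rightarrow> 'v) \<Rightarrow> (int \<Rightarrow> int)
      \<Rightarrow> (int \<Rightarrow> int \<Rightarrow> ('v, 'a) qpath \<Rightarrow> 'k::field)
      \<Rightarrow> (('v, 'a) qpath \<Rightarrow> 'k, int \<Rightarrow> ('v, 'a) qpath \<Rightarrow> 'k) mod_complex" where
  "proj_complex G R J x dg D =
     \<lparr>cterm = (\<lambda>m. {u. finite {i. u i \<noteq> 0} \<and>
                       (\<forall>i. u i \<in> (if i \<in> J \<and> dg i = m then proj G R (x i) else {0}))}),
      cact = (\<lambda>r u i. lmult G R r (u i)),
      cdiff = (\<lambda>m. mat_map G R D)\<rparr>"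


section \<open>Homotopy words\<close>

text \<open>\<open>Inv p\<close> is the formal inverse of the path \<open>p\<close>.\<close>

datatype ('v, 'a) letter = Dir "('v, 'a) qpath" | Inv "('v, 'a) qpath"

fun is_direct :: "('v, 'a) letter \<Rightarrow> bool" where
  "is_direct (Dir p) = True"
| "is_direct (Inv p) = False"

fun letter_path :: "('v, 'a) letter \<Rightarrow> ('v, 'a) qpath" where
  "letter_path (Dir p) = p"
| "letter_path (Inv p) = p"

fun lstart :: "('v, 'a) pre_digraph \<Rightarrow> ('v, 'a) letter \<Rightarrow> 'v" where
  "lstart G (Dir p) = pstart p"
| "lstart G (Inv p) = pend G p"

fun lend :: "('v, 'a) pre_digraph \<Rightarrow> ('v, 'a) letter \<Rightarrow> 'v" where
  "lend G (Dir p) = pend G p"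
| "lend G (Inv p) = pstart p"

text \<open>
  A finite or infinite word is represented by its graded diagram, drawn from left to right.
  The vertices of the diagram occupy the interval \<open>pos w\<close> of the integers; \<open>ltr w i\<close> is the letter
  drawn between the positions \<open>i\<close> and \<open>i + 1\<close>.  In the notation \<open>\<sigma>\<^sub>n \<dots> \<sigma>\<^sub>1\<close> the indices decrease from
  left to right, so a letter runs, as a walk in the quiver, from its right end to its left end.
  Field values that do not belong to positions in \<open>pos w\<close> are irrelevant.
\<close>

record ('v, 'a) word =
  pos :: "int set"
  vtx :: "int \<Rightarrow> 'v"
  deg :: "int \<Rightarrow> int"
  ltr :: "int \<Rightarrow> ('v, 'a) letter"

definition int_interval :: "int set \<Rightarrow> bool" where
  "int_interval I \<longleftrightarrow> I \<noteq> {} \<and> (\<forall>i\<in>I. \<forall>k\<in>I. {i..k} \<subseteq> I)"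

definition links :: "('v, 'a) word \<Rightarrow> int set" where
  "links w = {i. i \<in> pos w \<and> i + 1 \<in> pos w}"

text \<open>\<open>junction R l r\<close>: the letter \<open>r\<close> may be written immediately to the right of \<open>l\<close>.\<close>

fun junction :: "('a \<times> 'a) set \<Rightarrow> ('v, 'a) letter \<Rightarrow> ('v, 'a) letter \<Rightarrow> bool" where
  "junction R (Dir p) (Dir q) \<longleftrightarrow> (hd (snd p), last (snd q)) \<in> R"
| "junction R (Inv p) (Inv q) \<longleftrightarrow> (hd (snd q), last (snd p)) \<in> R"
| "junction R (Dir p) (Inv q) \<longleftrightarrow> hd (snd p) \<noteq> hd (snd q)"
| "junction R (Inv p) (Dir q) \<longleftrightarrow> last (snd p) \<noteq> last (snd q)"

definition homotopy_word :: "('v, 'a) pre_digraph \<Rightarrow> ('a \<times> 'a) set \<Rightarrow> ('v, 'a) word \<Rightarrow> bool" where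
  "homotopy_word G R w \<longleftrightarrow>
     int_interval (pos w) \<and>
     (\<forall>i\<in>pos w. vtx w i \<in> verts G) \<and>
     (\<forall>i\<in>links w.
        nonzero_path G R (letter_path (ltr w i)) \<and> nontrivial (letter_path (ltr w i)) \<and>
        lend G (ltr w i) = vtx w i \<and> lstart G (ltr w i) = vtx w (i + 1) \<and>
        deg w (i + 1) = (if is_direct (ltr w i) then deg w i + 1 else deg w i - 1)) \<and>
     (\<forall>i\<in>links w. i + 1 \<in> links w \<longrightarrow> junction R (ltr w i) (ltr w (i + 1)))"

text \<open>
  The matrix with the single entry contributed to the differential by a letter \<open>l\<close>, with scalar
  \<open>c\<close>, drawn between the summands \<open>a\<close> (left) and \<open>b\<close> (right).
\<close>

fun letter_entry ::
    "'k \<Rightarrow> ('v, 'a) letter \<Rightarrow> int \<Rightarrow> int \<Rightarrow> int \<Rightarrow> int \<Rightarrow> ('v, 'a) qpath \<Rightarrow> 'k::field" where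
  "letter_entry c (Dir p) a b i j = (if i = a \<and> j = b then path_elt c p else 0)"
| "letter_entry c (Inv p) a b i j = (if i = b \<and> j = a then path_elt c p else 0)"

definition string_complex ::
    "('v, 'a) pre_digraph \<Rightarrow> ('a \<times> 'a) set \<Rightarrow> ('v, 'a) word
      \<Rightarrow> (('v, 'a) qpath \<Rightarrow> 'k::field, int \<Rightarrow> ('v, 'a) qpath \<Rightarrow> 'k) mod_complex" where
  "string_complex G R w = proj_complex G R (pos w) (vtx w) (deg w)
     (\<lambda>i j. \<Sum>k | k \<in> links w \<and> (k = i \<or> k = j). letter_entry 1 (ltr w k) k (k + 1) i j)"

text \<open>
  The complex of an infinite homotopy string has to be a right bounded complex of finitely
  generated projectives with bounded cohomology; these conditions are automatic for finite words.
\<close>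

definition homotopy_string ::
    "'k::field itself \<Rightarrow> ('v, 'a) pre_digraph \<Rightarrow> ('a \<times> 'a) set \<Rightarrow> ('v, 'a) word \<Rightarrow> bool" where
  "homotopy_string K G R w \<longleftrightarrow>
     homotopy_word G R w \<and>
     (finite (pos w) \<or>
      (let C = string_complex G R w :: (('v, 'a) qpath \<Rightarrow> 'k, int \<Rightarrow> ('v, 'a) qpath \<Rightarrow> 'k) mod_complex
       in (\<forall>m. finite {i \<in> pos w. deg w i = m}) \<and> right_bounded C \<and> bounded_cohomology C))"

text \<open>Equality of graded words, up to a translation of the positions.\<close>

definition same_word :: "('v, 'a) word \<Rightarrow> ('v, 'a) word \<Rightarrow> bool" where
  "same_word u w \<longleftrightarrow>
     (\<exists>k. pos w = (\<lambda>i. i + k) ` pos u \<and>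
          (\<forall>i\<in>pos u. vtx w (i + k) = vtx u i \<and> deg w (i + k) = deg u i) \<and>
          (\<forall>i\<in>links u. ltr w (i + k) = ltr u i))"

definition restrict_word :: "('v, 'a) word \<Rightarrow> int set \<Rightarrow> ('v, 'a) word" where
  "restrict_word w I = w\<lparr>pos := pos w \<inter> I\<rparr>"

definition subword :: "('v, 'a) word \<Rightarrow> ('v, 'a) word \<Rightarrow> bool" where
  "subword u w \<longleftrightarrow> (\<exists>I. int_interval I \<and> I \<subseteq> pos w \<and> same_word u (restrict_word w I))"

definition proper_subword :: "('v, 'a) word \<Rightarrow> ('v, 'a) word \<Rightarrow> bool" where
  "proper_subword u w \<longleftrightarrow> (\<exists>I. int_interval I \<and> I \<subset> pos w \<and> same_word u (restrict_word w I))"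

text \<open>
  \<open>concat2 G R u v w\<close>: the word \<open>w\<close> is a product \<open>u v\<close>.  In the second case the last letter of \<open>u\<close>
  and the first letter of \<open>v\<close> merge to the letter of \<open>w\<close> between \<open>m\<close> and \<open>m + 1\<close>; the vertex \<open>y\<close>
  at which they meet is then the right end of \<open>u\<close> and the left end of \<open>v\<close>.
\<close>

fun merges ::
    "('v, 'a) pre_digraph \<Rightarrow> ('a \<times> 'a) set \<Rightarrow> ('v, 'a) letter \<Rightarrow> ('v, 'a) letter \<Rightarrow> ('v, 'a) letter \<Rightarrow> bool" where
  "merges G R (Dir p) (Dir q) (Dir r) \<longleftrightarrow> is_prod G R p q r"
| "merges G R (Inv p) (Inv q) (Inv r) \<longleftrightarrow> is_prod G R q p r"
| "merges G R _ _ _ \<longleftrightarrow> False"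

definition concat2 ::
    "('v, 'a) pre_digraph \<Rightarrow> ('a \<times> 'a) set \<Rightarrow> ('v, 'a) word \<Rightarrow> ('v, 'a) word \<Rightarrow> ('v, 'a) word \<Rightarrow> bool" where
  "concat2 G R u v w \<longleftrightarrow>
     (\<exists>m\<in>pos w. same_word u (restrict_word w {..m}) \<and> same_word v (restrict_word w {m..})) \<or>
     (\<exists>m\<in>links w. \<exists>y l r. merges G R l r (ltr w m) \<and>
        same_word u ((restrict_word w {..m + 1})\<lparr>vtx := (vtx w)(m + 1 := y), ltr := (ltr w)(m := l)\<rparr>) \<and>
        same_word v ((restrict_word w {m..})\<lparr>vtx := (vtx w)(m := y), ltr := (ltr w)(m := r)\<rparr>))"

fun concat_words ::
    "('v, 'a) pre_digraph \<Rightarrow> ('a \<times> 'a) set \<Rightarrow> ('v, 'a) word list \<Rightarrow> ('v, 'a) word \<Rightarrow> bool" where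
  "concat_words G R [] w \<longleftrightarrow> False"
| "concat_words G R [u] w \<longleftrightarrow> same_word u w"
| "concat_words G R (u # us) w \<longleftrightarrow> (\<exists>v. concat_words G R us v \<and> concat2 G R u v w)"


section \<open>Bands\<close>

definition word_length :: "('v, 'a) word \<Rightarrow> int" where
  "word_length w = int (card (pos w)) - 1"

text \<open>Bands occupy the positions \<open>{0..n}\<close>; \<open>unfold_band \<sigma>\<close> is the diagram of \<open>\<^sup>\<infinity>\<sigma>\<^sup>\<infinity>\<close>.\<close>

definition unfold_band :: "('v, 'a) word \<Rightarrow> ('v, 'a) word" where
  "unfold_band w =
     (let n = word_length w
      in \<lparr>pos = UNIV, vtx = (\<lambda>i. vtx w (i mod n)), deg = (\<lambda>i. deg w (i mod n)),
          ltr = (\<lambda>i. ltr w (i mod n))\<rparr>)"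

definition window :: "('v, 'a) word \<Rightarrow> int \<Rightarrow> int \<Rightarrow> ('v, 'a) word" where
  "window w a n =
     \<lparr>pos = {0..n}, vtx = (\<lambda>i. vtx w (a + i)), deg = (\<lambda>i. deg w (a + i)), ltr = (\<lambda>i. ltr w (a + i))\<rparr>"

definition band_power :: "('v, 'a) word \<Rightarrow> nat \<Rightarrow> ('v, 'a) word" where
  "band_power w l = window (unfold_band w) 0 (int l * word_length w)"

definition rotate_band :: "int \<Rightarrow> ('v, 'a) word \<Rightarrow> ('v, 'a) word" where
  "rotate_band k w = window (unfold_band w) k (word_length w)"

definition letters :: "('v, 'a) word \<Rightarrow> ('v, 'a) letter list" where
  "letters w = map (ltr w) [0..word_length w - 1]"

definition homotopy_band :: "('v, 'a) pre_digraph \<Rightarrow> ('a \<times> 'a) set \<Rightarrow> ('v, 'a) word \<Rightarrow> bool" where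
  "homotopy_band G R w \<longleftrightarrow>
     homotopy_word G R w \<and>
     (\<exists>n>0. pos w = {0..n} \<and> vtx w 0 = vtx w n \<and> deg w 0 = deg w n) \<and>
     homotopy_word G R (band_power w 2) \<and>
     \<not> (\<exists>ls k. k \<ge> 2 \<and> letters w = concat (replicate k ls))"

text \<open>\<open>band_complex G R w c d\<close>: the scalar \<open>c\<close> is placed on the letter at \<open>d\<close>.\<close>

definition band_complex ::
    "('v, 'a) pre_digraph \<Rightarrow> ('a \<times> 'a) set \<Rightarrow> ('v, 'a) word \<Rightarrow> 'k::field \<Rightarrow> int
      \<Rightarrow> (('v, 'a) qpath \<Rightarrow> 'k, int \<Rightarrow> ('v, 'a) qpath \<Rightarrow> 'k) mod_complex" where
  "band_complex G R w c d =
     (let n = word_length w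
      in proj_complex G R {0..<n} (vtx w) (deg w)
           (\<lambda>i j. \<Sum>k\<in>{0..<n}. letter_entry (if k = d then c else 1) (ltr w k) k ((k + 1) mod n) i j))"


section \<open>Graph maps\<close>

text \<open>
  The positions \<open>I\<close> of \<open>T\<close> carry a maximal common subword of \<open>S\<close> and \<open>T\<close>, in matching degrees; the
  position \<open>j \<in> I\<close> of \<open>T\<close> corresponds to the position \<open>j + s\<close> of \<open>S\<close>.  Words are considered up to
  inversion; \<open>S\<close> and \<open>T\<close> stand for representatives in which the common subword is read in the same
  direction.
\<close>

definition common_subword ::
    "('v, 'a) word \<Rightarrow> ('v, 'a) word \<Rightarrow> int set \<Rightarrow> int \<Rightarrow> bool" where
  "common_subword S T I s \<longleftrightarrow>
     int_interval I \<and> I \<subseteq> pos T \<and> (\<lambda>j. j + s) ` I \<subseteq> pos S \<and>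
     (\<forall>j\<in>I. vtx S (j + s) = vtx T j \<and> deg S (j + s) = deg T j) \<and>
     (\<forall>j. j \<in> I \<and> j + 1 \<in> I \<longrightarrow> ltr S (j + s) = ltr T j)"

definition overlap :: "('v, 'a) word \<Rightarrow> ('v, 'a) word \<Rightarrow> int set \<Rightarrow> int \<Rightarrow> bool" where
  "overlap S T I s \<longleftrightarrow>
     common_subword S T I s \<and> (\<forall>J. common_subword S T J s \<and> I \<subseteq> J \<longrightarrow> J = I)"

definition left_letter :: "('v, 'a) word \<Rightarrow> int \<Rightarrow> ('v, 'a) letter option" where
  "left_letter w i = (if i - 1 \<in> links w then Some (ltr w (i - 1)) else None)"

definition right_letter :: "('v, 'a) word \<Rightarrow> int \<Rightarrow> ('v, 'a) letter option" where
  "right_letter w i = (if i \<in> links w then Some (ltr w i) else None)"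

definition empty_or_direct :: "('v, 'a) letter option \<Rightarrow> bool" where
  "empty_or_direct l \<longleftrightarrow> (\<forall>x. l = Some x \<longrightarrow> is_direct x)"

definition empty_or_inverse :: "('v, 'a) letter option \<Rightarrow> bool" where
  "empty_or_inverse l \<longleftrightarrow> (\<forall>x. l = Some x \<longrightarrow> \<not> is_direct x)"

fun left_end ::
    "('v, 'a) pre_digraph \<Rightarrow> ('a \<times> 'a) set \<Rightarrow> ('v, 'a) letter option \<Rightarrow> ('v, 'a) letter option
      \<Rightarrow> ('v, 'a) qpath option \<Rightarrow> bool" where
  "left_end G R sL tL (Some f) \<longleftrightarrow> nontrivial f \<and>
     ((\<exists>p q. sL = Some (Dir p) \<and> tL = Some (Dir q) \<and> is_prod G R f q p) \<or>
      (\<exists>p q. sL = Some (Inv p) \<and> tL = Some (Inv q) \<and> is_prod G R p f q))"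
| "left_end G R sL tL None \<longleftrightarrow> empty_or_inverse sL \<and> empty_or_direct tL"

fun right_end ::
    "('v, 'a) pre_digraph \<Rightarrow> ('a \<times> 'a) set \<Rightarrow> ('v, 'a) letter option \<Rightarrow> ('v, 'a) letter option
      \<Rightarrow> ('v, 'a) qpath option \<Rightarrow> bool" where
  "right_end G R sR tR (Some f) \<longleftrightarrow> nontrivial f \<and>
     ((\<exists>p q. sR = Some (Dir p) \<and> tR = Some (Dir q) \<and> is_prod G R p f q) \<or>
      (\<exists>p q. sR = Some (Inv p) \<and> tR = Some (Inv q) \<and> is_prod G R f q p))"
| "right_end G R sR tR None \<longleftrightarrow> empty_or_direct sR \<and> empty_or_inverse tR"

definition end_conditions ::
    "('v, 'a) pre_digraph \<Rightarrow> ('a \<times> 'a) set \<Rightarrow> ('v, 'a) word \<Rightarrow> ('v, 'a) word \<Rightarrow> int set \<Rightarrow> int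
      \<Rightarrow> ('v, 'a) qpath option \<Rightarrow> ('v, 'a) qpath option \<Rightarrow> bool" where
  "end_conditions G R S T I s fL fR \<longleftrightarrow>
     (\<forall>a. a \<in> I \<and> a - 1 \<notin> I \<longrightarrow> left_end G R (left_letter S (a + s)) (left_letter T a) fL) \<and>
     (\<forall>b. b \<in> I \<and> b + 1 \<notin> I \<longrightarrow> right_end G R (right_letter S (b + s)) (right_letter T b) fR)"

text \<open>
  The components of a graph map: the identity at the positions \<open>j \<in> I\<close>, \<open>f\<^sub>L\<close> at the position
  adjacent to \<open>I\<close> on the left, \<open>f\<^sub>R\<close> at the one adjacent on the right, multiplied by scalars \<open>c j\<close>.
  The summand of the source at the position \<open>i\<close> of the diagram \<open>S\<close> has the index \<open>idx i\<close>.
\<close>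

definition graph_matrix ::
    "('v, 'a) word \<Rightarrow> int set \<Rightarrow> int \<Rightarrow> (int \<Rightarrow> int) \<Rightarrow> ('v, 'a) qpath option \<Rightarrow> ('v, 'a) qpath option
      \<Rightarrow> (int \<Rightarrow> 'k) \<Rightarrow> int \<Rightarrow> int \<Rightarrow> ('v, 'a) qpath \<Rightarrow> 'k::field" where
  "graph_matrix T I s idx fL fR c i j =
     (if i \<noteq> idx (j + s) then 0
      else if j \<in> I then path_elt (c j) (vtx T j, [])
      else if j + 1 \<in> I then (case fL of None \<Rightarrow> 0 | Some p \<Rightarrow> path_elt (c j) p)
      else if j - 1 \<in> I then (case fR of None \<Rightarrow> 0 | Some p \<Rightarrow> path_elt (c j) p)
      else 0)"

text \<open>
  \<open>f\<close> is a graph map from the band complex of \<open>\<sigma>\<close> (with the scalar \<open>lam\<close> on its letter at \<open>d\<close>) to the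
  string complex of \<open>\<tau>\<close>, determined by the overlap \<open>(I, s)\<close>.  That \<open>f\<close> is a chain map forces the
  scalars up to a common factor.
\<close>

definition band_string_graph_map ::
    "('v, 'a) pre_digraph \<Rightarrow> ('a \<times> 'a) set \<Rightarrow> ('v, 'a) word \<Rightarrow> 'k::field \<Rightarrow> int \<Rightarrow> ('v, 'a) word
      \<Rightarrow> int set \<Rightarrow> int
      \<Rightarrow> (int \<Rightarrow> (int \<Rightarrow> ('v, 'a) qpath \<Rightarrow> 'k) \<Rightarrow> (int \<Rightarrow> ('v, 'a) qpath \<Rightarrow> 'k)) \<Rightarrow> bool" where
  "band_string_graph_map G R \<sigma> lam d \<tau> I s f \<longleftrightarrow>
     overlap (unfold_band \<sigma>) \<tau> I s \<and>
     chain_map (Lam G R) (band_complex G R \<sigma> lam d) (string_complex G R \<tau>) f \<and>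
     (\<exists>fL fR c.
        end_conditions G R (unfold_band \<sigma>) \<tau> I s fL fR \<and> (\<forall>j. c j \<noteq> 0) \<and>
        (\<forall>m. \<forall>u\<in>cterm (band_complex G R \<sigma> lam d) m.
           f m u = mat_map G R (graph_matrix \<tau> I s (\<lambda>i. i mod word_length \<sigma>) fL fR c) u))"

end

theory Submission
  imports Defs
begin

text \<open>
  Let \<open>n\<close> be the length of the band and \<open>{a..b}\<close> the set of positions of \<open>\<tau>\<close> that carry the overlap,
  so that \<open>l n \<le> b - a < (l + 1) n\<close>.  Rotate \<open>\<sigma>\<close> so that it starts where the overlap starts.  Then
  the overlap reads \<open>\<sigma>\<^sup>l \<beta>\<close> for a proper prefix \<open>\<beta>\<close> of \<open>\<sigma>\<close>, and \<open>\<tau> = \<delta> \<sigma>\<^sup>l \<beta> \<gamma>\<close>.  The word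
  \<open>c = \<delta> \<sigma>\<^sup>l\<^sup>-\<^sup>1 \<beta> \<gamma>\<close> arises from \<open>\<tau>\<close> by cutting out \<open>n\<close> consecutive positions.  It is a homotopy
  word in which no letters merge: its junctions occur in \<open>\<tau>\<close>, except possibly when \<open>l = 1\<close> and \<open>\<beta>\<close> is
  trivial, where the end conditions and gentleness give the new junction (\<open>cut_junction\<close>).

  The graph map \<open>f\<close> is split injective in each degree, because the last \<open>n\<close> positions of the overlap
  contain every vertex of the band exactly once and \<open>f\<close> is a nonzero scalar there.  Hence its cone is
  homotopy equivalent to its cokernel (\<open>cone_of_split_mono\<close>), and it suffices to identify the
  cokernel with the complex of \<open>c\<close>.

  The words \<open>\<tau>\<close> and \<open>c\<close> share two overlaps: one consists of everything in \<open>c\<close> up to the end of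
  \<open>\<sigma>\<^sup>l\<^sup>-\<^sup>1 \<beta>\<close>, the other of everything from the beginning of \<open>\<sigma>\<^sup>l\<^sup>-\<^sup>1 \<beta>\<close> on.  At their inner ends they
  satisfy the end conditions of \<open>f\<close>, so they determine graph maps \<open>q\<^sub>1\<close> and \<open>q\<^sub>2\<close> from the complex of
  \<open>\<tau>\<close> to that of \<open>c\<close>.  The composites of \<open>f\<close> with \<open>q\<^sub>1\<close> and \<open>q\<^sub>2\<close> have the same components up to
  scalars, which are the scalars of \<open>f\<close> at positions at distance \<open>n\<close>.  As \<open>f\<close> is a chain map, these
  differ by the band parameter \<open>\<lambda>\<close> (\<open>scalar_period\<close>), so that \<open>q\<^sub>1 - \<lambda> q\<^sub>2\<close> vanishes on the image of \<open>f\<close>.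
  An element of the complex of \<open>\<tau>\<close> that is zero on the last \<open>n\<close> positions of the overlap can be
  recovered from its image under \<open>q\<^sub>1 - \<lambda> q\<^sub>2\<close>, and this image is arbitrary (\<open>quot_retr_inj\<close>,
  \<open>quot_retr_surj\<close>).  So \<open>q\<^sub>1 - \<lambda> q\<^sub>2\<close> is the cokernel of \<open>f\<close>.

  For infinite \<open>\<tau>\<close> it remains to see that \<open>\<gamma>\<close>, \<open>\<delta>\<close> and \<open>c\<close> are homotopy strings.  In degrees far from
  zero, the complex of \<open>c\<close> is isomorphic to that of \<open>\<tau>\<close>, and those of \<open>\<gamma>\<close> and \<open>\<delta>\<close> are direct summands
  of it.
\<close>

section \<open>Right multiplication by a path\<close>

abbreviation rmul :: "('v, 'a) pre_digraph \<Rightarrow> ('a \<times> 'a) set \<Rightarrow> (('v, 'a) qpath \<Rightarrow> 'k::field)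
    \<Rightarrow> ('v, 'a) qpath \<Rightarrow> ('v, 'a) qpath \<Rightarrow> 'k" where
  "rmul G R u p \<equiv> lmult G R u (path_elt 1 p)"

definition scale :: "'k \<Rightarrow> ('p \<Rightarrow> 'k) \<Rightarrow> 'p \<Rightarrow> 'k::field" where
  "scale k u = (\<lambda>p. k * u p)"

lemma scale_zero [simp]: "scale k 0 = 0" "scale 0 u = 0"
  by (auto simp: scale_def fun_eq_iff)

lemma scale_one [simp]: "scale 1 u = u"
  by (auto simp: scale_def)

lemma scale_scale [simp]: "scale k (scale k' u) = scale (k * k') u"
  by (auto simp: scale_def fun_eq_iff)

lemma scale_add: "scale k (u + v) = scale k u + scale k v"
  by (auto simp: scale_def fun_eq_iff algebra_simps)

lemma pend_append: "pend G (x, as @ bs) = pend G (pend G (x, as), bs)"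
  by (simp add: pend_def)

lemma lmult_eq:
  "lmult G R u v r = (\<Sum>x\<in>{x. is_prod G R (fst x) (snd x) r}. u (fst x) * v (snd x))"
  unfolding lmult_def case_prod_beta ..

lemma lmult_zero_left [simp]: "lmult G R 0 v = 0"
  by (auto simp: lmult_def fun_eq_iff case_prod_beta)

lemma lmult_zero_right [simp]: "lmult G R u 0 = 0"
  by (auto simp: lmult_def fun_eq_iff case_prod_beta)

lemma lmult_add_left: "lmult G R (u + u') v = lmult G R u v + lmult G R u' v"
  by (auto simp: lmult_def fun_eq_iff case_prod_beta sum.distrib algebra_simps)

lemma lmult_add_right: "lmult G R u (v + v') = lmult G R u v + lmult G R u v'"
  by (auto simp: lmult_def fun_eq_iff case_prod_beta sum.distrib algebra_simps)

lemma lmult_scale_left: "lmult G R (scale k u) v = scale k (lmult G R u v)"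
  by (auto simp: lmult_def scale_def fun_eq_iff case_prod_beta sum_distrib_left algebra_simps)

lemma lmult_scale_right: "lmult G R u (scale k v) = scale k (lmult G R u v)"
  by (auto simp: lmult_def scale_def fun_eq_iff case_prod_beta sum_distrib_left algebra_simps)

lemma lmult_sum_right: "lmult G R u (\<Sum>i\<in>A. v i) = (\<Sum>i\<in>A. lmult G R u (v i))"
proof (induction A rule: infinite_finite_induct)
  case (insert x F)
  then show ?case by (simp only: sum.insert[OF insert(1,2)] lmult_add_right)
qed (simp_all only: sum.infinite sum.empty lmult_zero_right not_False_eq_True)

lemma path_elt_scale: "path_elt c p = scale c (path_elt 1 p)"
  by (auto simp: path_elt_def scale_def)

lemma proj_zero [simp]: "0 \<in> proj G R x"
  by (simp add: proj_def Lam_def)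

lemma proj_add: "u \<in> proj G R x \<Longrightarrow> v \<in> proj G R x \<Longrightarrow> u + v \<in> proj G R x"
  unfolding proj_def Lam_def by (simp add: plus_fun_def) (metis add.right_neutral)

lemma proj_minus: "u \<in> proj G R x \<Longrightarrow> - u \<in> proj G R x"
  by (auto simp: proj_def Lam_def)

lemma proj_scale: "u \<in> proj G R x \<Longrightarrow> scale k u \<in> proj G R x"
  by (auto simp: proj_def Lam_def scale_def)

context gentle_algebra
begin

lemma nonzero_appendD:
  assumes "nonzero_path G R (x, as @ bs)"
  shows "nonzero_path G R (x, as)" "nonzero_path G R (pend G (x, as), bs)"
proof -
  have w: "awalk x as (awlast x as)" "awalk (awlast x as) bs (pend G (x, as @ bs))"
    using assms by (auto simp: nonzero_path_def pstart_def)
  moreover have "awlast x as = pend G (x, as)"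
    by (simp add: pend_def awalk_verts_conv)
  ultimately show "nonzero_path G R (x, as)" "nonzero_path G R (pend G (x, as), bs)"
    using assms by (auto simp: nonzero_path_def pstart_def successively_append_iff pend_append)
qed

lemma nonzero_trivial: "nonzero_path G R (x, []) \<longleftrightarrow> x \<in> verts G"
  by (auto simp: nonzero_path_def pstart_def pend_def awalk_Nil_iff)

lemma nonzero_arcs: "nonzero_path G R p \<Longrightarrow> set (snd p) \<subseteq> arcs G"
  by (auto simp: nonzero_path_def)

lemma nonzero_start: "nonzero_path G R p \<Longrightarrow> fst p \<in> verts G"
  by (auto simp: nonzero_path_def pstart_def)

text \<open>
  The four conclusions are those that the uniqueness conditions of a gentle algebra ask of a
  neighbouring arrow.
\<close>

lemma nonzero_append_link:
  assumes "nonzero_path G R (x, as @ bs)" "as \<noteq> []" "bs \<noteq> []"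
  shows "last as \<in> arcs G" "hd bs \<in> arcs G" "head G (last as) = tail G (hd bs)"
    "(hd bs, last as) \<notin> R"
proof -
  have "set (as @ bs) \<subseteq> arcs G"
    using nonzero_arcs[OF assms(1)] by simp
  with assms(2,3) show "last as \<in> arcs G" "hd bs \<in> arcs G"
    by auto
  have "nonzero_path G R (pend G (x, as), bs)"
    by (rule nonzero_appendD[OF assms(1)])
  with assms(2,3) show "head G (last as) = tail G (hd bs)"
    by (cases bs) (auto simp: nonzero_path_def pstart_def pend_def awalk_def)
  show "(hd bs, last as) \<notin> R"
    using assms by (auto simp: nonzero_path_def successively_append_iff)
qed

lemma is_prodI:
  "nonzero_path G R (x, as @ bs) \<Longrightarrow> is_prod G R (pend G (x, as), bs) (x, as) (x, as @ bs)"
  using nonzero_appendD[of x as bs] by (auto simp: is_prod_def pstart_def)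

lemma is_prodD:
  assumes "is_prod G R q p r"
  shows "nonzero_path G R q" "nonzero_path G R p" "nonzero_path G R r" "fst q = pend G p"
    "fst r = fst p" "snd r = snd p @ snd q" "pend G r = pend G q"
  using assms by (auto simp: is_prod_def pstart_def pend_def)

lemma is_prod_link:
  assumes "is_prod G R q p r" "nontrivial q" "nontrivial p"
  shows "last (snd p) \<in> arcs G" "hd (snd q) \<in> arcs G"
    "head G (last (snd p)) = tail G (hd (snd q))" "(hd (snd q), last (snd p)) \<notin> R"
proof -
  have "r = (fst r, snd p @ snd q)"
    using is_prodD(6)[OF assms(1)] by (metis prod.collapse)
  then have "nonzero_path G R (fst r, snd p @ snd q)"
    using is_prodD(3)[OF assms(1)] by metis
  from nonzero_append_link[OF this] assms(2,3)
  show "last (snd p) \<in> arcs G" "hd (snd q) \<in> arcs G"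
    "head G (last (snd p)) = tail G (hd (snd q))" "(hd (snd q), last (snd p)) \<notin> R"
    by (simp_all add: nontrivial_def)
qed

lemma is_prod_trivial_left:
  "nonzero_path G R p \<Longrightarrow> v = pend G p \<Longrightarrow> is_prod G R (v, []) p p"
  by (auto simp: is_prod_def pstart_def nonzero_trivial) (auto simp: nonzero_path_def)

lemma is_prod_trivial_right:
  "nonzero_path G R p \<Longrightarrow> v = fst p \<Longrightarrow> is_prod G R p (v, []) p"
  by (auto simp: is_prod_def pstart_def nonzero_trivial nonzero_start) (auto simp: pend_def)

lemma finite_prods: "finite {(q, p). is_prod G R q p r}"
  by (rule finite_subset[of _ "{p. nonzero_path G R p} \<times> {p. nonzero_path G R p}"])
    (auto simp: is_prod_def finite_dimensional)

text \<open>
  Right multiplication by a path removes an initial segment from the argument of the coefficient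
  function; all computations with products of paths below rest on this formula.
\<close>

lemma rmul_eq:
  "rmul G R u p r =
     (if nonzero_path G R r \<and> fst r = fst p \<and> take (length (snd p)) (snd r) = snd p
      then u (pend G p, drop (length (snd p)) (snd r)) else (0::'k::field))"
proof -
  let ?S = "{x. is_prod G R (fst x) (snd x) r}"
  have fin: "finite ?S"
    using finite_prods[of r] unfolding case_prod_beta by simp
  let ?q = "(pend G p, drop (length (snd p)) (snd r))"
  have *: "rmul G R u p r = (\<Sum>x\<in>?S \<inter> {x. x = (?q, p)}. u (fst x))"
    unfolding lmult_def case_prod_beta path_elt_def
  proof (rule sum.mono_neutral_cong_right)
    show "\<forall>i\<in>?S - ?S \<inter> {x. x = (?q, p)}. u (fst i) * (if snd i = p then 1 else 0) = 0"
      by (auto simp: is_prod_def pstart_def prod_eq_iff)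
  qed (use fin in auto)
  have "(?q, p) \<in> ?S \<longleftrightarrow> nonzero_path G R r \<and> fst r = fst p \<and> take (length (snd p)) (snd r) = snd p"
  proof
    assume "nonzero_path G R r \<and> fst r = fst p \<and> take (length (snd p)) (snd r) = snd p"
    then have r: "r = (fst p, snd p @ drop (length (snd p)) (snd r))" "nonzero_path G R r"
      by (metis append_take_drop_id prod.collapse, simp)
    then have "is_prod G R ?q (fst p, snd p) r"
      using is_prodI[of "fst p" "snd p" "drop (length (snd p)) (snd r)"] by (metis prod.collapse)
    then show "(?q, p) \<in> ?S" by simp
  next
    assume "(?q, p) \<in> ?S"
    then have "is_prod G R ?q p r" by simp
    then show "nonzero_path G R r \<and> fst r = fst p \<and> take (length (snd p)) (snd r) = snd p"
      by (metis append_eq_conv_conj is_prodD(3,5,6))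
  qed
  moreover have "?S \<inter> {x. x = (?q, p)} = (if (?q, p) \<in> ?S then {(?q, p)} else {})"
    by auto
  ultimately show ?thesis
    unfolding * by simp
qed

lemma rmul_trivial:
  assumes "u \<in> proj G R x"
  shows "rmul G R u (x, []) = u"
  using assms by (auto simp: fun_eq_iff rmul_eq proj_def Lam_def pend_def pstart_def)

lemma rmul_prod:
  assumes "is_prod G R q p r"
  shows "rmul G R (rmul G R u q) p = rmul G R u r"
proof
  fix s
  note d = is_prodD[OF assms]
  show "rmul G R (rmul G R u q) p s = rmul G R u r s"
  proof (cases "nonzero_path G R s \<and> fst s = fst p \<and> take (length (snd p)) (snd s) = snd p")
    case True
    then have s: "(fst p, snd p @ drop (length (snd p)) (snd s)) = s"
      by (metis append_take_drop_id prod.collapse)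
    with True have "nonzero_path G R (pend G p, drop (length (snd p)) (snd s))"
      using nonzero_appendD(2)[of "fst p" "snd p" "drop (length (snd p)) (snd s)"] by simp
    moreover have "take (length (snd r)) (snd s) = snd r \<longleftrightarrow>
        take (length (snd q)) (drop (length (snd p)) (snd s)) = snd q"
      using True d(6) by (simp add: take_add)
    ultimately show ?thesis
      using True d by (auto simp: rmul_eq add.commute)
  next
    case False
    moreover have "\<not> (nonzero_path G R s \<and> fst s = fst r \<and> take (length (snd r)) (snd s) = snd r)"
    proof
      assume s: "nonzero_path G R s \<and> fst s = fst r \<and> take (length (snd r)) (snd s) = snd r"
      then have "take (length (snd p)) (take (length (snd r)) (snd s)) = snd p"
        using d(6) by simp
      then show False
        using s False d(5,6) by (simp add: min_def split: if_splits)
    qed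
    ultimately show ?thesis
      by (auto simp: rmul_eq)
  qed
qed

text \<open>
  Every path in the support of the product begins with \<open>p\<close> followed by \<open>q\<close>.
\<close>

lemma rmul_rmul_nonzero:
  assumes "rmul G R (rmul G R u q) p \<noteq> 0" "nontrivial q" "nontrivial p"
  shows "last (snd p) \<in> arcs G \<and> hd (snd q) \<in> arcs G \<and>
    head G (last (snd p)) = tail G (hd (snd q)) \<and> (hd (snd q), last (snd p)) \<notin> R"
proof -
  obtain s where s: "rmul G R (rmul G R u q) p s \<noteq> 0"
    using assms(1) by (auto simp: fun_eq_iff)
  then have a: "nonzero_path G R s" "fst s = fst p" "take (length (snd p)) (snd s) = snd p"
    "take (length (snd q)) (drop (length (snd p)) (snd s)) = snd q"
    by (auto simp: rmul_eq split: if_splits)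
  define t where "t = drop (length (snd p)) (snd s)"
  have "s = (fst p, snd p @ t)"
    using a(2,3) by (metis append_take_drop_id prod.collapse t_def)
  moreover have "t \<noteq> []" "hd t = hd (snd q)"
    using a(4) assms(2) by (auto simp: t_def nontrivial_def simp del: drop_eq_Nil)
      (metis hd_take length_greater_0_conv)
  ultimately show ?thesis
    using nonzero_append_link[of "fst p" "snd p" t] a(1) assms(3) by (auto simp: nontrivial_def)
qed

lemma rmul_relation:
  assumes "(hd (snd q), last (snd p)) \<in> R" "nontrivial q" "nontrivial p"
  shows "rmul G R (rmul G R u q) p = 0"
  using rmul_rmul_nonzero[of u q p] assms by blast

lemma rmul_proj: "rmul G R u p \<in> proj G R (fst p)"
  by (auto simp: proj_def Lam_def rmul_eq pstart_def split: if_splits)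

lemma lmult_proj:
  assumes "u \<in> proj G R x"
  shows "lmult G R r u \<in> proj G R x"
proof -
  have "pstart s = x \<and> nonzero_path G R s" if s: "lmult G R r u s \<noteq> 0" for s
  proof -
    obtain q p where "is_prod G R q p s" "u p \<noteq> 0"
      using s unfolding lmult_def by (auto elim!: sum.not_neutral_contains_not_neutral)
    with assms show ?thesis by (cases p) (auto simp: is_prod_def proj_def pstart_def)
  qed
  then show ?thesis by (auto simp: proj_def Lam_def)
qed

lemma lmult_proj_right:
  assumes "\<And>p. v p \<noteq> 0 \<Longrightarrow> pstart p = x"
  shows "lmult G R u v \<in> proj G R x"
proof -
  have "pstart s = x \<and> nonzero_path G R s" if s: "lmult G R u v s \<noteq> 0" for s
  proof -
    obtain q p where "is_prod G R q p s" "v p \<noteq> 0"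
      using s unfolding lmult_def by (auto elim!: sum.not_neutral_contains_not_neutral)
    with assms show ?thesis by (cases p) (auto simp: is_prod_def proj_def pstart_def)
  qed
  then show ?thesis by (auto simp: proj_def Lam_def)
qed

lemma lmult_assoc:
  "lmult G R r (lmult G R u v) = lmult G R (lmult G R r u) (v :: _ \<Rightarrow> 'k::field)"
proof
  fix s
  let ?P = "\<lambda>s. {x. is_prod G R (fst x) (snd x) s}"
  have fin: "finite (?P s)" for s
    using finite_prods[of s] unfolding case_prod_beta by simp
  \<comment> \<open>Both sides are sums over the factorisations of \<open>s\<close> into three paths, which are stored as
    two nested factorisations into two paths.\<close>
  have "lmult G R r (lmult G R u v) s = (\<Sum>x\<in>?P s. \<Sum>y\<in>?P (snd x). r (fst x) * u (fst y) * v (snd y))"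
    by (simp add: lmult_eq sum_distrib_left mult.assoc)
  also have "\<dots> = (\<Sum>(x, y)\<in>Sigma (?P s) (\<lambda>x. ?P (snd x)). r (fst x) * u (fst y) * v (snd y))"
    by (rule sum.Sigma) (auto simp: fin)
  also have "\<dots> = (\<Sum>(x, y)\<in>Sigma (?P s) (\<lambda>x. ?P (fst x)). r (fst y) * u (snd y) * v (snd x))"
  proof (rule sum.reindex_bij_witness[where
        j = "\<lambda>((q, p), (a, b)). (((fst a, snd a @ snd q), b), (q, a))" and
        i = "\<lambda>((q, p), (a, b)). ((a, (fst p, snd p @ snd b)), (b, p))"], goal_cases)
    case (1 z)
    obtain q p a b where z: "z = ((q, p), (a, b))" by (metis prod.collapse)
    then have "is_prod G R q p s" "is_prod G R a b p" using 1 by auto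
    then show ?case unfolding z by (auto simp: is_prod_def pstart_def)
  next
    case (2 z)
    obtain q p a b where z: "z = ((q, p), (a, b))" by (metis prod.collapse)
    then have pr: "is_prod G R q p s" "is_prod G R a b p" using 2 by auto
    note d = is_prodD[OF pr(1)] is_prodD[OF pr(2)]
    have s: "s = (fst b, snd b @ snd a @ snd q)" "p = (fst b, snd b @ snd a)"
      using d(5,6,12,13) by (auto simp: prod_eq_iff)
    then have "nonzero_path G R (pend G (fst b, snd b), snd a @ snd q)"
      using d(3) nonzero_appendD(2) by blast
    moreover have "pend G (fst b, snd b) = fst a"
      using d(11) by simp
    ultimately have n: "nonzero_path G R (fst a, snd a @ snd q)" by simp
    have "pend G p = pend G a"
      using d(14) .
    then show ?case
      unfolding z using d n s by (auto simp: is_prod_def pstart_def)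
  next
    case (3 z)
    obtain q p a b where z: "z = ((q, p), (a, b))" by (metis prod.collapse)
    then have "is_prod G R q p s" "is_prod G R a b q" using 3 by auto
    then show ?case unfolding z by (auto simp: is_prod_def pstart_def)
  next
    case (4 z)
    obtain q p a b where z: "z = ((q, p), (a, b))" by (metis prod.collapse)
    then have pr: "is_prod G R q p s" "is_prod G R a b q" using 4 by auto
    note d = is_prodD[OF pr(1)] is_prodD[OF pr(2)]
    have s: "s = (fst p, (snd p @ snd b) @ snd a)" "q = (fst b, snd b @ snd a)"
      using d(5,6,12,13) by (auto simp: prod_eq_iff)
    then have n: "nonzero_path G R (fst p, snd p @ snd b)"
      using d(3) nonzero_appendD(1) by metis
    have "pend G (fst p, snd p @ snd b) = pend G b"
      using d(4,12) by (simp add: pend_append) (simp add: pend_def)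
    then show ?case
      unfolding z using d n s by (auto simp: is_prod_def pstart_def)
  next
    case (5 z)
    then show ?case by (auto simp: case_prod_beta)
  qed
  also have "\<dots> = (\<Sum>x\<in>?P s. \<Sum>y\<in>?P (fst x). r (fst y) * u (snd y) * v (snd x))"
    by (rule sum.Sigma[symmetric]) (auto simp: fin)
  also have "\<dots> = lmult G R (lmult G R r u) v s"
    by (simp add: lmult_eq sum_distrib_right)
  finally show "lmult G R r (lmult G R u v) s = lmult G R (lmult G R r u) v s" .
qed

end

section \<open>Cones of split monomorphisms\<close>

text \<open>
  The module structure and the differential of a complex.  The equation \<open>d d = 0\<close> is kept apart,
  because it passes from the middle term of a degreewise split sequence to the outer ones.
\<close>

definition dg_module :: "'r set \<Rightarrow> ('r, 'm::ab_group_add) mod_complex \<Rightarrow> bool" where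
  "dg_module A C \<longleftrightarrow>
     (\<forall>m. 0 \<in> cterm C m \<and>
        (\<forall>x\<in>cterm C m. - x \<in> cterm C m \<and>
           (\<forall>y\<in>cterm C m. x + y \<in> cterm C m \<and>
              (\<forall>r\<in>A. cact C r (x + y) = cact C r x + cact C r y)) \<and>
           (\<forall>r\<in>A. cact C r x \<in> cterm C m))) \<and>
     graded_linear A C C 1 (cdiff C)"

lemma dg_moduleD:
  assumes "dg_module A C"
  shows "0 \<in> cterm C m" "x \<in> cterm C m \<Longrightarrow> - x \<in> cterm C m"
    "x \<in> cterm C m \<Longrightarrow> y \<in> cterm C m \<Longrightarrow> x + y \<in> cterm C m"
    "x \<in> cterm C m \<Longrightarrow> y \<in> cterm C m \<Longrightarrow> r \<in> A \<Longrightarrow> cact C r (x + y) = cact C r x + cact C r y"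
    "x \<in> cterm C m \<Longrightarrow> r \<in> A \<Longrightarrow> cact C r x \<in> cterm C m"
    "graded_linear A C C 1 (cdiff C)"
  using assms by (auto simp: dg_module_def)

lemma dg_module_diff:
  "dg_module A C \<Longrightarrow> x \<in> cterm C m \<Longrightarrow> y \<in> cterm C m \<Longrightarrow> x - y \<in> cterm C m"
  using dg_moduleD(2,3)[of A C] by (metis diff_conv_add_uminus)

lemma dg_module_act_minus:
  assumes "dg_module A C" "x \<in> cterm C m" "r \<in> A"
  shows "cact C r (- x) = - cact C r x"
proof -
  have "cact C r (0 + 0) = cact C r 0 + cact C r 0"
    using dg_moduleD(1,4)[OF assms(1)] assms(3) by blast
  then have "cact C r 0 = 0" by simp
  moreover have "cact C r (x + - x) = cact C r x + cact C r (- x)"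
    using dg_moduleD[OF assms(1)] assms by blast
  ultimately show ?thesis by (simp add: eq_neg_iff_add_eq_0 add.commute)
qed

lemma graded_linearD:
  assumes "graded_linear A C D e f" "x \<in> cterm C m"
  shows "f m x \<in> cterm D (m + e)"
    "y \<in> cterm C m \<Longrightarrow> f m (x + y) = f m x + f m y"
    "r \<in> A \<Longrightarrow> f m (cact C r x) = cact D r (f m x)"
  using assms by (auto simp: graded_linear_def)

lemma graded_linear_zero:
  assumes "graded_linear A C D e f" "dg_module A C"
  shows "f m 0 = 0"
  using graded_linearD(2)[OF assms(1), of 0 m 0] dg_moduleD(1)[OF assms(2)] by auto

lemma graded_linear_minus:
  assumes "graded_linear A C D e f" "dg_module A C" "x \<in> cterm C m"
  shows "f m (- x) = - f m x"
  using graded_linearD(2)[OF assms(1,3), of "- x"] dg_moduleD(2)[OF assms(2,3)]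
    graded_linear_zero[OF assms(1,2), of m] by (simp add: eq_neg_iff_add_eq_0 add.commute)

lemma graded_linear_diff:
  assumes "graded_linear A C D e f" "dg_module A C" "x \<in> cterm C m" "y \<in> cterm C m"
  shows "f m (x - y) = f m x - f m y"
  using graded_linearD(2)[OF assms(1,3), of "- y"] dg_moduleD(2)[OF assms(2,4)]
    graded_linear_minus[OF assms(1,2,4)] by simp

text \<open>
  Let \<open>f\<close> be degreewise split mono with retraction \<open>r\<close> and cokernel \<open>q\<close>, and let \<open>i\<close> be the section
  of \<open>q\<close> with image the kernel of \<open>r\<close>, so that \<open>f r + i q = 1\<close>.  Neither \<open>r\<close> nor \<open>i\<close> commutes with the
  differentials, but \<open>(x, y) \<mapsto> q y\<close> and \<open>z \<mapsto> (- r d i z, i z)\<close> are inverse homotopy equivalences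
  between the cone of \<open>f\<close> and the cokernel, with homotopy \<open>(x, y) \<mapsto> (r y, 0)\<close>.
\<close>

lemma cone_of_split_mono:
  fixes P :: "('r, 'm::ab_group_add) mod_complex" and Q :: "('r, 'n::ab_group_add) mod_complex"
    and C :: "('r, 'o::ab_group_add) mod_complex"
  assumes P: "dg_module A P" and Q: "dg_module A Q" and C: "dg_module A C"
    and dd: "\<And>m x. x \<in> cterm Q m \<Longrightarrow> cdiff Q (m + 1) (cdiff Q m x) = 0"
    and f: "chain_map A P Q f" and q: "chain_map A Q C q" and r: "graded_linear A Q P 0 r"
    and rf: "\<And>m x. x \<in> cterm P m \<Longrightarrow> r m (f m x) = x"
    and qf: "\<And>m x. x \<in> cterm P m \<Longrightarrow> q m (f m x) = 0"
    and surj: "\<And>m y. y \<in> cterm C m \<Longrightarrow> \<exists>u\<in>cterm Q m. q m u = y \<and> r m u = 0"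
    and inj: "\<And>m u. u \<in> cterm Q m \<Longrightarrow> q m u = 0 \<Longrightarrow> r m u = 0 \<Longrightarrow> u = 0"
  shows "homotopy_iso A (mapping_cone P Q f) C"
proof -
  have fl: "graded_linear A P Q 0 f" and ql: "graded_linear A Q C 0 q"
    and fd: "\<And>m x. x \<in> cterm P m \<Longrightarrow> f (m + 1) (cdiff P m x) = cdiff Q m (f m x)"
    and qd: "\<And>m x. x \<in> cterm Q m \<Longrightarrow> q (m + 1) (cdiff Q m x) = cdiff C m (q m x)"
    using f q by (auto simp: chain_map_def)
  note dPl = dg_moduleD(6)[OF P] and dQl = dg_moduleD(6)[OF Q] and dCl = dg_moduleD(6)[OF C]
  define i where "i m y = (SOME u. u \<in> cterm Q m \<and> q m u = y \<and> r m u = 0)" for m y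
  have i: "i m y \<in> cterm Q m" "q m (i m y) = y" "r m (i m y) = 0" if "y \<in> cterm C m" for m y
    using someI_ex[of "\<lambda>u. u \<in> cterm Q m \<and> q m u = y \<and> r m u = 0"] surj[OF that]
    by (auto simp: i_def)
  have cl [simp]: "f m x \<in> cterm Q m" "cdiff P m x \<in> cterm P (m + 1)" if "x \<in> cterm P m" for m x
    using graded_linearD(1)[OF fl that] graded_linearD(1)[OF dPl that] by auto
  have clQ [simp]: "q m x \<in> cterm C m" "r m x \<in> cterm P m" "cdiff Q m x \<in> cterm Q (m + 1)"
    if "x \<in> cterm Q m" for m x
    using graded_linearD(1)[OF ql that] graded_linearD(1)[OF r that] graded_linearD(1)[OF dQl that]
    by auto
  have clC [simp]: "cdiff C m x \<in> cterm C (m + 1)" if "x \<in> cterm C m" for m x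
    using graded_linearD(1)[OF dCl that] by auto
  have ext: "u = v" if "u \<in> cterm Q m" "v \<in> cterm Q m" "q m u = q m v" "r m u = r m v" for m u v
    using inj[of "u - v" m] that graded_linear_diff[OF ql Q that(1,2)]
      graded_linear_diff[OF r Q that(1,2)] dg_module_diff[OF Q that(1,2)] by simp
  have i_unique: "i m y = u" if "u \<in> cterm Q m" "q m u = y" "r m u = 0" for m u y
    using that i[of y m] clQ(1)[OF that(1)] by (intro ext[of _ m]) auto
  have split: "f m (r m u) + i m (q m u) = u" if u: "u \<in> cterm Q m" for m u
  proof (rule ext[of _ m])
    show "f m (r m u) + i m (q m u) \<in> cterm Q m"
      using u i by (intro dg_moduleD(3)[OF Q]) auto
    show "q m (f m (r m u) + i m (q m u)) = q m u"
      using u i by (subst graded_linearD(2)[OF ql]) (auto simp: qf)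
    show "r m (f m (r m u) + i m (q m u)) = r m u"
      using u i by (subst graded_linearD(2)[OF r]) (auto simp: rf)
  qed (fact u)
  have il: "graded_linear A C Q 0 i"
    unfolding graded_linear_def
  proof (intro allI ballI conjI)
    fix m x y s
    assume x: "x \<in> cterm C m"
    show "i m x \<in> cterm Q (m + 0)" using i x by simp
    show "i m (x + y) = i m x + i m y" if y: "y \<in> cterm C m"
      by (rule i_unique)
        (use x y i dg_moduleD(3)[OF Q] graded_linearD(2)[OF ql] graded_linearD(2)[OF r] in auto)
    show "i m (cact C s x) = cact Q s (i m x)" if s: "s \<in> A"
    proof (rule i_unique)
      have "r m (cact Q s (i m x)) = cact P s (r m (i m x))"
        using graded_linearD(3)[OF r] s x i by auto
      also have "\<dots> = cact P s (r m (i m 0))"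
        using i x dg_moduleD(1)[OF C] by simp
      also have "\<dots> = 0"
      proof -
        have "cact P s (0 + 0) = cact P s 0 + cact P s 0"
          using dg_moduleD(1,4)[OF P] s by blast
        then show ?thesis using i(3)[OF dg_moduleD(1)[OF C]] by simp
      qed
      finally show "r m (cact Q s (i m x)) = 0" .
    qed (use x s i dg_moduleD(5)[OF Q] graded_linearD(3)[OF ql] in auto)
  qed
  define t where "t m z = r (m + 1) (cdiff Q m (i m z))" for m z
  have t: "t m z \<in> cterm P (m + 1)" if "z \<in> cterm C m" for m z
    using that i by (simp add: t_def)
  have tl: "t m (x + y) = t m x + t m y" if "x \<in> cterm C m" "y \<in> cterm C m" for m x y
    using that i unfolding t_def
    by (simp add: graded_linearD(2)[OF il] graded_linearD(2)[OF dQl] graded_linearD(2)[OF r])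
  have ta: "t m (cact C s x) = cact P s (t m x)" if "x \<in> cterm C m" "s \<in> A" for m x s
    using that i unfolding t_def
    by (simp add: graded_linearD(3)[OF il] graded_linearD(3)[OF dQl] graded_linearD(3)[OF r])
  have di: "cdiff Q m (i m z) = f (m + 1) (t m z) + i (m + 1) (cdiff C m z)"
    if z: "z \<in> cterm C m" for m z
    using split[of "cdiff Q m (i m z)" "m + 1"] z i by (simp add: t_def qd)
  have ddP: "cdiff P (m + 1) (cdiff P m x) = 0" if x: "x \<in> cterm P m" for m x
  proof -
    have "f (m + 1 + 1) (cdiff P (m + 1) (cdiff P m x)) = 0"
      using x by (simp only: fd cl dd)
    then have "r (m + 1 + 1) (f (m + 1 + 1) (cdiff P (m + 1) (cdiff P m x))) = 0"
      using graded_linear_zero[OF r Q] by simp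
    then show ?thesis using x by (simp only: rf cl)
  qed
  have dt: "cdiff P (m + 1) (t m z) + t (m + 1) (cdiff C m z) = 0" if z: "z \<in> cterm C m" for m z
  proof -
    let ?d = "cdiff C m z"
    have [simp]: "i (m + 1) ?d \<in> cterm Q (m + 1)" "t m z \<in> cterm P (m + 1)"
      using z i t by auto
    have "0 = cdiff Q (m + 1) (cdiff Q m (i m z))"
      using dd i z by simp
    also have "\<dots> = cdiff Q (m + 1) (f (m + 1) (t m z)) + cdiff Q (m + 1) (i (m + 1) ?d)"
      unfolding di[OF z] by (rule graded_linearD(2)[OF dQl]) auto
    finally have "r (m + 1 + 1) (f (m + 1 + 1) (cdiff P (m + 1) (t m z)) + cdiff Q (m + 1) (i (m + 1) ?d)) = 0"
      using graded_linear_zero[OF r Q] by (simp only: fd[symmetric] \<open>t m z \<in> _\<close>)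
    moreover have a: "cdiff P (m + 1) (t m z) \<in> cterm P (m + 1 + 1)"
      "cdiff Q (m + 1) (i (m + 1) ?d) \<in> cterm Q (m + 1 + 1)"
      by (rule cl clQ, simp)+
    ultimately show ?thesis
      using graded_linearD(2)[OF r cl(1)[OF a(1)] a(2)] rf[OF a(1)] by (simp add: t_def[of "m + 1"])
  qed
  let ?M = "mapping_cone P Q f"
  let ?F = "\<lambda>m (xy :: 'm \<times> 'n). q m (snd xy)"
  let ?G = "\<lambda>m z. (- t m z, i m z)"
  have F: "chain_map A ?M C ?F"
    unfolding chain_map_def graded_linear_def mapping_cone_def
    using qf by (auto simp: graded_linearD[OF ql] qd)
  have "cact P s (- t m x) = - cact P s (t m x)" if "s \<in> A" "x \<in> cterm C m" for s m x
    using dg_module_act_minus[OF P] t that by blast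
  moreover have "cdiff P (m + 1) (- t m x) = t (m + 1) (cdiff C m x)" if "x \<in> cterm C m" for m x
    using graded_linear_minus[OF dPl P t[OF that]] dt[OF that] by (simp add: add_eq_0_iff)
  moreover have "f (m + 1) (- t m x) = - f (m + 1) (t m x)" if "x \<in> cterm C m" for m x
    using graded_linear_minus[OF fl P t[OF that]] .
  ultimately have G: "chain_map A C ?M ?G"
    unfolding chain_map_def graded_linear_def mapping_cone_def
    using i t by (auto simp: dg_moduleD(2)[OF P] tl ta graded_linearD[OF il] di)
  have FG: "chain_homotopic A C C (\<lambda>m x. ?F m (?G m x)) (\<lambda>m x. x)"
    unfolding chain_homotopic_def
    by (rule exI[of _ "\<lambda>_ _. 0"])
      (use i graded_linear_zero[OF dCl C] in \<open>auto simp: graded_linear_def dg_moduleD(1)[OF C]\<close>,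
       metis add_0 dg_moduleD(1,4)[OF C] add_left_cancel add.right_neutral)
  let ?H = "\<lambda>m (xy :: 'm \<times> 'n). (- r m (snd xy), 0 :: 'n)"
  have "graded_linear A ?M ?M (- 1) ?H"
  proof -
    have "cact Q s 0 = 0" if "s \<in> A" for s
      using dg_moduleD(4)[OF Q dg_moduleD(1)[OF Q] dg_moduleD(1)[OF Q] that] by simp
    then show ?thesis
      unfolding graded_linear_def mapping_cone_def
      by (auto simp: dg_moduleD[OF P] dg_moduleD(1)[OF Q] graded_linearD[OF r] dg_module_act_minus[OF P clQ(2)])
  qed
  moreover have "(- t m (q m y), i m (q m y)) - (x, y) =
      cdiff ?M (m - 1) (- r m y, 0) + (- r (m + 1) (f (m + 1) x + cdiff Q m y), 0)"
    if x: "x \<in> cterm P (m + 1)" and y: "y \<in> cterm Q m" for m x y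
  proof -
    have "cdiff P m (- r m y) = - cdiff P m (r m y)"
      using graded_linear_minus[OF dPl P, of "r m y" m] y by simp
    moreover have "f m (- r m y) = - f m (r m y)"
      using graded_linear_minus[OF fl P, of "r m y" m] y by simp
    moreover have "r (m + 1) (f (m + 1) x + cdiff Q m y) = x + r (m + 1) (cdiff Q m y)"
      using x y by (simp add: graded_linearD(2)[OF r] rf)
    moreover have iq: "i m (q m y) = y - f m (r m y)"
      using split[OF y] by (simp add: algebra_simps)
    moreover have "t m (q m y) = r (m + 1) (cdiff Q m y) - cdiff P m (r m y)"
    proof -
      have [simp]: "f m (r m y) \<in> cterm Q m"
        using y by simp
      have "cdiff Q m (i m (q m y)) = cdiff Q m y - f (m + 1) (cdiff P m (r m y))"
        unfolding iq using y by (simp add: graded_linear_diff[OF dQl Q] fd)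
      then show ?thesis
        using y by (simp add: t_def graded_linear_diff[OF r Q] rf)
    qed
    ultimately show ?thesis
      using graded_linear_zero[OF dQl Q, of "m - 1"] by (simp add: mapping_cone_def)
  qed
  ultimately have GF: "chain_homotopic A ?M ?M (\<lambda>m x. ?G m (?F m x)) (\<lambda>m x. x)"
    unfolding chain_homotopic_def by (intro exI[of _ ?H]) (auto simp: mapping_cone_def)
  show ?thesis
    unfolding homotopy_iso_def using F G FG GF by blast
qed

text \<open>
  In the degrees in which \<open>P\<close> vanishes, \<open>q\<close> is bijective, so exactness passes from \<open>Q\<close> to \<open>C\<close>.
\<close>

lemma cokernel_bounded_cohomology:
  assumes P: "dg_module A P" and Q: "dg_module A Q" and C: "dg_module A C"
    and dd: "\<And>m x. x \<in> cterm Q m \<Longrightarrow> cdiff Q (m + 1) (cdiff Q m x) = 0"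
    and q: "chain_map A Q C q" and r: "graded_linear A Q P 0 r"
    and surj: "\<And>m y. y \<in> cterm C m \<Longrightarrow> \<exists>u\<in>cterm Q m. q m u = y \<and> r m u = 0"
    and inj: "\<And>m u. u \<in> cterm Q m \<Longrightarrow> q m u = 0 \<Longrightarrow> r m u = 0 \<Longrightarrow> u = 0"
    and fin: "finite {m. cterm P m \<noteq> {0}}"
    and exact: "bounded_cohomology Q"
  shows "bounded_cohomology C"
proof -
  have ql: "graded_linear A Q C 0 q"
    and qd: "\<And>m x. x \<in> cterm Q m \<Longrightarrow> q (m + 1) (cdiff Q m x) = cdiff C m (q m x)"
    using q by (auto simp: chain_map_def)
  note dQl = dg_moduleD(6)[OF Q]
  obtain N where N: "\<And>m. \<bar>m\<bar> > N \<Longrightarrow>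
      {x \<in> cterm Q m. cdiff Q m x = 0} = cdiff Q (m - 1) ` cterm Q (m - 1)"
    using exact by (auto simp: bounded_cohomology_def)
  obtain M where M: "\<And>m. cterm P m \<noteq> {0} \<Longrightarrow> \<bar>m\<bar> \<le> M"
  proof
    show "\<bar>m\<bar> \<le> Max (abs ` {m. cterm P m \<noteq> {0}})" if "cterm P m \<noteq> {0}" for m
      using fin that by (intro Max_ge) auto
  qed
  have "{x \<in> cterm C m. cdiff C m x = 0} = cdiff C (m - 1) ` cterm C (m - 1)"
    if m: "\<bar>m\<bar> > max N (M + 1)" for m
  proof (intro equalityI subsetI)
    fix y assume y: "y \<in> {x \<in> cterm C m. cdiff C m x = 0}"
    then obtain u where u: "u \<in> cterm Q m" "q m u = y"
      using surj by blast
    have du: "cdiff Q m u \<in> cterm Q (m + 1)"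
      using graded_linearD(1)[OF dQl u(1)] .
    have "cterm P (m + 1) = {0}"
      using M[of "m + 1"] m by fastforce
    then have "r (m + 1) (cdiff Q m u) = 0"
      using graded_linearD(1)[OF r du] by simp
    moreover have "q (m + 1) (cdiff Q m u) = 0"
      using u y by (simp add: qd)
    ultimately have "cdiff Q m u = 0"
      using inj du by blast
    then obtain z where z: "z \<in> cterm Q (m - 1)" "u = cdiff Q (m - 1) z"
      using N[of m] m u by auto
    then have "y = cdiff C (m - 1) (q (m - 1) z)"
      using qd[OF z(1)] u by simp
    then show "y \<in> cdiff C (m - 1) ` cterm C (m - 1)"
      using graded_linearD(1)[OF ql z(1)] by auto
  next
    fix y assume "y \<in> cdiff C (m - 1) ` cterm C (m - 1)"
    then obtain u where u: "u \<in> cterm Q (m - 1)" "y = cdiff C (m - 1) (q (m - 1) u)"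
      using surj by blast
    then have y: "y = q m (cdiff Q (m - 1) u)" "cdiff Q (m - 1) u \<in> cterm Q m"
      using qd[OF u(1)] graded_linearD(1)[OF dQl u(1)] by auto
    then have "cdiff C m y = q (m + 1) 0"
      using qd[OF y(2)] dd[OF u(1)] by simp
    then show "y \<in> {x \<in> cterm C m. cdiff C m x = 0}"
      using y graded_linearD(1)[OF ql y(2)] graded_linear_zero[OF ql Q] by simp
  qed
  then show ?thesis
    unfolding bounded_cohomology_def by blast
qed

section \<open>The differentials of string and band complexes\<close>

fun flip :: "('v, 'a) letter \<Rightarrow> ('v, 'a) letter" where
  "flip (Dir p) = Inv p"
| "flip (Inv p) = Dir p"

fun entry :: "('v, 'a) letter option \<Rightarrow> ('v, 'a) qpath \<Rightarrow> 'k::field" where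
  "entry (Some (Inv p)) = path_elt 1 p"
| "entry _ = 0"

text \<open>
  Seen from a position, the letter \<open>l\<close> to its right contributes to the differential with target this
  position iff \<open>l\<close> is inverse, and the letter to its left does so iff it is direct, that is, iff its
  flip is inverse.  This reduces each statement about left ends to the one about right ends.
\<close>

abbreviation incoming :: "('v, 'a) pre_digraph \<Rightarrow> ('a \<times> 'a) set \<Rightarrow> ('v, 'a) letter option
    \<Rightarrow> (('v, 'a) qpath \<Rightarrow> 'k::field) \<Rightarrow> ('v, 'a) qpath \<Rightarrow> 'k" where
  "incoming G R l u \<equiv> lmult G R u (entry l)"

abbreviation flipped_left :: "('v, 'a) word \<Rightarrow> int \<Rightarrow> ('v, 'a) letter option" where
  "flipped_left w j \<equiv> map_option flip (left_letter w j)"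

lemma letter_entry_eq:
  "letter_entry c l a b i j =
     (if i = b \<and> j = a then scale c (entry (Some l)) else 0) +
     (if i = a \<and> j = b then scale c (entry (Some (flip l))) else 0)"
proof (cases l)
  case (Dir p)
  show ?thesis
    unfolding Dir letter_entry.simps flip.simps entry.simps by (subst path_elt_scale) simp
next
  case (Inv p)
  show ?thesis
    unfolding Inv letter_entry.simps flip.simps entry.simps by (subst path_elt_scale) simp
qed

text \<open>
  The matrices of the two differentials, sorted by the target: at most two letters meet at a
  position.  In a band of length two these letters join the same two positions, and their
  contributions to the matrix entry add up.
\<close>

definition string_matrix :: "('v, 'a) word \<Rightarrow> int \<Rightarrow> int \<Rightarrow> ('v, 'a) qpath \<Rightarrow> 'k::field" where
  "string_matrix w i j = (if i = j + 1 then entry (right_letter w j) else 0) +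
     (if i = j - 1 then entry (flipped_left w j) else 0)"

definition band_matrix :: "('v, 'a) word \<Rightarrow> 'k \<Rightarrow> int \<Rightarrow> int \<Rightarrow> int \<Rightarrow> ('v, 'a) qpath \<Rightarrow> 'k::field" where
  "band_matrix w c d i j =
     (if i = (j + 1) mod word_length w
      then scale (if j = d then c else 1) (entry (Some (ltr w j))) else 0) +
     (if i = (j - 1) mod word_length w
      then scale (if i = d then c else 1) (entry (Some (flip (ltr w i)))) else 0)"

lemma proj_complex_cong:
  assumes "\<And>i j. D i j = D' i j"
  shows "proj_complex G R J x dg D = proj_complex G R J x dg D'"
proof -
  have "D = D'" by (intro ext assms[THEN fun_cong])
  then show ?thesis by simp
qed

lemma string_complex_matrix:
  "string_complex G R w = proj_complex G R (pos w) (vtx w) (deg w) (string_matrix w)"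
proof -
  have "(\<Sum>k | k \<in> links w \<and> (k = i \<or> k = j). letter_entry 1 (ltr w k) k (k + 1) i j) =
      (string_matrix w i j :: _ \<Rightarrow> 'k::field)" for i j
  proof -
    let ?K = "{k. k \<in> links w \<and> (k = i \<or> k = j)}"
    have fin: "finite ?K"
      by (rule finite_subset[of _ "{i, j}"]) auto
    have "(\<Sum>k\<in>?K. letter_entry 1 (ltr w k) k (k + 1) i j) =
       (\<Sum>k\<in>?K. if k = j then (if i = j + 1 then entry (Some (ltr w j)) else 0) else 0) +
       (\<Sum>k\<in>?K. if k = i then (if i = j - 1 then entry (Some (flip (ltr w (j - 1)))) else 0) else
         (0 :: _ \<Rightarrow> 'k))"
      unfolding sum.distrib[symmetric] by (rule sum.cong) (auto simp: letter_entry_eq)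
    also have "\<dots> = string_matrix w i j"
      unfolding sum.delta[OF fin] by (auto simp: string_matrix_def right_letter_def left_letter_def)
    finally show ?thesis .
  qed
  then show ?thesis
    unfolding string_complex_def by (rule proj_complex_cong)
qed

lemma band_complex_matrix:
  assumes "word_length w > 0"
  shows "band_complex G R w c d = proj_complex G R {0..<word_length w} (vtx w) (deg w)
    (\<lambda>i j. if j \<in> {0..<word_length w} then band_matrix w c d i j else 0)"
  unfolding band_complex_def Let_def
proof (rule proj_complex_cong)
  fix i j
  let ?n = "word_length w" and ?c = "\<lambda>k. if k = d then c else 1"
  have "(\<Sum>k\<in>{0..<?n}. letter_entry (?c k) (ltr w k) k ((k + 1) mod ?n) i j) =
     (\<Sum>k\<in>{0..<?n}. if k = j then (if i = (j + 1) mod ?n then scale (?c j) (entry (Some (ltr w j))) else 0) else 0) +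
     (\<Sum>k\<in>{0..<?n}. if k = i then (if j = (i + 1) mod ?n then scale (?c i) (entry (Some (flip (ltr w i)))) else 0) else 0)"
    unfolding sum.distrib[symmetric] by (rule sum.cong) (auto simp: letter_entry_eq)
  moreover have "i \<in> {0..<?n} \<and> j = (i + 1) mod ?n \<longleftrightarrow> j \<in> {0..<?n} \<and> i = (j - 1) mod ?n"
  proof
    assume "i \<in> {0..<?n} \<and> j = (i + 1) mod ?n"
    then show "j \<in> {0..<?n} \<and> i = (j - 1) mod ?n"
      using assms by (auto simp: mod_simps)
  next
    assume "j \<in> {0..<?n} \<and> i = (j - 1) mod ?n"
    then show "i \<in> {0..<?n} \<and> j = (i + 1) mod ?n"
      using assms by (auto simp: mod_simps)
  qed
  ultimately show "(\<Sum>k\<in>{0..<?n}. letter_entry (?c k) (ltr w k) k ((k + 1) mod ?n) i j) =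
      (if j \<in> {0..<?n} then band_matrix w c d i j else 0)"
    by (auto simp: band_matrix_def)
qed

definition summand :: "('v, 'a) pre_digraph \<Rightarrow> ('a \<times> 'a) set \<Rightarrow> int set \<Rightarrow> (int \<Rightarrow> 'v) \<Rightarrow> (int \<Rightarrow> int)
    \<Rightarrow> int \<Rightarrow> int \<Rightarrow> (('v, 'a) qpath \<Rightarrow> 'k::field) set" where
  "summand G R J x dg m i = (if i \<in> J \<and> dg i = m then proj G R (x i) else {0})"

lemma summand_zero [simp]: "0 \<in> summand G R J x dg m i"
  by (simp add: summand_def)

lemma summand_add:
  "u \<in> summand G R J x dg m i \<Longrightarrow> v \<in> summand G R J x dg m i \<Longrightarrow> u + v \<in> summand G R J x dg m i"
  by (auto simp: summand_def proj_add split: if_splits)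

lemma summand_minus: "u \<in> summand G R J x dg m i \<Longrightarrow> - u \<in> summand G R J x dg m i"
  by (auto simp: summand_def proj_minus split: if_splits)

lemma summand_scale: "u \<in> summand G R J x dg m i \<Longrightarrow> scale k u \<in> summand G R J x dg m i"
  by (auto simp: summand_def proj_scale split: if_splits)

lemma summand_nonzero:
  "u \<in> summand G R J x dg m i \<Longrightarrow> u \<noteq> 0 \<Longrightarrow> i \<in> J \<and> dg i = m \<and> u \<in> proj G R (x i)"
  by (auto simp: summand_def split: if_splits)

lemma summand_proj: "u \<in> summand G R J x dg m i \<Longrightarrow> u \<in> proj G R (x i)"
  by (auto simp: summand_def split: if_splits)

lemma cterm_proj_complex:
  "u \<in> cterm (proj_complex G R J x dg D) m \<longleftrightarrow>
     finite {i. u i \<noteq> 0} \<and> (\<forall>i. u i \<in> summand G R J x dg m i)"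
  by (simp add: proj_complex_def summand_def)

lemma cact_proj_complex: "cact (proj_complex G R J x dg D) r u = (\<lambda>i. lmult G R r (u i))"
  by (simp add: proj_complex_def)

lemma cdiff_proj_complex: "cdiff (proj_complex G R J x dg D) m u = mat_map G R D u"
  by (simp add: proj_complex_def)

lemma mat_map_superset:
  assumes "finite A" "{i. u i \<noteq> 0} \<subseteq> A"
  shows "mat_map G R D u j = (\<Sum>i\<in>A. lmult G R (u i) (D i j))"
  unfolding mat_map_def by (rule sum.mono_neutral_left) (use assms in auto)

lemma mat_map_add:
  assumes "finite {i. u i \<noteq> 0}" "finite {i. v i \<noteq> 0}"
  shows "mat_map G R D (u + v) = mat_map G R D u + mat_map G R D v"
proof
  fix j
  let ?A = "{i. u i \<noteq> 0} \<union> {i. v i \<noteq> 0}"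
  have "{i. (u + v) i \<noteq> 0} \<subseteq> ?A"
    by (auto simp: plus_fun_def zero_fun_def)
  then show "mat_map G R D (u + v) j = (mat_map G R D u + mat_map G R D v) j"
    using assms by (simp add: mat_map_superset[of ?A] lmult_add_left sum.distrib)
qed

lemma mat_map_string:
  assumes "finite {i. u i \<noteq> 0}"
  shows "mat_map G R (string_matrix w) u j =
    incoming G R (right_letter w j) (u (j + 1)) + incoming G R (flipped_left w j) (u (j - 1))"
proof -
  let ?A = "{i. u i \<noteq> 0} \<union> {j + 1, j - 1}"
  have "mat_map G R (string_matrix w) u j = (\<Sum>i\<in>?A. lmult G R (u i) (string_matrix w i j))"
    by (rule mat_map_superset) (use assms in auto)
  also have "\<dots> = (\<Sum>i\<in>?A. if i = j + 1 then incoming G R (right_letter w j) (u (j + 1)) else 0) +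
      (\<Sum>i\<in>?A. if i = j - 1 then incoming G R (flipped_left w j) (u (j - 1)) else 0)"
    unfolding sum.distrib[symmetric] by (rule sum.cong) (auto simp: string_matrix_def lmult_add_right)
  also have "\<dots> = incoming G R (right_letter w j) (u (j + 1)) + incoming G R (flipped_left w j) (u (j - 1))"
    using assms by simp
  finally show ?thesis .
qed

lemma mat_map_band:
  assumes "finite {i. u i \<noteq> 0}" "j \<in> {0..<word_length w}"
  shows "mat_map G R (\<lambda>i j. if j \<in> {0..<word_length w} then band_matrix w c d i j else 0) u j =
    scale (if j = d then c else 1)
      (incoming G R (Some (ltr w j)) (u ((j + 1) mod word_length w))) +
    scale (if (j - 1) mod word_length w = d then c else 1)
      (incoming G R (Some (flip (ltr w ((j - 1) mod word_length w)))) (u ((j - 1) mod word_length w)))"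
    (is "_ = ?X + ?Y")
proof -
  let ?n = "word_length w"
  let ?A = "{i. u i \<noteq> 0} \<union> {(j + 1) mod ?n, (j - 1) mod ?n}"
  have "mat_map G R (\<lambda>i j. if j \<in> {0..<word_length w} then band_matrix w c d i j else 0) u j =
      (\<Sum>i\<in>?A. lmult G R (u i) (if j \<in> {0..<word_length w} then band_matrix w c d i j else 0))"
    by (rule mat_map_superset) (use assms in auto)
  also have "\<dots> = (\<Sum>i\<in>?A. if i = (j + 1) mod ?n then ?X else 0) +
      (\<Sum>i\<in>?A. if i = (j - 1) mod ?n then ?Y else 0)"
    unfolding sum.distrib[symmetric]
    by (rule sum.cong) (use assms(2) in \<open>auto simp: band_matrix_def lmult_add_right lmult_scale_right\<close>)
  also have "\<dots> = ?X + ?Y"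
    using assms by simp
  finally show ?thesis .
qed

context gentle_algebra
begin

text \<open>
  Right multiplication by a combination of paths that start at \<open>x j\<close> has its values in \<open>P(x j)\<close>,
  whatever it is applied to.  This is why the matrix entries are constrained at one end only.
\<close>

lemma proj_complex_dg:
  assumes hom: "\<And>i j p. i \<in> J \<Longrightarrow> D i j p \<noteq> 0 \<Longrightarrow> j \<in> J \<and> dg j = dg i + 1 \<and> pstart p = x j"
    and fin: "\<And>i. i \<in> J \<Longrightarrow> finite {j. D i j \<noteq> 0}"
  shows "dg_module (Lam G R) (proj_complex G R J x dg D :: (_ \<Rightarrow> 'k::field, _) mod_complex)"
proof -
  let ?C = "proj_complex G R J x dg D :: (_ \<Rightarrow> 'k::field, _) mod_complex"
  have supp_J: "{i. u i \<noteq> 0} \<subseteq> J" if "u \<in> cterm ?C m" for u m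
    using that summand_nonzero unfolding cterm_proj_complex by blast
  have d: "mat_map G R D u \<in> cterm ?C (m + 1)" if u: "u \<in> cterm ?C m" for u m
    unfolding cterm_proj_complex
  proof
    have fu: "finite {i. u i \<noteq> 0}" and su: "\<And>i. u i \<in> summand G R J x dg m i"
      using u by (auto simp: cterm_proj_complex)
    have "{j. mat_map G R D u j \<noteq> 0} \<subseteq> (\<Union>i\<in>{i. u i \<noteq> 0}. {j. D i j \<noteq> 0})"
    proof
      fix j assume "j \<in> {j. mat_map G R D u j \<noteq> 0}"
      then obtain i where "u i \<noteq> 0" "lmult G R (u i) (D i j) \<noteq> 0"
        unfolding mat_map_def by (auto elim!: sum.not_neutral_contains_not_neutral)
      then show "j \<in> (\<Union>i\<in>{i. u i \<noteq> 0}. {j. D i j \<noteq> 0})"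
        by (auto simp: lmult_zero_right)
    qed
    then show "finite {j. mat_map G R D u j \<noteq> 0}"
      by (rule finite_subset) (use fu fin supp_J[OF u] in auto)
    show "\<forall>j. mat_map G R D u j \<in> summand G R J x dg (m + 1) j"
    proof
      fix j
      have z: "lmult G R (u i) (D i j) \<in> summand G R J x dg (m + 1) j" if i: "u i \<noteq> 0" for i
      proof (cases "D i j = 0")
        case False
        have iJ: "i \<in> J" "dg i = m"
          using summand_nonzero[OF su i] by auto
        obtain p where "D i j p \<noteq> 0"
          using False by (auto simp: fun_eq_iff)
        then have "j \<in> J" "dg j = m + 1"
          using hom iJ by auto
        moreover have "lmult G R (u i) (D i j) \<in> proj G R (x j)"
          by (rule lmult_proj_right) (use hom iJ in auto)
        ultimately show ?thesis by (simp add: summand_def)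
      qed simp
      have "(\<Sum>i\<in>A. lmult G R (u i) (D i j)) \<in> summand G R J x dg (m + 1) j"
        if "A \<subseteq> {i. u i \<noteq> 0}" for A
        using finite_subset[OF that fu] that
        by (induction A rule: finite_induct) (auto intro!: summand_add z)
      then show "mat_map G R D u j \<in> summand G R J x dg (m + 1) j"
        unfolding mat_map_def by blast
    qed
  qed
  have act: "(\<lambda>i. lmult G R r (u i)) \<in> cterm ?C m" if u: "u \<in> cterm ?C m" for r u m
    unfolding cterm_proj_complex
  proof
    show "finite {i. lmult G R r (u i) \<noteq> 0}"
      by (rule finite_subset[of _ "{i. u i \<noteq> 0}"])
        (use u in \<open>auto simp: cterm_proj_complex lmult_zero_right\<close>)
    show "\<forall>i. lmult G R r (u i) \<in> summand G R J x dg m i"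
      using u by (auto simp: cterm_proj_complex summand_def lmult_proj split: if_splits)
  qed
  have add: "u + v \<in> cterm ?C m" if "u \<in> cterm ?C m" "v \<in> cterm ?C m" for u v m
    unfolding cterm_proj_complex
  proof
    show "finite {i. (u + v) i \<noteq> 0}"
      by (rule finite_subset[of _ "{i. u i \<noteq> 0} \<union> {i. v i \<noteq> 0}"])
        (use that in \<open>auto simp: cterm_proj_complex plus_fun_def zero_fun_def\<close>)
    show "\<forall>i. (u + v) i \<in> summand G R J x dg m i"
    proof
      fix i
      show "(u + v) i \<in> summand G R J x dg m i"
        by (subst plus_fun_apply, rule summand_add) (use that in \<open>auto simp: cterm_proj_complex\<close>)
    qed
  qed
  have "graded_linear (Lam G R) ?C ?C 1 (cdiff ?C)"
    unfolding graded_linear_def cdiff_proj_complex cact_proj_complex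
  proof (intro allI ballI conjI)
    fix m u r assume u: "u \<in> cterm ?C m"
    have fu: "finite {i. u i \<noteq> 0}"
      using u by (auto simp: cterm_proj_complex)
    show "mat_map G R D u \<in> cterm ?C (m + 1)"
      by (rule d[OF u])
    show "mat_map G R D (u + v) = mat_map G R D u + mat_map G R D v" if v: "v \<in> cterm ?C m" for v
      by (rule mat_map_add) (use u v in \<open>auto simp: cterm_proj_complex\<close>)
    show "mat_map G R D (\<lambda>i. lmult G R r (u i)) = (\<lambda>i. lmult G R r (mat_map G R D u i))"
    proof
      fix j
      have "{i. lmult G R r (u i) \<noteq> 0} \<subseteq> {i. u i \<noteq> 0}"
        by (auto simp: lmult_zero_right)
      then show "mat_map G R D (\<lambda>i. lmult G R r (u i)) j = lmult G R r (mat_map G R D u j)"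
        using fu by (simp add: mat_map_superset[of "{i. u i \<noteq> 0}"] lmult_sum_right lmult_assoc)
    qed
  qed
  moreover have "- u \<in> cterm ?C m" if "u \<in> cterm ?C m" for u m
    using that by (auto simp: cterm_proj_complex intro: summand_minus)
  moreover have "0 \<in> cterm ?C m" for m
    by (simp add: cterm_proj_complex)
  ultimately show ?thesis
    using act add unfolding dg_module_def
    by (auto simp: cact_proj_complex lmult_add_right fun_eq_iff)
qed

lemma homotopy_wordD:
  assumes "homotopy_word G R w" "i \<in> links w"
  shows "nonzero_path G R (letter_path (ltr w i))" "nontrivial (letter_path (ltr w i))"
    "lend G (ltr w i) = vtx w i" "lstart G (ltr w i) = vtx w (i + 1)"
    "deg w (i + 1) = (if is_direct (ltr w i) then deg w i + 1 else deg w i - 1)"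
    "i + 1 \<in> links w \<Longrightarrow> junction R (ltr w i) (ltr w (i + 1))"
  using assms by (auto simp: homotopy_word_def)

lemma entry_nonzero: "entry (Some l) p \<noteq> (0::'k::field) \<Longrightarrow> l = Inv p"
  by (cases l) (auto simp: path_elt_def split: if_splits)

lemma right_entry:
  assumes "homotopy_word G R w" "entry (right_letter w j) p \<noteq> (0::'k::field)"
  shows "j \<in> links w" "ltr w j = Inv p" "deg w j = deg w (j + 1) + 1" "pstart p = vtx w j"
proof -
  have "j \<in> links w \<and> entry (Some (ltr w j)) p \<noteq> (0::'k)"
    using assms(2) by (auto simp: right_letter_def split: if_splits)
  then show j: "j \<in> links w" "ltr w j = Inv p"
    using entry_nonzero by blast+
  then show "deg w j = deg w (j + 1) + 1" "pstart p = vtx w j"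
    using homotopy_wordD[OF assms(1) j(1)] by auto
qed

lemma left_entry:
  assumes "homotopy_word G R w" "entry (flipped_left w j) p \<noteq> (0::'k::field)"
  shows "j - 1 \<in> links w" "ltr w (j - 1) = Dir p" "deg w j = deg w (j - 1) + 1" "pstart p = vtx w j"
proof -
  have j: "j - 1 \<in> links w" "flip (ltr w (j - 1)) = Inv p"
    using assms(2) entry_nonzero[of "flip (ltr w (j - 1))" p]
    by (auto simp: left_letter_def split: if_splits)
  then show j': "j - 1 \<in> links w" "ltr w (j - 1) = Dir p"
    by (cases "ltr w (j - 1)"; simp)+
  then show "deg w j = deg w (j - 1) + 1" "pstart p = vtx w j"
    using homotopy_wordD[OF assms(1) j(1)] by auto
qed

lemma string_complex_dg:
  assumes "homotopy_word G R w"
  shows "dg_module (Lam G R) (string_complex G R w :: (_ \<Rightarrow> 'k::field, _) mod_complex)"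
  unfolding string_complex_matrix
proof (rule proj_complex_dg)
  fix i j p assume "string_matrix w i j p \<noteq> (0::'k)"
  then consider "i = j + 1" "entry (right_letter w j) p \<noteq> (0::'k)"
    | "i = j - 1" "entry (flipped_left w j) p \<noteq> (0::'k)"
    by (fastforce simp: string_matrix_def split: if_splits)
  then show "j \<in> pos w \<and> deg w j = deg w i + 1 \<and> pstart p = vtx w j"
  proof cases
    case 1
    then show ?thesis using right_entry[OF assms 1(2)] by (auto simp: links_def)
  next
    case 2
    then show ?thesis using left_entry[OF assms 2(2)] by (auto simp: links_def)
  qed
next
  fix i
  show "finite {j. string_matrix w i j \<noteq> (0::_ \<Rightarrow> 'k)}"
    by (rule finite_subset[of _ "{i - 1, i + 1}"]) (auto simp: string_matrix_def split: if_splits)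
qed

lemma string_diff:
  assumes "u \<in> cterm (string_complex G R w) m"
  shows "cdiff (string_complex G R w) m' u j =
    incoming G R (right_letter w j) (u (j + 1)) + incoming G R (flipped_left w j) (u (j - 1))"
  using assms unfolding string_complex_matrix cterm_proj_complex cdiff_proj_complex
  by (intro mat_map_string) auto

text \<open>
  A position with an arrow into it and an arrow out of it lies between two letters of the same
  direction, whose junction is a relation.
\<close>

lemma string_diff_diff:
  assumes w: "homotopy_word G R w" and u: "u \<in> cterm (string_complex G R w) m"
  shows "cdiff (string_complex G R w) (m + 1) (cdiff (string_complex G R w) m u) = 0"
proof
  fix j
  let ?C = "string_complex G R w" and ?d = "cdiff (string_complex G R w) m u"
  have du: "?d \<in> cterm ?C (m + 1)"
    using graded_linearD(1)[OF dg_moduleD(6)[OF string_complex_dg[OF w]] u] .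
  have "incoming G R (right_letter w j) (?d (j + 1)) = 0"
  proof (cases "j \<in> links w \<and> (\<exists>p. ltr w j = Inv p)")
    case True
    then obtain p where p: "j \<in> links w" "ltr w j = Inv p" by blast
    have "?d (j + 1) = incoming G R (right_letter w (j + 1)) (u (j + 2))"
      using p by (simp add: string_diff[OF u] left_letter_def add.commute)
    moreover have "rmul G R (rmul G R (u (j + 2)) q) p = 0" if "right_letter w (j + 1) = Some (Inv q)" for q
      using that p homotopy_wordD[OF w p(1)] homotopy_wordD[OF w, of "j + 1"]
      by (intro rmul_relation) (auto simp: right_letter_def split: if_splits)
    ultimately show ?thesis
      using p by (cases "right_letter w (j + 1)" rule: entry.cases) (auto simp: right_letter_def)
  next
    case False
    then show ?thesis
      by (cases "ltr w j") (auto simp: right_letter_def)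
  qed
  moreover have "incoming G R (flipped_left w j) (?d (j - 1)) = 0"
  proof (cases "j - 1 \<in> links w \<and> (\<exists>p. ltr w (j - 1) = Dir p)")
    case True
    then obtain p where p: "j - 1 \<in> links w" "ltr w (j - 1) = Dir p" by blast
    have "?d (j - 1) = incoming G R (flipped_left w (j - 1)) (u (j - 2))"
      using p by (simp add: string_diff[OF u] right_letter_def)
    moreover have "rmul G R (rmul G R (u (j - 2)) q) p = 0" if "left_letter w (j - 1) = Some (Dir q)" for q
      using that p homotopy_wordD[OF w p(1)] homotopy_wordD[OF w, of "j - 2"]
      by (intro rmul_relation) (auto simp: left_letter_def split: if_splits)
    ultimately show ?thesis
      using p by (cases "left_letter w (j - 1)" rule: entry.cases) (auto simp: left_letter_def)
  next
    case False
    then show ?thesis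
      by (cases "ltr w (j - 1)") (auto simp: left_letter_def)
  qed
  ultimately show "cdiff ?C (m + 1) ?d j = 0 j"
    by (simp add: string_diff[OF du] zero_fun_def)
qed

lemma unfold_band_simps:
  "pos (unfold_band w) = UNIV" "vtx (unfold_band w) i = vtx w (i mod word_length w)"
  "deg (unfold_band w) i = deg w (i mod word_length w)"
  "ltr (unfold_band w) i = ltr w (i mod word_length w)" "links (unfold_band w) = UNIV"
  by (auto simp: unfold_band_def Let_def links_def)

lemma band_basics:
  assumes "homotopy_band G R w"
  shows "word_length w > 0" "pos w = {0..word_length w}"
    "vtx w (word_length w) = vtx w 0" "deg w (word_length w) = deg w 0"
  using assms by (auto simp: homotopy_band_def word_length_def)

text \<open>
  The junctions of the unfolded diagram all occur in \<open>\<sigma>\<^sup>2\<close>.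
\<close>

lemma homotopy_word_unfold:
  assumes b: "homotopy_band G R w"
  shows "homotopy_word G R (unfold_band w)"
proof -
  let ?n = "word_length w" and ?S = "unfold_band w"
  note bb = band_basics[OF b]
  have w: "homotopy_word G R w" and w2: "homotopy_word G R (band_power w 2)"
    using b by (auto simp: homotopy_band_def)
  have m: "i mod ?n \<in> {0..<?n}" for i
    using bb(1) by auto
  have lk: "i mod ?n \<in> links w" for i
    using m[of i] unfolding links_def bb(2) by (simp del: pos_mod_bound pos_mod_sign)
  have Suc: "vtx w (i mod ?n + 1) = vtx w ((i + 1) mod ?n)" "deg w (i mod ?n + 1) = deg w ((i + 1) mod ?n)" for i
  proof -
    have "(i + 1) mod ?n = (i mod ?n + 1) mod ?n" by (simp add: mod_simps)
    also have "\<dots> = (if i mod ?n + 1 = ?n then 0 else i mod ?n + 1)"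
      using m[of i] by auto
    finally show "vtx w (i mod ?n + 1) = vtx w ((i + 1) mod ?n)"
      "deg w (i mod ?n + 1) = deg w ((i + 1) mod ?n)"
      using bb by (auto split: if_splits)
  qed
  have "junction R (ltr ?S i) (ltr ?S (i + 1))" for i
  proof -
    let ?k = "i mod ?n"
    have "?k \<in> links (band_power w 2)" "?k + 1 \<in> links (band_power w 2)"
      using m[of i] bb(1)
      by (simp_all add: links_def band_power_def window_def del: pos_mod_bound pos_mod_sign)
    from homotopy_wordD(6)[OF w2 this]
    show ?thesis
      by (simp add: band_power_def window_def unfold_band_simps mod_simps)
  qed
  moreover have "vtx w (i mod ?n) \<in> verts G" for i
    using w lk[of i] by (auto simp: homotopy_word_def links_def)
  ultimately show ?thesis
    using homotopy_wordD(1-5)[OF w lk] Suc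
    unfolding homotopy_word_def unfold_band_simps
    by (auto simp: int_interval_def)
qed

lemma band_complex_dg:
  assumes b: "homotopy_band G R w"
  shows "dg_module (Lam G R) (band_complex G R w c d :: (_ \<Rightarrow> 'k::field, _) mod_complex)"
  unfolding band_complex_matrix[OF band_basics(1)[OF b]]
proof (rule proj_complex_dg)
  let ?n = "word_length w"
  let ?J = "{0..<?n}"
  let ?S = "unfold_band w"
  note n = band_basics(1)[OF b]
  note S = homotopy_word_unfold[OF b]
  fix i j p
  assume "i \<in> ?J" and "(if j \<in> ?J then band_matrix w c d i j else 0) p \<noteq> (0::'k)"
  then have j: "j \<in> ?J" and nz: "band_matrix w c d i j p \<noteq> 0"
    by (auto split: if_splits)
  have jS: "j mod ?n = j" using j by auto
  from nz consider "i = (j + 1) mod ?n" "entry (right_letter ?S j) p \<noteq> (0::'k)"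
    | "i = (j - 1) mod ?n" "entry (flipped_left ?S j) p \<noteq> (0::'k)"
    by (fastforce simp: band_matrix_def right_letter_def left_letter_def unfold_band_simps scale_def jS
        split: if_splits)
  then show "j \<in> ?J \<and> deg w j = deg w i + 1 \<and> pstart p = vtx w j"
  proof cases
    case 1
    show ?thesis using right_entry(3,4)[OF S 1(2)] 1(1) j jS by (simp add: unfold_band_simps)
  next
    case 2
    show ?thesis using left_entry(3,4)[OF S 2(2)] 2(1) j jS by (simp add: unfold_band_simps)
  qed
next
  fix i
  show "finite {j. (if j \<in> {0..<word_length w} then band_matrix w c d i j else 0) \<noteq> (0::_ \<Rightarrow> 'k)}"
    by (rule finite_subset[of _ "{0..<word_length w}"]) (auto split: if_splits)
qed

end

section \<open>Graph maps are chain maps\<close>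

fun rmul_opt :: "('v, 'a) pre_digraph \<Rightarrow> ('a \<times> 'a) set \<Rightarrow> (('v, 'a) qpath \<Rightarrow> 'k::field)
    \<Rightarrow> ('v, 'a) qpath option \<Rightarrow> ('v, 'a) qpath \<Rightarrow> 'k" where
  "rmul_opt G R u None = 0"
| "rmul_opt G R u (Some p) = rmul G R u p"

text \<open>
  The component of a graph map with target position \<open>j\<close>, up to its scalar; the overlap determines
  the source position.
\<close>

definition graph_component :: "('v, 'a) pre_digraph \<Rightarrow> ('a \<times> 'a) set \<Rightarrow> int set
    \<Rightarrow> ('v, 'a) qpath option \<Rightarrow> ('v, 'a) qpath option \<Rightarrow> int
    \<Rightarrow> (('v, 'a) qpath \<Rightarrow> 'k::field) \<Rightarrow> ('v, 'a) qpath \<Rightarrow> 'k" where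
  "graph_component G R K fL fR j u =
     (if j \<in> K then u else if j + 1 \<in> K then rmul_opt G R u fL
      else if j - 1 \<in> K then rmul_opt G R u fR else 0)"

definition diff_at :: "('v, 'a) pre_digraph \<Rightarrow> ('a \<times> 'a) set \<Rightarrow> ('v, 'a) word
    \<Rightarrow> (int \<Rightarrow> ('v, 'a) qpath \<Rightarrow> 'k::field) \<Rightarrow> int \<Rightarrow> ('v, 'a) qpath \<Rightarrow> 'k" where
  "diff_at G R w u j =
     incoming G R (right_letter w j) (u (j + 1)) + incoming G R (flipped_left w j) (u (j - 1))"

lemma rmul_opt_zero [simp]: "rmul_opt G R 0 f = 0"
  by (cases f) auto

lemma rmul_opt_add: "rmul_opt G R (u + v) f = rmul_opt G R u f + rmul_opt G R v f"
  by (cases f) (auto simp: lmult_add_left)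

lemma rmul_opt_scale: "rmul_opt G R (scale k u) f = scale k (rmul_opt G R u f)"
  by (cases f) (auto simp: lmult_scale_left)

lemma graph_component_zero [simp]: "graph_component G R K fL fR j 0 = 0"
  by (auto simp: graph_component_def)

lemma graph_component_add:
  "graph_component G R K fL fR j (u + v) =
    graph_component G R K fL fR j u + graph_component G R K fL fR j v"
  by (auto simp: graph_component_def rmul_opt_add)

lemma graph_component_scale:
  "graph_component G R K fL fR j (scale k u) = scale k (graph_component G R K fL fR j u)"
  by (auto simp: graph_component_def rmul_opt_scale)

lemma flip_flip [simp]: "flip (flip l) = l"
  by (cases l) auto

lemma map_option_flip_flip [simp]: "map_option flip (map_option flip l) = l"
  by (cases l) auto

lemma flip_simps [simp]:
  "letter_path (flip l) = letter_path l" "is_direct (flip l) \<longleftrightarrow> \<not> is_direct l"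
  "lstart G (flip l) = lend G l" "lend G (flip l) = lstart G l"
  by (cases l; simp)+

lemma junction_flip: "junction R (flip l') (flip l) \<longleftrightarrow> junction R l l'"
  by (cases l; cases l') auto

lemma left_end_flip:
  "left_end G R sL tL f \<longleftrightarrow> right_end G R (map_option flip sL) (map_option flip tL) f"
proof (cases f)
  case None
  then show ?thesis
    by (auto simp: empty_or_direct_def empty_or_inverse_def)
next
  case (Some g)
  show ?thesis
    unfolding Some by (cases sL rule: entry.cases; cases tL rule: entry.cases) simp_all
qed

lemma flip_right_letter: "map_option flip (right_letter w j) = flipped_left w (j + 1)"
  by (simp add: right_letter_def left_letter_def)

lemma flip_flipped_left: "map_option flip (flipped_left w j) = right_letter w (j - 1)"
  by (simp add: right_letter_def left_letter_def)

context gentle_algebra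
begin

definition consecutive :: "('v, 'a) letter option \<Rightarrow> ('v, 'a) letter option \<Rightarrow> bool" where
  "consecutive s t \<longleftrightarrow> (\<forall>l l'. s = Some l \<longrightarrow> t = Some l' \<longrightarrow>
     nontrivial (letter_path l) \<and> nontrivial (letter_path l') \<and> junction R l l')"

lemma consecutive_right:
  "homotopy_word G R w \<Longrightarrow> consecutive (right_letter w j) (right_letter w (j + 1))"
  using homotopy_wordD[of w j] homotopy_wordD[of w "j + 1"]
  by (auto simp: consecutive_def right_letter_def split: if_splits)

lemma consecutive_left:
  "homotopy_word G R w \<Longrightarrow> consecutive (flipped_left w j) (flipped_left w (j - 1))"
  using homotopy_wordD[of w "j - 1"] homotopy_wordD[of w "j - 2"]
  by (auto simp: consecutive_def left_letter_def junction_flip split: if_splits)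

text \<open>
  The commutativity of a graph map at an end of the overlap is a matter of four letters: the
  letters \<open>s\<close>, \<open>t\<close> of the source and the target at the end and the letters \<open>s'\<close>, \<open>t'\<close> that follow
  them.  At the last position of the overlap and at the next one this is the end condition.  The
  contributions of \<open>s'\<close> and \<open>t'\<close> vanish: either their junction with \<open>s\<close> or \<open>t\<close> already is a relation
  with the arrow of \<open>f\<close> there, or \<open>s\<close> or \<open>t\<close> uses the only continuation of \<open>f\<close> outside \<open>I\<close>, which
  is unique in a gentle algebra, and a different arrow forms a relation with \<open>f\<close>.
\<close>

lemma end_inside:
  assumes "right_end G R s t f"
  shows "incoming G R t (rmul_opt G R u f) = incoming G R s u"
proof (cases f)
  case None
  with assms show ?thesis
    by (cases s rule: entry.cases) (auto simp: empty_or_direct_def)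
next
  case (Some g)
  with assms show ?thesis
    by (auto simp: rmul_prod)
qed

lemma end_after:
  assumes f: "right_end G R s t f" and s: "consecutive s s'"
  shows "rmul_opt G R (incoming G R s' v + incoming G R (map_option flip s) u) f =
    incoming G R (map_option flip t) u"
proof (cases f)
  case None
  with f show ?thesis
    by (cases t rule: entry.cases) (auto simp: empty_or_inverse_def)
next
  case (Some g)
  have "rmul G R (incoming G R s' v) g = 0"
  proof (cases s' rule: entry.cases)
    case (1 x)
    show ?thesis
    proof (rule ccontr)
      assume "rmul G R (incoming G R s' v) g \<noteq> 0"
      then have nz: "rmul G R (rmul G R v x) g \<noteq> 0"
        using 1 by simp
      from f Some consider p q where "s = Some (Dir p)" "is_prod G R p g q" "nontrivial g"
        | p q where "s = Some (Inv p)" "is_prod G R g q p" "nontrivial g"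
        by auto
      then show False
      proof cases
        case p: 1
        then have ntr: "nontrivial p" "nontrivial x" "hd (snd p) \<noteq> hd (snd x)"
          using s 1 by (auto simp: consecutive_def)
        note a = rmul_rmul_nonzero[OF nz ntr(2) p(3)] and b = is_prod_link[OF p(2) ntr(1) p(3)]
        have "hd (snd p) = hd (snd x)"
          using after_nonzero[of "last (snd g)"] a b unfolding Uniq_def by blast
        with ntr(3) show False ..
      next
        case p: 2
        then have ntr: "nontrivial x" "(hd (snd x), last (snd p)) \<in> R"
          using s 1 by (auto simp: consecutive_def)
        have "last (snd p) = last (snd g)"
          using is_prodD(6)[OF p(2)] p(3) by (simp add: nontrivial_def)
        then show False
          using rmul_rmul_nonzero[OF nz ntr(1) p(3)] ntr(2) by simp
      qed
    qed
  qed auto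
  moreover have "rmul G R (incoming G R (map_option flip s) u) g = incoming G R (map_option flip t) u"
    using f Some by (auto simp: rmul_prod)
  ultimately show ?thesis
    by (simp add: Some lmult_add_left)
qed

lemma end_beyond:
  assumes f: "right_end G R s t f" and t: "consecutive t t'"
  shows "incoming G R (map_option flip t') (rmul_opt G R u f) = 0"
proof (cases "f = None \<or> (\<forall>y. t' \<noteq> Some (Dir y))")
  case True
  then show ?thesis
    by (cases "map_option flip t'" rule: entry.cases) (auto, metis flip.simps(2) flip_flip)
next
  case False
  then obtain g y where g: "f = Some g" and y: "t' = Some (Dir y)"
    by auto
  have "rmul G R (rmul G R u g) y = 0"
  proof (rule ccontr)
    assume nz: "rmul G R (rmul G R u g) y \<noteq> 0"
    from f g consider p q where "t = Some (Dir q)" "is_prod G R p g q" "nontrivial g"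
      | p q where "t = Some (Inv q)" "is_prod G R g q p" "nontrivial g"
      by auto
    then show False
    proof cases
      case p: 1
      then have ntr: "nontrivial y" "(hd (snd q), last (snd y)) \<in> R"
        using t y by (auto simp: consecutive_def)
      have "hd (snd q) = hd (snd g)"
        using is_prodD(6)[OF p(2)] p(3) by (simp add: nontrivial_def)
      then show False
        using rmul_rmul_nonzero[OF nz p(3) ntr(1)] ntr(2) by simp
    next
      case p: 2
      then have ntr: "nontrivial q" "nontrivial y" "last (snd q) \<noteq> last (snd y)"
        using t y by (auto simp: consecutive_def)
      note a = rmul_rmul_nonzero[OF nz p(3) ntr(2)] and b = is_prod_link[OF p(2) p(3) ntr(1)]
      have "last (snd q) = last (snd y)"
        using before_nonzero[of "hd (snd g)"] a b unfolding Uniq_def by blast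
      with ntr(3) show False ..
    qed
  qed
  then show ?thesis
    using g y by simp
qed

text \<open>
  Inside the overlap the two differentials agree letter by letter.  Further away than two positions
  from it both sides vanish.  What remains at each end are the three positions of the previous
  lemmas, and flipping turns the left end into a right end.
\<close>

lemma graph_component_commutes:
  assumes V: "homotopy_word G R V" and W: "homotopy_word G R W"
    and K: "common_subword V W K t" and ends: "end_conditions G R V W K t fL fR"
  shows "graph_component G R K fL fR j (diff_at G R V u (j + t)) =
    diff_at G R W (\<lambda>j. graph_component G R K fL fR j (u (j + t))) j"
proof -
  let ?g = "\<lambda>j. graph_component G R K fL fR j (u (j + t))"
  have conv: "b \<in> K" if "a \<in> K" "c \<in> K" "a \<le> b" "b \<le> c" for a b c
  proof -
    have "{a..c} \<subseteq> K"
      using K that(1,2) unfolding common_subword_def int_interval_def by blast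
    with that(3,4) show ?thesis by auto
  qed
  have le: "right_end G R (flipped_left V (a + t)) (flipped_left W a) fL" if "a \<in> K" "a - 1 \<notin> K" for a
    using ends that by (simp add: end_conditions_def left_end_flip)
  have re: "right_end G R (right_letter V (b + t)) (right_letter W b) fR" if "b \<in> K" "b + 1 \<notin> K" for b
    using ends that by (simp add: end_conditions_def)
  have inner: "right_letter W j = right_letter V (j + t)" if "j \<in> K" "j + 1 \<in> K" for j
    using K that by (auto simp: common_subword_def right_letter_def links_def algebra_simps)
  consider "j \<in> K" | "j \<notin> K" "j - 1 \<in> K" | "j \<notin> K" "j + 1 \<in> K" | "j \<notin> K" "j - 1 \<notin> K" "j + 1 \<notin> K"
    by blast
  then show ?thesis
  proof cases
    case 1
    have "incoming G R (right_letter W j) (?g (j + 1)) = incoming G R (right_letter V (j + t)) (u (j + t + 1))"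
    proof (cases "j + 1 \<in> K")
      case True
      then show ?thesis
        using inner[OF 1 True] by (simp add: graph_component_def algebra_simps)
    next
      case False
      then have "j + 1 + 1 \<notin> K"
        using conv[OF 1, of "j + 1 + 1" "j + 1"] by auto
      then show ?thesis
        using end_inside[OF re[OF 1 False]] 1 False by (simp add: graph_component_def algebra_simps)
    qed
    moreover have "incoming G R (flipped_left W j) (?g (j - 1)) =
        incoming G R (flipped_left V (j + t)) (u (j + t - 1))"
    proof (cases "j - 1 \<in> K")
      case True
      then have "flipped_left W j = flipped_left V (j + t)"
        using inner[of "j - 1"] 1 flip_right_letter[of W "j - 1"] flip_right_letter[of V "j - 1 + t"]
        by (simp add: algebra_simps)
      with True show ?thesis
        by (simp add: graph_component_def algebra_simps)
    next
      case False
      then show ?thesis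
        using end_inside[OF le[OF 1 False]] 1 by (simp add: graph_component_def algebra_simps)
    qed
    ultimately show ?thesis
      using 1 by (simp add: diff_at_def graph_component_def[of _ _ _ _ _ j])
  next
    case 2
    have out: "j + 1 \<notin> K" "j + 1 + 1 \<notin> K"
      using conv[OF 2(2), of "j + 1" j] conv[OF 2(2), of "j + 1 + 1" j] 2(1) by auto
    have "rmul_opt G R (incoming G R (right_letter V (j + t)) (u (j + t + 1)) +
        incoming G R (flipped_left V (j + t)) (u (j + t - 1))) fR =
        incoming G R (flipped_left W j) (u (j - 1 + t))"
      using end_after[OF re consecutive_right[OF V], of "j - 1" "u (j + t + 1)" "u (j + t - 1)"] 2
        flip_right_letter[of V "j - 1 + t"] flip_right_letter[of W "j - 1"]
      by (simp add: algebra_simps)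
    moreover have "?g (j + 1) = 0" "?g (j - 1) = u (j - 1 + t)"
      using 2 out by (auto simp: graph_component_def)
    ultimately show ?thesis
      using 2 out by (simp add: diff_at_def graph_component_def[of _ _ _ _ _ j])
  next
    case 3
    have out: "j - 1 \<notin> K" "j - 1 - 1 \<notin> K"
      using conv[of "j - 1" "j + 1" j] conv[of "j - 1 - 1" "j + 1" j] 3 by auto
    have "rmul_opt G R (incoming G R (flipped_left V (j + t)) (u (j + t - 1)) +
        incoming G R (right_letter V (j + t)) (u (j + t + 1))) fL =
        incoming G R (right_letter W j) (u (j + 1 + t))"
      using end_after[OF le consecutive_left[OF V], of "j + 1" "u (j + t - 1)" "u (j + t + 1)"] 3
        flip_flipped_left[of V "j + 1 + t"] flip_flipped_left[of W "j + 1"]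
      by (simp add: algebra_simps)
    moreover have "?g (j - 1) = 0" "?g (j + 1) = u (j + 1 + t)"
      using 3 out by (auto simp: graph_component_def)
    ultimately show ?thesis
      using 3 out by (simp add: diff_at_def graph_component_def[of _ _ _ _ _ j] add.commute)
  next
    case 4
    have "incoming G R (right_letter W j) (?g (j + 1)) = 0"
    proof (cases "j + 2 \<in> K")
      case True
      then show ?thesis
        using end_beyond[OF le consecutive_left[OF W], of "j + 2" "u (j + 1 + t)"] 4
          flip_flipped_left[of W "j + 1"]
        by (simp add: graph_component_def algebra_simps)
    qed (use 4 in \<open>auto simp: graph_component_def algebra_simps\<close>)
    moreover have "incoming G R (flipped_left W j) (?g (j - 1)) = 0"
    proof (cases "j - 2 \<in> K")
      case True
      then show ?thesis
        using end_beyond[OF re consecutive_right[OF W], of "j - 2" "u (j - 1 + t)"] 4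
          flip_right_letter[of W "j - 1"]
        by (simp add: graph_component_def algebra_simps)
    qed (use 4 in \<open>auto simp: graph_component_def algebra_simps\<close>)
    ultimately show ?thesis
      using 4 by (simp add: diff_at_def graph_component_def[of _ _ _ _ _ j])
  qed
qed

lemma right_end_start:
  assumes "right_end G R s t (Some f)"
  obtains l l' where "s = Some l" "t = Some l'" "is_direct l \<longleftrightarrow> is_direct l'" "fst f = lstart G l'"
proof -
  from assms consider p q where "s = Some (Dir p)" "t = Some (Dir q)" "is_prod G R p f q"
    | p q where "s = Some (Inv p)" "t = Some (Inv q)" "is_prod G R f q p"
    by auto
  then show thesis
  proof cases
    case 1
    then show ?thesis
      using that[OF 1(1,2)] is_prodD(5)[OF 1(3)] by (simp add: pstart_def)
  next
    case 2
    then show ?thesis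
      using that[OF 2(1,2)] is_prodD(4)[OF 2(3)] by simp
  qed
qed

lemma graph_component_summand:
  assumes V: "homotopy_word G R V" and W: "homotopy_word G R W"
    and K: "common_subword V W K t" and ends: "end_conditions G R V W K t fL fR"
    and u: "u \<in> summand G R (pos V) (vtx V) (deg V) m (j + t)"
  shows "graph_component G R K fL fR j u \<in> summand G R (pos W) (vtx W) (deg W) m j"
proof (cases "u = 0 \<or> graph_component G R K fL fR j u = 0")
  case False
  have uV: "j + t \<in> pos V" "deg V (j + t) = m" "u \<in> proj G R (vtx V (j + t))"
    using summand_nonzero[OF u] False by auto
  consider "j \<in> K" | "j \<notin> K" "j + 1 \<in> K" | "j \<notin> K" "j + 1 \<notin> K" "j - 1 \<in> K"
    using False by (auto simp: graph_component_def split: if_splits)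
  then show ?thesis
  proof cases
    case 1
    then show ?thesis
      using K uV by (auto simp: graph_component_def common_subword_def summand_def)
  next
    case 2
    then obtain f where f: "fL = Some f"
      using False by (cases fL) (auto simp: graph_component_def)
    have "left_end G R (left_letter V (j + 1 + t)) (left_letter W (j + 1)) fL"
      using ends 2 by (simp add: end_conditions_def del: left_end.simps)
    then have "right_end G R (flipped_left V (j + 1 + t)) (flipped_left W (j + 1)) (Some f)"
      by (simp only: left_end_flip f)
    then obtain l l' where l: "flipped_left V (j + 1 + t) = Some l" "flipped_left W (j + 1) = Some l'"
      "is_direct l \<longleftrightarrow> is_direct l'" "fst f = lstart G l'"
      by (rule right_end_start)
    then have lk: "j + t \<in> links V" "j \<in> links W" "l = flip (ltr V (j + t))" "l' = flip (ltr W j)"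
      by (auto simp: left_letter_def algebra_simps split: if_splits)
    have "deg W (j + 1) = deg V (j + t + 1)"
      using K 2 by (auto simp: common_subword_def algebra_simps)
    then have "deg W j = m"
      using homotopy_wordD(5)[OF V lk(1)] homotopy_wordD(5)[OF W lk(2)] uV(2) l(3) lk(3,4)
      by (auto split: if_splits)
    moreover have "vtx W j = fst f"
      using homotopy_wordD(3)[OF W lk(2)] l(4) lk(4) by simp
    ultimately show ?thesis
      using 2 f lk(2) rmul_proj[of u f] by (auto simp: graph_component_def summand_def links_def)
  next
    case 3
    then obtain f where f: "fR = Some f"
      using False by (cases fR) (auto simp: graph_component_def)
    have "right_end G R (right_letter V (j - 1 + t)) (right_letter W (j - 1)) fR"
      using ends 3 by (simp add: end_conditions_def del: right_end.simps)
    then have "right_end G R (right_letter V (j - 1 + t)) (right_letter W (j - 1)) (Some f)"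
      by (simp only: f)
    then obtain l l' where l: "right_letter V (j - 1 + t) = Some l" "right_letter W (j - 1) = Some l'"
      "is_direct l \<longleftrightarrow> is_direct l'" "fst f = lstart G l'"
      by (rule right_end_start)
    then have lk: "j - 1 + t \<in> links V" "j - 1 \<in> links W" "l = ltr V (j - 1 + t)" "l' = ltr W (j - 1)"
      by (auto simp: right_letter_def split: if_splits)
    have "deg W (j - 1) = deg V (j - 1 + t)"
      using K 3 by (auto simp: common_subword_def)
    then have "deg W j = m"
      using homotopy_wordD(5)[OF V lk(1)] homotopy_wordD(5)[OF W lk(2)] uV(2) l(3) lk(3,4)
      by (auto simp: algebra_simps split: if_splits)
    moreover have "vtx W j = fst f"
      using homotopy_wordD(4)[OF W lk(2)] l(4) lk(4) by simp
    ultimately show ?thesis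
      using 3 f lk(2) rmul_proj[of u f] by (auto simp: graph_component_def summand_def links_def)
  qed
qed (auto simp: graph_component_def)

lemma graph_component_act:
  "graph_component G R K fL fR j (lmult G R r u) = lmult G R r (graph_component G R K fL fR j u)"
  by (cases fL; cases fR) (auto simp: graph_component_def lmult_assoc)

lemma string_diff_at:
  "u \<in> cterm (string_complex G R w) m \<Longrightarrow> cdiff (string_complex G R w) m' u = diff_at G R w u"
  by (rule ext) (simp add: string_diff diff_at_def)

lemma cterm_string_complex:
  "u \<in> cterm (string_complex G R w) m \<longleftrightarrow>
     finite {i. u i \<noteq> 0} \<and> (\<forall>i. u i \<in> summand G R (pos w) (vtx w) (deg w) m i)"
  by (simp add: string_complex_matrix cterm_proj_complex)

lemma string_graph_map_chain_map:
  fixes V W :: "('v, 'a) word"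
  assumes V: "homotopy_word G R V" and W: "homotopy_word G R W"
    and K: "common_subword V W K t" and ends: "end_conditions G R V W K t fL fR"
  shows "chain_map (Lam G R) (string_complex G R V) (string_complex G R W)
    (\<lambda>m u j. graph_component G R K fL fR j (u (j + t) :: _ \<Rightarrow> 'k::field))"
proof -
  let ?C = "string_complex G R V :: (_ \<Rightarrow> 'k, _) mod_complex"
  let ?D = "string_complex G R W :: (_ \<Rightarrow> 'k, _) mod_complex"
  let ?g = "\<lambda>u j. graph_component G R K fL fR j (u (j + t) :: _ \<Rightarrow> 'k)"
  have in_D: "?g u \<in> cterm ?D m" if u: "u \<in> cterm ?C m" for u m
    unfolding cterm_string_complex
  proof
    have "{j. ?g u j \<noteq> 0} \<subseteq> (\<lambda>i. i - t) ` {i. u i \<noteq> 0}"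
    proof
      fix j assume "j \<in> {j. ?g u j \<noteq> 0}"
      then have "u (j + t) \<noteq> 0" by auto
      then show "j \<in> (\<lambda>i. i - t) ` {i. u i \<noteq> 0}"
        by (intro image_eqI[of _ _ "j + t"]) auto
    qed
    then show "finite {j. ?g u j \<noteq> 0}"
      by (rule finite_subset) (use u in \<open>auto simp: cterm_string_complex\<close>)
    show "\<forall>j. ?g u j \<in> summand G R (pos W) (vtx W) (deg W) m j"
      using u unfolding cterm_string_complex by (intro allI graph_component_summand[OF V W K ends]) blast
  qed
  have "graded_linear (Lam G R) ?C ?D 0 (\<lambda>m. ?g)"
    unfolding graded_linear_def
    using in_D by (auto simp: string_complex_matrix cact_proj_complex graph_component_act fun_eq_iff
        graph_component_add[THEN fun_cong, simplified] plus_fun_apply[of _ _ "_ + t"])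
  moreover have "?g (cdiff ?C m u) = cdiff ?D m (?g u)" if u: "u \<in> cterm ?C m" for u m
    unfolding string_diff_at[OF u] string_diff_at[OF in_D[OF u]]
    by (rule ext) (rule graph_component_commutes[OF V W K ends])
  ultimately show ?thesis
    by (simp add: chain_map_def)
qed

end

section \<open>The scalars of a graph map out of a band complex\<close>

context gentle_algebra
begin

lemma cterm_band_complex:
  assumes "homotopy_band G R w"
  shows "u \<in> cterm (band_complex G R w k d) m \<longleftrightarrow>
    finite {i. u i \<noteq> 0} \<and> (\<forall>i. u i \<in> summand G R {0..<word_length w} (vtx w) (deg w) m i)"
  by (simp add: band_complex_matrix[OF band_basics(1)[OF assms]] cterm_proj_complex)

lemma band_diff:
  assumes b: "homotopy_band G R w" and u: "u \<in> cterm (band_complex G R w k d) m"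
  shows "cdiff (band_complex G R w k d) m' u (x mod word_length w) =
    scale (if x mod word_length w = d then k else 1)
      (incoming G R (right_letter (unfold_band w) x) (u ((x + 1) mod word_length w))) +
    scale (if (x - 1) mod word_length w = d then k else 1)
      (incoming G R (flipped_left (unfold_band w) x) (u ((x - 1) mod word_length w)))"
proof -
  have n: "word_length w > 0"
    by (rule band_basics(1)[OF b])
  have fin: "finite {i. u i \<noteq> 0}"
    using u by (simp add: cterm_band_complex[OF b])
  have "x mod word_length w \<in> {0..<word_length w}"
    using n by simp
  from mat_map_band[OF fin this]
  show ?thesis
    by (simp add: band_complex_matrix[OF n] cdiff_proj_complex right_letter_def left_letter_def
        unfold_band_simps mod_simps)
qed

lemma rmul_prod_other:
  assumes "is_prod G R p f w" "nontrivial p" "nontrivial x" "hd (snd p) \<noteq> hd (snd x)"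
  shows "rmul G R (rmul G R u x) f w = 0"
proof -
  have "drop (length (snd f)) (snd w) = snd p"
    using is_prodD(6)[OF assms(1)] by simp
  moreover have "take (length (snd x)) (snd p) \<noteq> snd x"
    using assms(2-4) by (metis hd_take length_greater_0_conv nontrivial_def)
  ultimately show ?thesis
    by (simp add: rmul_eq)
qed

lemma rmul_other:
  assumes "is_prod G R f q w" "nontrivial q" "nontrivial y" "hd (snd q) \<noteq> hd (snd y)"
  shows "rmul G R u y w = 0"
proof -
  have "hd (snd w) = hd (snd q)"
    using is_prodD(6)[OF assms(1)] assms(2) by (simp add: nontrivial_def)
  then have "take (length (snd y)) (snd w) \<noteq> snd y"
    using assms(3,4) by (metis hd_take length_greater_0_conv nontrivial_def)
  then show ?thesis
    by (simp add: rmul_eq)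
qed

lemma scale_apply: "scale k u p = k * u p"
  by (simp add: scale_def)

lemma rmul_unit:
  assumes "nonzero_path G R w" "x = pend G w"
  shows "rmul G R (path_elt 1 (x, [])) w w = 1"
  using assms by (simp add: rmul_eq) (simp add: path_elt_def)

lemma unit_proj: "x \<in> verts G \<Longrightarrow> path_elt k (x, []) \<in> proj G R x"
  by (simp add: proj_def Lam_def path_elt_def pstart_def nonzero_trivial)

end

text \<open>
  A graph map whose overlap \<open>{a..b}\<close> contains at least one full turn of the band.
\<close>

locale band_graph_map = gentle_algebra G R
  for G :: "('v, 'a) pre_digraph" and R :: "('a \<times> 'a) set" +
  fixes sigma tau :: "('v, 'a) word" and lam :: "'k::field" and d :: int and I :: "int set"
    and s :: int and fL fR :: "('v, 'a) qpath option" and c :: "int \<Rightarrow> 'k" and a b :: int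
    and f :: "int \<Rightarrow> (int \<Rightarrow> ('v, 'a) qpath \<Rightarrow> 'k) \<Rightarrow> (int \<Rightarrow> ('v, 'a) qpath \<Rightarrow> 'k)"
  assumes band: "homotopy_band G R sigma"
    and string: "homotopy_string TYPE('k) G R tau"
    and lam: "lam \<noteq> 0" and d_range: "d \<in> {0..<word_length sigma}"
    and direct_d: "is_direct (ltr sigma d)"
    and common: "common_subword (unfold_band sigma) tau I s"
    and ends: "end_conditions G R (unfold_band sigma) tau I s fL fR"
    and f_chain: "chain_map (Lam G R) (band_complex G R sigma lam d) (string_complex G R tau) f"
    and c_nonzero: "c j \<noteq> 0"
    and f_matrix: "u \<in> cterm (band_complex G R sigma lam d) m \<Longrightarrow>
      f m u = mat_map G R (graph_matrix tau I s (\<lambda>i. i mod word_length sigma) fL fR c) u"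
    and I_eq: "I = {a..b}" and winds: "word_length sigma \<le> b - a"
begin

abbreviation n :: int where "n \<equiv> word_length sigma"
abbreviation S :: "('v, 'a) word" where "S \<equiv> unfold_band sigma"
abbreviation kap :: "int \<Rightarrow> 'k" where "kap x \<equiv> (if x mod n = d then lam else 1)"
abbreviation Bc :: "(('v, 'a) qpath \<Rightarrow> 'k, int \<Rightarrow> ('v, 'a) qpath \<Rightarrow> 'k) mod_complex" where
  "Bc \<equiv> band_complex G R sigma lam d"
abbreviation Tc :: "(('v, 'a) qpath \<Rightarrow> 'k, int \<Rightarrow> ('v, 'a) qpath \<Rightarrow> 'k) mod_complex" where
  "Tc \<equiv> string_complex G R tau"

lemma n_pos: "n > 0"
  by (rule band_basics(1)[OF band])

lemma S_word: "homotopy_word G R S"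
  by (rule homotopy_word_unfold[OF band])

lemma tau_word: "homotopy_word G R tau"
  using string by (simp add: homotopy_string_def)

lemma S_periodic:
  "vtx S (x + n) = vtx S x" "deg S (x + n) = deg S x" "ltr S (x + n) = ltr S x"
  by (simp_all add: unfold_band_simps)

lemma on_I:
  assumes "j \<in> I"
  shows "j \<in> pos tau" "vtx tau j = vtx S (j + s)" "deg tau j = deg S (j + s)"
  using common assms by (auto simp: common_subword_def)

lemma inside_I:
  assumes "j \<in> I" "j + 1 \<in> I"
  shows "j \<in> links tau" "ltr tau j = ltr S (j + s)"
  using common assms by (auto simp: common_subword_def links_def)

lemma S_verts: "vtx S x \<in> verts G"
  using S_word by (simp add: homotopy_word_def unfold_band_simps)

lemma mem_I: "x \<in> I \<longleftrightarrow> a \<le> x \<and> x \<le> b"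
  by (simp add: I_eq)

lemma band_cterm_proj:
  assumes "u \<in> cterm Bc m"
  shows "u i \<in> proj G R (vtx sigma i)"
proof -
  have "u i \<in> summand G R {0..<n} (vtx sigma) (deg sigma) m i"
    using assms by (simp add: cterm_band_complex[OF band])
  then show ?thesis
    by (rule summand_proj)
qed

lemma f_eq:
  assumes u: "u \<in> cterm Bc m"
  shows "f m u j = scale (c j) (graph_component G R I fL fR j (u ((j + s) mod n)))"
proof -
  let ?i = "(j + s) mod n"
  let ?D = "graph_matrix tau I s (\<lambda>i. i mod n) fL fR c :: int \<Rightarrow> int \<Rightarrow> _ \<Rightarrow> 'k"
  have u': "finite {i. u i \<noteq> 0}" "u ?i \<in> proj G R (vtx sigma ?i)"
    using u band_cterm_proj[OF u] by (auto simp: cterm_band_complex[OF band])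
  have "f m u j = mat_map G R ?D u j"
    by (simp add: f_matrix[OF u])
  also have "\<dots> = (\<Sum>i\<in>{i. u i \<noteq> 0} \<union> {?i}. lmult G R (u i) (?D i j))"
    by (rule mat_map_superset) (use u' in auto)
  also have "\<dots> = (\<Sum>i\<in>{?i}. lmult G R (u i) (?D i j))"
    by (rule sum.mono_neutral_right) (use u' in \<open>auto simp: graph_matrix_def\<close>)
  also have "\<dots> = lmult G R (u ?i) (?D ?i j)"
    by simp
  also have "\<dots> = scale (c j) (graph_component G R I fL fR j (u ?i))"
  proof (cases "j \<in> I")
    case True
    then have "rmul G R (u ?i) (vtx tau j, []) = u ?i"
      using u'(2) by (intro rmul_trivial) (simp add: on_I unfold_band_simps)
    with True show ?thesis
      by (simp add: graph_matrix_def graph_component_def path_elt_scale[of "c j"] lmult_scale_right)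
  next
    case False
    then show ?thesis
      by (cases fL; cases fR)
        (simp_all add: graph_matrix_def graph_component_def path_elt_scale[of "c j"] lmult_scale_right)
  qed
  finally show ?thesis .
qed

definition component_path :: "int \<Rightarrow> ('v, 'a) qpath option" where
  "component_path j = (if j \<in> I then Some (vtx tau j, []) else if j + 1 \<in> I then fL
     else if j - 1 \<in> I then fR else None)"

lemma graph_component_path:
  "(j \<in> I \<Longrightarrow> u \<in> proj G R (vtx tau j)) \<Longrightarrow>
    graph_component G R I fL fR j u = rmul_opt G R u (component_path j)"
  by (auto simp: graph_component_def component_path_def rmul_trivial)

text \<open>
  The letters at a link and the components of the graph map at its two ends form a square of paths
  that commutes in \<open>\<Lambda>\<close> with a nonzero diagonal \<open>w\<close>.  Inside the overlap the components are trivial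
  paths; at its ends this is the end condition.
\<close>

lemma component_square:
  assumes F: "component_path k = Some F" "component_path (k + 1) = Some F'"
  obtains (direct) p q w where "right_letter S (k + s) = Some (Dir p)" "right_letter tau k = Some (Dir q)"
      "is_prod G R p F' w" "is_prod G R F q w"
  | (inverse) p q w where "right_letter S (k + s) = Some (Inv p)" "right_letter tau k = Some (Inv q)"
      "is_prod G R p F w" "is_prod G R F' q w"
proof -
  have SD: "nonzero_path G R p" "pend G p = vtx S (k + s)" "fst p = vtx S (k + 1 + s)"
    if "right_letter S (k + s) = Some (Dir p)" for p
    using that homotopy_wordD[OF S_word, of "k + s"]
    by (auto simp: right_letter_def pstart_def algebra_simps split: if_splits)
  have SI: "nonzero_path G R p" "fst p = vtx S (k + s)" "pend G p = vtx S (k + 1 + s)"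
    if "right_letter S (k + s) = Some (Inv p)" for p
    using that homotopy_wordD[OF S_word, of "k + s"]
    by (auto simp: right_letter_def pstart_def algebra_simps split: if_splits)
  have TD: "nonzero_path G R p" "pend G p = vtx tau k" "fst p = vtx tau (k + 1)"
    if "right_letter tau k = Some (Dir p)" for p
    using that homotopy_wordD[OF tau_word, of k]
    by (auto simp: right_letter_def pstart_def split: if_splits)
  have TI: "nonzero_path G R p" "fst p = vtx tau k" "pend G p = vtx tau (k + 1)"
    if "right_letter tau k = Some (Inv p)" for p
    using that homotopy_wordD[OF tau_word, of k]
    by (auto simp: right_letter_def pstart_def split: if_splits)
  consider "k \<in> I" "k + 1 \<in> I" | "k \<notin> I" "k + 1 \<in> I" | "k \<in> I" "k + 1 \<notin> I"
    using F by (auto simp: component_path_def mem_I split: if_splits)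
  then show thesis
  proof cases
    case 1
    then have FF: "F = (vtx tau k, [])" "F' = (vtx tau (k + 1), [])"
      using F by (auto simp: component_path_def)
    have rl: "right_letter tau k = Some (ltr tau k)" "right_letter S (k + s) = Some (ltr tau k)"
      using inside_I[OF 1] by (auto simp: right_letter_def unfold_band_simps)
    show thesis
    proof (cases "ltr tau k")
      case (Dir p)
      then show thesis
        using direct[of p p p] rl TD[of p] FF by (simp add: is_prod_trivial_left is_prod_trivial_right)
    next
      case (Inv p)
      then show thesis
        using inverse[of p p p] rl TI[of p] FF by (simp add: is_prod_trivial_left is_prod_trivial_right)
    qed
  next
    case 2
    then have FF: "fL = Some F" "F' = (vtx S (k + 1 + s), [])" "F' = (vtx tau (k + 1), [])"
      using F unfolding component_path_def by (simp_all add: on_I)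
    have "left_end G R (left_letter S (k + 1 + s)) (left_letter tau (k + 1)) fL"
      using ends 2 by (simp add: end_conditions_def del: left_end.simps)
    moreover have "left_letter S (k + 1 + s) = right_letter S (k + s)"
      "left_letter tau (k + 1) = right_letter tau k"
      by (auto simp: left_letter_def right_letter_def algebra_simps)
    ultimately consider p q where "right_letter S (k + s) = Some (Dir p)"
        "right_letter tau k = Some (Dir q)" "is_prod G R F q p"
      | p q where "right_letter S (k + s) = Some (Inv p)" "right_letter tau k = Some (Inv q)"
        "is_prod G R p F q"
      using FF(1) by auto
    then show thesis
    proof cases
      case (1 p q)
      show thesis
        by (rule direct[OF 1(1,2) _ 1(3)]) (use SD[OF 1(1)] FF in \<open>simp add: is_prod_trivial_right\<close>)
    next
      case (2 p q)
      show thesis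
        by (rule inverse[OF 2(1,2,3)]) (use TI[OF 2(2)] FF in \<open>simp add: is_prod_trivial_left\<close>)
    qed
  next
    case 3
    then have FF: "fR = Some F'" "F = (vtx S (k + s), [])" "F = (vtx tau k, [])"
      using F unfolding component_path_def by (auto simp: on_I mem_I split: if_splits)
    have "right_end G R (right_letter S (k + s)) (right_letter tau k) fR"
      using ends 3 by (simp add: end_conditions_def del: right_end.simps)
    then consider p q where "right_letter S (k + s) = Some (Dir p)"
        "right_letter tau k = Some (Dir q)" "is_prod G R p F' q"
      | p q where "right_letter S (k + s) = Some (Inv p)" "right_letter tau k = Some (Inv q)"
        "is_prod G R F' q p"
      using FF(1) by auto
    then show thesis
    proof cases
      case (1 p q)
      show thesis
        by (rule direct[OF 1(1,2,3)]) (use TD[OF 1(2)] FF in \<open>simp add: is_prod_trivial_left\<close>)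
    next
      case (2 p q)
      show thesis
        by (rule inverse[OF 2(1,2) _ 2(3)]) (use SI[OF 2(1)] FF in \<open>simp add: is_prod_trivial_right\<close>)
    qed
  qed
qed

definition unit_at :: "int \<Rightarrow> int \<Rightarrow> ('v, 'a) qpath \<Rightarrow> 'k" where
  "unit_at x = (\<lambda>i. if i = x mod n then path_elt 1 (vtx S x, []) else 0)"

lemma unit_at_cterm: "unit_at x \<in> cterm Bc (deg S x)"
proof -
  have "finite {i. unit_at x i \<noteq> 0}"
    by (rule finite_subset[of _ "{x mod n}"]) (auto simp: unit_at_def)
  then show ?thesis
    using n_pos S_verts[of x]
    by (auto simp: cterm_band_complex[OF band] unit_at_def summand_def unfold_band_simps unit_proj)
qed

lemma unit_at_mod: "unit_at x (x mod n) = path_elt 1 (vtx S x, [])"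
  by (simp add: unit_at_def)

text \<open>
  Compare both sides of the chain map condition for \<open>f\<close> on an idempotent, at the coefficient of the
  diagonal path \<open>w\<close> of the square.  The other letter with an arrow into the target position
  contributes only paths that branch off from \<open>w\<close>, because the two letters start with different
  arrows.
\<close>

lemma scalar_step:
  assumes "component_path k \<noteq> None" "component_path (k + 1) \<noteq> None"
  shows "c k = kap (k + s) * c (k + 1)"
proof -
  obtain F F' where F: "component_path k = Some F" "component_path (k + 1) = Some F'"
    using assms by auto
  have fd: "f (m + 1) (cdiff Bc m u) j = diff_at G R tau (f m u) j" if u: "u \<in> cterm Bc m" for m u j
    using f_chain u string_diff_at[of "f m u" tau m] graded_linearD(1)[of "Lam G R" Bc Tc 0 f]
    by (auto simp: chain_map_def)
  have dB: "cdiff Bc m u \<in> cterm Bc (m + 1)" if "u \<in> cterm Bc m" for m u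
    using graded_linearD(1)[OF dg_moduleD(6)[OF band_complex_dg[OF band]] that] .
  have proj_I: "u ((j + s) mod n) \<in> proj G R (vtx tau j)" if "j \<in> I" "u \<in> cterm Bc m" for j m u
    using that(1) band_cterm_proj[OF that(2), of "(j + s) mod n"]
    by (simp add: on_I unfold_band_simps)
  from F show ?thesis
  proof (cases rule: component_square)
    case (direct p q w)
    let ?x = "k + s" and ?y = "k + 1 + s"
    let ?u = "unit_at ?x" and ?m = "deg S (k + s)"
    note u = unit_at_cterm[of ?x] and du = dB[OF unit_at_cterm[of ?x]]
    note w1 = is_prodD[OF direct(3)] and w2 = is_prodD[OF direct(4)]
    have pS: "nontrivial p" "pend G p = vtx S ?x"
      using direct(1) homotopy_wordD[OF S_word, of ?x] by (auto simp: right_letter_def split: if_splits)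
    have qT: "nontrivial q"
      using direct(2) homotopy_wordD[OF tau_word, of k] by (auto simp: right_letter_def split: if_splits)
    have unit: "rmul G R (?u (?x mod n)) w w = 1"
      using w1 pS by (simp add: unit_at_mod rmul_unit)
    have left_S: "flipped_left S ?y = Some (Inv p)"
      using flip_right_letter[of S ?x] direct(1) by (simp add: algebra_simps)
    have left_T: "flipped_left tau (k + 1) = Some (Inv q)"
      using flip_right_letter[of tau k] direct(2) by simp
    have "rmul G R (incoming G R (right_letter S ?y) v) F' w = 0" for v :: "_ \<Rightarrow> 'k"
    proof (cases "right_letter S ?y" rule: entry.cases)
      case (1 y)
      then show ?thesis
        using consecutive_right[OF S_word, of ?x] direct(1)
        by (simp add: consecutive_def algebra_simps rmul_prod_other[OF direct(3) pS(1)])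
    qed auto
    moreover have "cdiff Bc ?m ?u (?y mod n) =
        scale (kap ?y) (incoming G R (right_letter S ?y) (?u ((?y + 1) mod n))) +
        scale (kap ?x) (rmul G R (?u (?x mod n)) p)"
      using band_diff[OF band u, of ?m ?y] left_S by (simp del: map_option_eq_Some)
    moreover have "f (?m + 1) (cdiff Bc ?m ?u) (k + 1) =
        scale (c (k + 1)) (rmul G R (cdiff Bc ?m ?u (?y mod n)) F')"
      using f_eq[OF du, of "k + 1"] graph_component_path[OF proj_I[OF _ du], of "k + 1"] F(2) by simp
    moreover have "rmul G R (rmul G R (?u (?x mod n)) p) F' w = 1"
      by (simp add: rmul_prod[OF direct(3)] unit)
    ultimately have L: "f (?m + 1) (cdiff Bc ?m ?u) (k + 1) w = c (k + 1) * kap ?x"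
      by (simp add: lmult_add_left lmult_scale_left scale_apply)
    have "incoming G R (right_letter tau (k + 1)) v w = 0" for v :: "_ \<Rightarrow> 'k"
    proof (cases "right_letter tau (k + 1)" rule: entry.cases)
      case (1 y)
      then show ?thesis
        using consecutive_right[OF tau_word, of k] direct(2)
        by (simp add: consecutive_def rmul_other[OF direct(4) qT])
    qed auto
    moreover have "f ?m ?u k = scale (c k) (rmul G R (?u (?x mod n)) F)"
      using f_eq[OF u, of k] graph_component_path[OF proj_I[OF _ u], of k] F(1) by simp
    moreover have "rmul G R (rmul G R (?u (?x mod n)) F) q w = 1"
      by (simp add: rmul_prod[OF direct(4)] unit)
    ultimately have "diff_at G R tau (f ?m ?u) (k + 1) w = c k"
      using left_T
      by (simp add: diff_at_def lmult_scale_left scale_apply del: map_option_eq_Some)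
    with L fd[OF u, of "k + 1"] show ?thesis
      by (simp add: mult.commute)
  next
    case (inverse p q w)
    let ?x = "k + s" and ?y = "k + 1 + s"
    let ?u = "unit_at ?y" and ?m = "deg S (k + 1 + s)"
    note u = unit_at_cterm[of ?y] and du = dB[OF unit_at_cterm[of ?y]]
    note w1 = is_prodD[OF inverse(3)] and w2 = is_prodD[OF inverse(4)]
    have pS: "nontrivial p" "pend G p = vtx S ?y"
      using inverse(1) homotopy_wordD[OF S_word, of ?x]
      by (auto simp: right_letter_def algebra_simps split: if_splits)
    have qT: "nontrivial q"
      using inverse(2) homotopy_wordD[OF tau_word, of k] by (auto simp: right_letter_def split: if_splits)
    have kap_1: "kap ?x = 1"
      using inverse(1) direct_d by (auto simp: right_letter_def unfold_band_simps split: if_splits)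
    have unit: "rmul G R (?u (?y mod n)) w w = 1"
      using w1 pS by (simp add: unit_at_mod rmul_unit)
    have "rmul G R (incoming G R (flipped_left S ?x) v) F w = 0" for v :: "_ \<Rightarrow> 'k"
    proof (cases "flipped_left S ?x" rule: entry.cases)
      case (1 y)
      have "consecutive (flipped_left S ?y) (flipped_left S ?x)"
        using consecutive_left[OF S_word, of ?y] by (simp add: algebra_simps)
      moreover have "flipped_left S ?y = Some (Dir p)"
        using flip_right_letter[of S ?x] inverse(1) by (simp add: algebra_simps)
      ultimately show ?thesis
        using 1 by (simp add: consecutive_def rmul_prod_other[OF inverse(3) pS(1)]
            del: map_option_eq_Some)
    qed auto
    moreover have "cdiff Bc ?m ?u (?x mod n) = rmul G R (?u (?y mod n)) p +
        scale (kap (?x - 1)) (incoming G R (flipped_left S ?x) (?u ((?x - 1) mod n)))"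
      using band_diff[OF band u, of ?m ?x] inverse(1) kap_1 by (simp add: algebra_simps)
    moreover have "f (?m + 1) (cdiff Bc ?m ?u) k =
        scale (c k) (rmul G R (cdiff Bc ?m ?u (?x mod n)) F)"
      using f_eq[OF du, of k] graph_component_path[OF proj_I[OF _ du], of k] F(1) by simp
    moreover have "rmul G R (rmul G R (?u (?y mod n)) p) F w = 1"
      by (simp add: rmul_prod[OF inverse(3)] unit)
    ultimately have L: "f (?m + 1) (cdiff Bc ?m ?u) k w = c k"
      by (simp add: lmult_add_left lmult_scale_left scale_apply)
    have "incoming G R (flipped_left tau k) v w = 0" for v :: "_ \<Rightarrow> 'k"
    proof (cases "flipped_left tau k" rule: entry.cases)
      case (1 y)
      have "flipped_left tau (k + 1) = Some (Dir q)"
        using flip_right_letter[of tau k] inverse(2) by simp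
      then show ?thesis
        using consecutive_left[OF tau_word, of "k + 1"] 1
        by (simp add: consecutive_def rmul_other[OF inverse(4) qT] del: map_option_eq_Some)
    qed auto
    moreover have "f ?m ?u (k + 1) = scale (c (k + 1)) (rmul G R (?u (?y mod n)) F')"
      using f_eq[OF u, of "k + 1"] graph_component_path[OF proj_I[OF _ u], of "k + 1"] F(2) by simp
    moreover have "rmul G R (rmul G R (?u (?y mod n)) F') q w = 1"
      by (simp add: rmul_prod[OF inverse(4)] unit)
    ultimately have "diff_at G R tau (f ?m ?u) k w = c (k + 1)"
      using inverse(2) by (simp add: diff_at_def lmult_scale_left scale_apply)
    with L fd[OF u, of k] kap_1 show ?thesis
      by simp
  qed
qed

text \<open>One full turn of the band passes the letter that carries \<open>\<lambda>\<close> exactly once.\<close>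

lemma scalar_period:
  assumes "\<And>i. j \<le> i \<Longrightarrow> i \<le> j + n \<Longrightarrow> component_path i \<noteq> None"
  shows "c j = lam * c (j + n)"
proof -
  have "c j = (\<Prod>i\<in>{j..<j + int t}. kap (i + s)) * c (j + int t)" if "int t \<le> n" for t
    using that
  proof (induction t)
    case (Suc t)
    have "{j..<j + int (Suc t)} = insert (j + int t) {j..<j + int t}"
      by auto
    moreover have "c (j + int t) = kap (j + int t + s) * c (j + int t + 1)"
      using assms[of "j + int t"] assms[of "j + int t + 1"] Suc.prems
      by (intro scalar_step) auto
    ultimately show ?case
      using Suc by (simp add: algebra_simps)
  qed simp
  from this[of "nat n"] have "c j = (\<Prod>i\<in>{j..<j + n}. kap (i + s)) * c (j + n)"
    using n_pos by simp
  moreover have "(\<Prod>i\<in>{j..<j + n}. kap (i + s)) = lam"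
  proof -
    define i0 where "i0 = j + (d - j - s) mod n"
    have i0: "i0 \<in> {j..<j + n}"
      using n_pos by (simp add: i0_def)
    have i0d: "(i0 + s) mod n = d"
    proof -
      have "(i0 + s) mod n = (j + s + (d - j - s)) mod n"
        unfolding i0_def
        by (metis (no_types, opaque_lifting) add.assoc add.commute mod_add_right_eq)
      then show ?thesis using d_range by simp
    qed
    have "kap (i + s) = (if i = i0 then lam else 1)" if "i \<in> {j..<j + n}" for i
    proof -
      have *: "i = i0" if "(i + s) mod n = d"
      proof -
        have "(i + s) mod n = (i0 + s) mod n"
          using that i0d by simp
        then have "n dvd (i + s) - (i0 + s)"
          by (simp only: mod_eq_dvd_iff)
        then have "n dvd i - i0" by simp
        moreover have "\<bar>i - i0\<bar> < n"
          using i0 \<open>i \<in> _\<close> by auto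
        ultimately show ?thesis
          using dvd_imp_le_int[of "i - i0" n] n_pos by (cases "i = i0") auto
      qed
      have "(i + s) mod n = d \<longleftrightarrow> i = i0"
        using * i0d by blast
      then show ?thesis by (simp only:)
    qed
    then have "(\<Prod>i\<in>{j..<j + n}. kap (i + s)) = (\<Prod>i\<in>{j..<j + n}. if i = i0 then lam else 1)"
      by (intro prod.cong) auto
    also have "\<dots> = lam"
      using i0 by (simp add: prod.delta)
    finally show ?thesis .
  qed
  ultimately show ?thesis by simp
qed

end

section \<open>Removing one turn of the band from the string\<close>

lemma chain_map_diff:
  assumes "chain_map A C D f" "chain_map A C D g" "dg_module A D"
  shows "chain_map A C D (\<lambda>m x. f m x - g m x)"
proof -
  have fl: "graded_linear A C D 0 f" and gl: "graded_linear A C D 0 g"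
    using assms by (auto simp: chain_map_def)
  note cl = graded_linearD(1)[OF fl, simplified] graded_linearD(1)[OF gl, simplified]
  have act: "cact D r (x - y) = cact D r x - cact D r y"
    if "r \<in> A" "x \<in> cterm D m" "y \<in> cterm D m" for r x y m
    using that dg_moduleD(4)[OF assms(3), of x m "- y" r] dg_moduleD(2)[OF assms(3)]
      dg_module_act_minus[OF assms(3)] by simp
  have diff: "cdiff D m (x - y) = cdiff D m x - cdiff D m y"
    if "x \<in> cterm D m" "y \<in> cterm D m" for x y m
    using graded_linear_diff[OF dg_moduleD(6)[OF assms(3)] assms(3) that] .
  have "graded_linear A C D 0 (\<lambda>m x. f m x - g m x)"
    unfolding graded_linear_def
    using cl by (auto simp: dg_module_diff[OF assms(3)] graded_linearD(2,3)[OF fl] graded_linearD(2,3)[OF gl]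
        act[OF _ cl])
  then show ?thesis
    using assms(1,2) cl by (auto simp: chain_map_def diff)
qed

context gentle_algebra
begin

lemma chain_map_scale:
  fixes W :: "('v, 'a) word"
  assumes f: "chain_map (Lam G R) C (string_complex G R W) (f :: int \<Rightarrow> 'm::ab_group_add \<Rightarrow> int \<Rightarrow> _ \<Rightarrow> 'k::field)"
    and W: "homotopy_word G R W"
  shows "chain_map (Lam G R) C (string_complex G R W) (\<lambda>m x j. scale k (f m x j))"
proof -
  let ?D = "string_complex G R W :: (_ \<Rightarrow> 'k, _) mod_complex"
  have fl: "graded_linear (Lam G R) C ?D 0 f"
    using f by (auto simp: chain_map_def)
  have cl: "(\<lambda>j. scale k (u j)) \<in> cterm ?D m" if "u \<in> cterm ?D m" for u m
    unfolding cterm_string_complex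
  proof
    show "finite {i. scale k (u i) \<noteq> 0}"
      by (rule finite_subset[of _ "{i. u i \<noteq> 0}"]) (use that in \<open>auto simp: cterm_string_complex\<close>)
    show "\<forall>i. scale k (u i) \<in> summand G R (pos W) (vtx W) (deg W) m i"
      using that by (auto simp: cterm_string_complex intro: summand_scale)
  qed
  have fm: "f m x \<in> cterm ?D m" if "x \<in> cterm C m" for m x
    using graded_linearD(1)[OF fl that] by simp
  have "graded_linear (Lam G R) C ?D 0 (\<lambda>m x j. scale k (f m x j))"
    unfolding graded_linear_def
  proof (intro allI ballI conjI)
    fix m x y r assume x: "x \<in> cterm C m"
    show "(\<lambda>j. scale k (f m x j)) \<in> cterm ?D (m + 0)"
      using cl[OF fm[OF x]] by simp
    show "(\<lambda>j. scale k (f m (x + y) j)) = (\<lambda>j. scale k (f m x j)) + (\<lambda>j. scale k (f m y j))"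
      if "y \<in> cterm C m"
      by (rule ext) (simp only: graded_linearD(2)[OF fl x that] plus_fun_apply[of _ _ "_::int"] scale_add)
    show "(\<lambda>j. scale k (f m (cact C r x) j)) = cact ?D r (\<lambda>j. scale k (f m x j))"
      if "r \<in> Lam G R"
      using graded_linearD(3)[OF fl x that]
      by (simp add: string_complex_matrix cact_proj_complex lmult_scale_right)
  qed
  moreover have "diff_at G R W (\<lambda>j. scale k (u j)) = (\<lambda>j. scale k (diff_at G R W u j))"
    for u :: "int \<Rightarrow> _ \<Rightarrow> 'k"
    by (rule ext) (simp add: diff_at_def lmult_scale_left scale_add)
  ultimately show ?thesis
    using f fm unfolding chain_map_def by (simp add: string_diff_at[OF cl[OF fm]] string_diff_at[OF fm])
qed

text \<open>
  An end condition with a nontrivial path compares two letters of the same direction which agree in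
  the arrow next to the overlap.
\<close>

lemma right_end_junction:
  assumes "right_end G R (Some l) (Some l') (Some f)" "nontrivial (letter_path l)"
    "nontrivial (letter_path l')"
  shows "junction R k l' \<longleftrightarrow> junction R k l"
proof -
  from assms(1) consider p q where "l = Dir p" "l' = Dir q" "is_prod G R p f q"
    | p q where "l = Inv p" "l' = Inv q" "is_prod G R f q p"
    by auto
  then show ?thesis
  proof cases
    case 1
    then have "last (snd q) = last (snd p)"
      using is_prodD(6)[OF 1(3)] assms(2) by (simp add: nontrivial_def)
    with 1 show ?thesis by (cases k) auto
  next
    case 2
    then have "hd (snd q) = hd (snd p)"
      using is_prodD(6)[OF 2(3)] assms(3) by (simp add: nontrivial_def)
    with 2 show ?thesis by (cases k) auto
  qed
qed

lemma left_end_junction: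
  assumes "left_end G R (Some l) (Some l') (Some f)" "nontrivial (letter_path l)"
    "nontrivial (letter_path l')"
  shows "junction R l' k \<longleftrightarrow> junction R l k"
proof -
  have "right_end G R (Some (flip l)) (Some (flip l')) (Some f)"
    using assms(1) unfolding left_end_flip by simp
  from right_end_junction[OF this, of "flip k"] show ?thesis
    using assms(2,3) by (simp add: junction_flip)
qed

end

text \<open>
  The solution of \<open>u j = y j + g j (u (j + n))\<close> for \<open>j \<le> p\<close> with initial values \<open>y\<close> beyond \<open>p\<close>.
\<close>

function descend :: "int \<Rightarrow> int \<Rightarrow> (int \<Rightarrow> 'e \<Rightarrow> 'e::plus) \<Rightarrow> (int \<Rightarrow> 'e) \<Rightarrow> int \<Rightarrow> 'e" where
  "descend n p g y j = (if 0 < n \<and> j \<le> p then y j + g j (descend n p g y (j + n)) else y j)"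
  by auto
termination
  by (relation "measure (\<lambda>(n, p, g, y, j). nat (p + 1 - j))") auto

declare descend.simps [simp del]

context band_graph_map
begin

definition K1 :: "int set" where "K1 = {j \<in> pos tau. j \<le> b - n}"
definition K2 :: "int set" where "K2 = {j. a \<le> j \<and> j + n \<in> pos tau}"

text \<open>
  The positions of \<open>\<tau>\<close> up to \<open>b - n\<close> keep their place, and those from \<open>b\<close> on move to the left by \<open>n\<close>.
  By periodicity, the shift by \<open>n\<close> describes the result already from the position \<open>a\<close> on, that is,
  on \<open>K2\<close>.
\<close>

definition shortened :: "('v, 'a) word" where
  "shortened =
     \<lparr>pos = K1 \<union> K2,
      vtx = (\<lambda>j. if j \<le> b - n then vtx tau j else vtx tau (j + n)),
      deg = (\<lambda>j. if j \<le> b - n then deg tau j else deg tau (j + n)),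
      ltr = (\<lambda>j. if j < b - n then ltr tau j else ltr tau (j + n))\<rparr>"

abbreviation Cc :: "(('v, 'a) qpath \<Rightarrow> 'k, int \<Rightarrow> ('v, 'a) qpath \<Rightarrow> 'k) mod_complex" where
  "Cc \<equiv> string_complex G R shortened"

lemma pos_tau_interval: "x \<in> pos tau \<Longrightarrow> z \<in> pos tau \<Longrightarrow> x \<le> y \<Longrightarrow> y \<le> z \<Longrightarrow> y \<in> pos tau"
  using tau_word unfolding homotopy_word_def int_interval_def by (meson atLeastAtMost_iff subset_iff)

lemma I_pos: "a \<le> j \<Longrightarrow> j \<le> b \<Longrightarrow> j \<in> pos tau"
  using on_I(1) mem_I by blast

lemma in_K1: "j \<in> K1 \<longleftrightarrow> j \<in> pos tau \<and> j \<le> b - n"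
  by (simp add: K1_def)

lemma in_K2: "j \<in> K2 \<longleftrightarrow> a \<le> j \<and> j + n \<in> pos tau"
  by (simp add: K2_def)

lemma pos_shortened: "j \<in> pos shortened \<longleftrightarrow> (if j \<le> b - n then j \<in> pos tau else j + n \<in> pos tau)"
  using I_pos[of j] n_pos winds by (auto simp: shortened_def in_K1 in_K2)

lemma tau_periodic:
  assumes "a \<le> j" "j \<le> b - n"
  shows "vtx tau (j + n) = vtx tau j" "deg tau (j + n) = deg tau j"
    "j < b - n \<Longrightarrow> ltr tau (j + n) = ltr tau j"
  using assms n_pos on_I[of j] on_I[of "j + n"] inside_I[of j] inside_I[of "j + n"] S_periodic[of "j + s"]
  by (auto simp: mem_I algebra_simps)

lemma shortened_left: "j \<le> b - n \<Longrightarrow> vtx shortened j = vtx tau j \<and> deg shortened j = deg tau j"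
  by (simp add: shortened_def)

lemma shortened_right: "a \<le> j \<Longrightarrow> vtx shortened j = vtx tau (j + n) \<and> deg shortened j = deg tau (j + n)"
  using tau_periodic[of j] by (simp add: shortened_def)

lemma shortened_ltr_left: "j < b - n \<Longrightarrow> ltr shortened j = ltr tau j"
  by (simp add: shortened_def)

lemma shortened_ltr_right: "a \<le> j \<Longrightarrow> ltr shortened j = ltr tau (j + n)"
  using tau_periodic[of j] by (simp add: shortened_def)

lemma links_shortened: "j \<in> links shortened \<longleftrightarrow> (if j < b - n then j \<in> links tau else j + n \<in> links tau)"
  using I_pos[of b] I_pos[of "b - n"] n_pos winds
  by (auto simp: links_def pos_shortened algebra_simps)

text \<open>
  If \<open>\<tau>\<close> contains exactly one full turn of the band, cutting it out joins two letters that were not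
  neighbours of each other.  If one of them is parallel to its counterpart in the band, the junction
  is one of \<open>\<tau>\<close>.  Otherwise the two arrows at the junction could only coincide if this arrow
  formed relations with two different arrows.
\<close>

lemma cut_junction:
  assumes b: "b = a + n" and l: "a - 1 \<in> links tau" "b \<in> links tau"
  shows "junction R (ltr tau (a - 1)) (ltr tau b)"
proof -
  define tL tR z w where "tL = ltr tau (a - 1)" and "tR = ltr tau b"
    and "z = ltr tau (b - 1)" and "w = ltr tau a"
  have li: "a \<in> links tau" "b - 1 \<in> links tau" "w = ltr S (a + s)" "z = ltr S (b - 1 + s)"
    using inside_I[of a] inside_I[of "b - 1"] b n_pos by (auto simp: mem_I w_def z_def)
  then have li': "z = ltr S (a - 1 + s)" "w = ltr S (b + s)"
    using S_periodic(3)[of "a - 1 + s"] S_periodic(3)[of "a + s"] by (simp_all add: b algebra_simps)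
  have nt: "nontrivial (letter_path tL)" "nontrivial (letter_path tR)"
    "nontrivial (letter_path z)" "nontrivial (letter_path w)"
    using homotopy_wordD(2)[OF tau_word] l li(1,2) by (auto simp: tL_def tR_def z_def w_def)
  have zR: "junction R z tR" and Lw: "junction R tL w"
    using homotopy_wordD(6)[OF tau_word, of "b - 1"] homotopy_wordD(6)[OF tau_word, of "a - 1"] l li(1,2)
    by (simp_all add: tL_def tR_def z_def w_def)
  have "a \<in> I" "a - 1 \<notin> I" "b \<in> I" "b + 1 \<notin> I"
    using b n_pos by (auto simp: mem_I)
  then have "left_end G R (left_letter S (a + s)) (left_letter tau a) fL"
    "right_end G R (right_letter S (b + s)) (right_letter tau b) fR"
    using ends by (simp_all add: end_conditions_def del: left_end.simps right_end.simps)
  then have le: "left_end G R (Some z) (Some tL) fL" and re: "right_end G R (Some w) (Some tR) fR"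
    using l li' by (simp_all add: left_letter_def right_letter_def unfold_band_simps tL_def tR_def algebra_simps)
  show ?thesis
  proof (cases fL)
    case (Some g)
    with le zR nt show ?thesis
      using left_end_junction[of z tL g tR] by (simp add: tL_def tR_def del: left_end.simps)
  next
    case None
    show ?thesis
    proof (cases fR)
      case (Some g)
      with re Lw nt show ?thesis
        using right_end_junction[of w tR g tL] by (simp add: tL_def tR_def del: right_end.simps)
    next
      case fR: None
      obtain p q p' q' where lp: "z = Inv p" "tL = Dir q" "w = Dir p'" "tR = Inv q'"
        using le re None fR
        by (cases z; cases tL; cases w; cases tR) (auto simp: empty_or_direct_def empty_or_inverse_def)
      have "junction R z w"
        using homotopy_wordD(6)[OF S_word, of "a - 1 + s"] li' li(3) by (simp add: unfold_band_simps(5) algebra_simps)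
      then have ne: "last (snd p) \<noteq> last (snd p')"
        using lp by simp
      have rel: "(hd (snd q'), last (snd p)) \<in> R" "(hd (snd q), last (snd p')) \<in> R"
        using zR Lw lp by simp_all
      have "hd (snd q) \<noteq> hd (snd q')"
      proof
        assume eq: "hd (snd q) = hd (snd q')"
        have "last (snd p) = last (snd p')"
          using before_zero[of "hd (snd q)"] rel relations unfolding eq Uniq_def by blast
        with ne show False ..
      qed
      then show ?thesis
        using lp by (simp add: tL_def tR_def)
    qed
  qed
qed

lemma shortened_word: "homotopy_word G R shortened"
  unfolding homotopy_word_def
proof (intro conjI ballI impI)
  have "a \<in> pos shortened"
    using I_pos[of a] winds n_pos by (simp add: pos_shortened)
  moreover have "{i..k} \<subseteq> pos shortened" if "i \<in> pos shortened" "k \<in> pos shortened" for i k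
  proof
    fix j assume j: "j \<in> {i..k}"
    show "j \<in> pos shortened"
    proof (cases "j \<le> b - n")
      case True
      then have "i \<in> pos tau" using that(1) j by (simp add: pos_shortened)
      moreover have "b \<in> pos tau" using I_pos[of b] winds n_pos by simp
      ultimately show ?thesis
        using pos_tau_interval[of i b j] True j n_pos by (simp add: pos_shortened)
    next
      case False
      then have "k + n \<in> pos tau" using that(2) j by (simp add: pos_shortened)
      moreover have "b \<in> pos tau" using I_pos[of b] winds n_pos by simp
      ultimately show ?thesis
        using pos_tau_interval[of b "k + n" "j + n"] False j by (simp add: pos_shortened)
    qed
  qed
  ultimately show "int_interval (pos shortened)"
    by (auto simp: int_interval_def)
next
  fix i assume i: "i \<in> pos shortened"
  have "vtx tau j \<in> verts G" if "j \<in> pos tau" for j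
    using tau_word that by (simp add: homotopy_word_def)
  then show "vtx shortened i \<in> verts G"
    using i shortened_left[of i] shortened_right[of i] winds
    by (cases "i \<le> b - n") (simp_all add: pos_shortened)
next
  fix i assume i: "i \<in> links shortened"
  define i' where "i' = (if i < b - n then i else i + n)"
  have i': "i' \<in> links tau" "ltr shortened i = ltr tau i'"
    using i winds
    by (cases "i < b - n"; simp add: links_shortened i'_def shortened_ltr_left shortened_ltr_right)+
  have "vtx shortened i = vtx tau i' \<and> deg shortened i = deg tau i'"
    "vtx shortened (i + 1) = vtx tau (i' + 1) \<and> deg shortened (i + 1) = deg tau (i' + 1)"
    using shortened_left[of i] shortened_left[of "i + 1"] shortened_right[of i] shortened_right[of "i + 1"] winds
    by (auto simp: i'_def algebra_simps)
  then show "nonzero_path G R (letter_path (ltr shortened i))"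
    "nontrivial (letter_path (ltr shortened i))"
    "lend G (ltr shortened i) = vtx shortened i" "lstart G (ltr shortened i) = vtx shortened (i + 1)"
    "deg shortened (i + 1) = (if is_direct (ltr shortened i) then deg shortened i + 1 else deg shortened i - 1)"
    using homotopy_wordD(1-5)[OF tau_word i'(1)] i'(2) by simp_all
  assume i1: "i + 1 \<in> links shortened"
  consider "i + 1 < b - n" | "i \<ge> b - n" | "i + 1 = b - n" "i \<ge> a" | "i + 1 = b - n" "b - n = a"
    using winds by linarith
  then show "junction R (ltr shortened i) (ltr shortened (i + 1))"
  proof cases
    case 1
    then show ?thesis
      using homotopy_wordD(6)[OF tau_word, of i] i i1 by (simp add: links_shortened shortened_ltr_left)
  next
    case 2
    then show ?thesis
      using homotopy_wordD(6)[OF tau_word, of "i + n"] i i1 winds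
      by (simp add: links_shortened shortened_ltr_right algebra_simps)
  next
    case 3
    then have "i + n \<in> links tau"
      using inside_I(1)[of "i + n"] n_pos by (simp add: mem_I)
    with 3 show ?thesis
      using homotopy_wordD(6)[OF tau_word, of "i + n"] i1
      by (simp add: links_shortened shortened_ltr_right algebra_simps)
  next
    case 4
    then have x: "i + 1 + n = b" "i < b - n" "a \<le> i + 1" "i = a - 1" and ba: "b = a + n"
      by auto
    have "i \<in> links tau" "b \<in> links tau"
      using i i1 links_shortened[of i] links_shortened[of "i + 1"] x(1,2) by (simp_all split: if_splits)
    moreover have "ltr shortened i = ltr tau i" "ltr shortened (i + 1) = ltr tau b"
      using shortened_ltr_left[OF x(2)] shortened_ltr_right[OF x(3)] x(1) by simp_all
    ultimately show ?thesis
      using cut_junction[OF ba] x(4) by metis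
  qed
qed

text \<open>
  The word \<open>\<tau>\<close> and the shortened word have the two overlaps \<open>K1\<close> and \<open>K2\<close>.  To the right of \<open>K1\<close>, the
  letters of \<open>\<tau>\<close> and of the shortened word are those that the band and \<open>\<tau>\<close> have to the right of the
  overlap of \<open>f\<close>; the same holds to the left of \<open>K2\<close>.  So each of the two inherits one end condition
  from \<open>f\<close>, and at its other end it is infinite or both words end.
\<close>

lemma common_K1: "common_subword tau shortened K1 0"
proof -
  have "K1 \<noteq> {}"
    using I_pos[of a] winds n_pos by (auto simp: K1_def)
  moreover have "{i..k} \<subseteq> K1" if "i \<in> K1" "k \<in> K1" for i k
  proof
    fix j assume "j \<in> {i..k}"
    then show "j \<in> K1"
      using that pos_tau_interval[of i k j] by (simp add: in_K1)
  qed
  ultimately have "int_interval K1"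
    by (simp add: int_interval_def)
  moreover have "K1 \<subseteq> pos shortened"
    by (auto simp: in_K1 pos_shortened)
  ultimately show ?thesis
    by (auto simp: common_subword_def in_K1 shortened_left shortened_ltr_left)
qed

lemma common_K2: "common_subword tau shortened K2 n"
proof -
  have "a \<in> K2"
    using I_pos[of "a + n"] winds n_pos by (auto simp: in_K2)
  moreover have "{i..k} \<subseteq> K2" if "i \<in> K2" "k \<in> K2" for i k
  proof
    fix j assume "j \<in> {i..k}"
    then show "j \<in> K2"
      using that pos_tau_interval[of "i + n" "k + n" "j + n"] by (auto simp: in_K2)
  qed
  ultimately have "int_interval K2"
    by (auto simp: int_interval_def)
  moreover have "K2 \<subseteq> pos shortened"
    by (simp add: shortened_def)
  ultimately show ?thesis
    by (auto simp: common_subword_def in_K2 shortened_right shortened_ltr_right)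
qed

lemma ends_K1: "end_conditions G R tau shortened K1 0 None fR"
  unfolding end_conditions_def
proof (intro conjI allI impI)
  fix x assume x: "x \<in> K1 \<and> x - 1 \<notin> K1"
  then have "x - 1 \<notin> pos tau"
    by (auto simp: in_K1)
  then show "left_end G R (left_letter tau (x + 0)) (left_letter shortened x) None"
    using x by (auto simp: left_letter_def links_def pos_shortened in_K1 empty_or_direct_def empty_or_inverse_def)
next
  fix y assume y: "y \<in> K1 \<and> y + 1 \<notin> K1"
  have "y = b - n"
  proof (rule ccontr)
    assume "y \<noteq> b - n"
    with y have "y + 1 \<le> b - n" "y \<in> pos tau"
      by (auto simp: in_K1)
    then show False
      using y pos_tau_interval[of y "b - n" "y + 1"] I_pos[of "b - n"] winds n_pos by (simp add: in_K1)
  qed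
  moreover have "right_end G R (right_letter S (b + s)) (right_letter tau b) fR"
    using ends winds n_pos by (simp add: end_conditions_def mem_I del: right_end.simps)
  moreover have "right_letter S (b + s) = right_letter tau (b - n)"
    using inside_I[of "b - n"] winds n_pos S_periodic(3)[of "b - n + s"]
    by (simp add: right_letter_def mem_I unfold_band_simps(5))
  moreover have "right_letter tau b = right_letter shortened (b - n)"
    using winds by (simp add: right_letter_def links_shortened shortened_ltr_right)
  ultimately show "right_end G R (right_letter tau (y + 0)) (right_letter shortened y) fR"
    by (simp del: right_end.simps)
qed

lemma ends_K2: "end_conditions G R tau shortened K2 n fL None"
  unfolding end_conditions_def
proof (intro conjI allI impI)
  fix x assume x: "x \<in> K2 \<and> x - 1 \<notin> K2"
  have "x = a"
  proof (rule ccontr)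
    assume "x \<noteq> a"
    with x have "a \<le> x - 1" "x + n \<in> pos tau"
      by (auto simp: in_K2)
    then show False
      using x pos_tau_interval[of a "x + n" "x - 1 + n"] I_pos[of a] winds n_pos by (simp add: in_K2)
  qed
  moreover have "left_end G R (left_letter S (a + s)) (left_letter tau a) fL"
    using ends winds n_pos by (simp add: end_conditions_def mem_I del: left_end.simps)
  moreover have "left_letter S (a + s) = left_letter tau (a + n)"
    using inside_I[of "a + n - 1"] winds n_pos S_periodic(3)[of "a - 1 + s"]
    by (simp add: left_letter_def mem_I unfold_band_simps(5) algebra_simps)
  moreover have "left_letter tau a = left_letter shortened a"
    using winds by (simp add: left_letter_def links_shortened shortened_ltr_left)
  ultimately show "left_end G R (left_letter tau (x + n)) (left_letter shortened x) fL"
    by (simp del: left_end.simps)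
next
  fix y assume y: "y \<in> K2 \<and> y + 1 \<notin> K2"
  then have "y + 1 + n \<notin> pos tau"
    by (auto simp: in_K2)
  moreover have "y + n \<in> pos tau" using y by (simp add: in_K2)
  moreover have "b - n \<le> y"
  proof -
    have "\<not> y + 1 + n \<le> b"
      using I_pos[of "y + 1 + n"] y calculation(1) n_pos by (auto simp: in_K2)
    then show ?thesis by linarith
  qed
  ultimately have "y + n \<notin> links tau" "y \<notin> links shortened"
    by (simp_all add: links_shortened) (simp_all add: links_def algebra_simps)
  then show "right_end G R (right_letter tau (y + n)) (right_letter shortened y) None"
    by (simp add: right_letter_def empty_or_direct_def empty_or_inverse_def)
qed

end

section \<open>The cokernel of the graph map\<close>

context band_graph_map
begin

text \<open>
  The difference of the two graph maps with the overlaps \<open>K1\<close> and \<open>K2\<close>, where the factor \<open>\<lambda>\<close> makes it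
  vanish on the image of \<open>f\<close>.
\<close>

definition quot :: "int \<Rightarrow> (int \<Rightarrow> ('v, 'a) qpath \<Rightarrow> 'k) \<Rightarrow> int \<Rightarrow> ('v, 'a) qpath \<Rightarrow> 'k" where
  "quot m u = (\<lambda>j. graph_component G R K1 None fR j (u j) -
     scale lam (graph_component G R K2 fL None j (u (j + n))))"

text \<open>
  The last \<open>n\<close> positions of the overlap form one full turn of the band; \<open>turn v\<close> is the one among
  them over the vertex \<open>v\<close> of the band.
\<close>

definition turn :: "int \<Rightarrow> int" where
  "turn v = b - (b + s - v) mod n"

definition retr :: "int \<Rightarrow> (int \<Rightarrow> ('v, 'a) qpath \<Rightarrow> 'k) \<Rightarrow> int \<Rightarrow> ('v, 'a) qpath \<Rightarrow> 'k" where
  "retr m u = (\<lambda>v. if v \<in> {0..<n} then scale (inverse (c (turn v))) (u (turn v)) else 0)"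

lemma quot_chain_map: "chain_map (Lam G R) Tc Cc quot"
proof -
  note dg = string_complex_dg[OF shortened_word]
  have "chain_map (Lam G R) Tc Cc (\<lambda>m u j. graph_component G R K1 None fR j (u j))"
    using string_graph_map_chain_map[OF tau_word shortened_word common_K1 ends_K1] by simp
  moreover have "chain_map (Lam G R) Tc Cc (\<lambda>m u j. scale lam (graph_component G R K2 fL None j (u (j + n))))"
    by (rule chain_map_scale[OF string_graph_map_chain_map[OF tau_word shortened_word common_K2 ends_K2]
          shortened_word])
  ultimately have "chain_map (Lam G R) Tc Cc (\<lambda>m u. (\<lambda>j. graph_component G R K1 None fR j (u j)) -
      (\<lambda>j. scale lam (graph_component G R K2 fL None j (u (j + n)))))"
    by (rule chain_map_diff) (rule dg)
  then show ?thesis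
    by (simp add: quot_def[abs_def] fun_diff_def)
qed

text \<open>
  Both summands of the quotient map turn the graph map into the graph map to the complex of the
  shortened word; the scalars that arise differ by one turn around the band, that is, by \<open>\<lambda>\<close>.
\<close>

lemma quot_f:
  assumes u: "u \<in> cterm Bc m"
  shows "quot m (f m u) = 0"
proof
  fix j
  let ?x = "u ((j + s) mod n)"
  let ?A = "graph_component G R K1 None fR j (graph_component G R I fL fR j ?x)"
  let ?A' = "graph_component G R K2 fL None j (graph_component G R I fL fR (j + n) ?x)"
  have comp: "component_path i \<noteq> None"
    if "a \<le> i \<and> i \<le> b \<or> i = a - 1 \<and> fL \<noteq> None \<or> i = b + 1 \<and> fR \<noteq> None" for i
    using that winds n_pos by (auto simp: component_path_def mem_I)
  have fL_None: "fL = None" if "a - 1 \<notin> pos tau"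
  proof -
    have "left_end G R (left_letter S (a + s)) (left_letter tau a) fL"
      using ends winds n_pos by (simp add: end_conditions_def mem_I del: left_end.simps)
    with that show ?thesis
      by (cases fL) (auto simp: left_letter_def links_def)
  qed
  have fR_None: "fR = None" if "b + 1 \<notin> pos tau"
  proof -
    have "right_end G R (right_letter S (b + s)) (right_letter tau b) fR"
      using ends winds n_pos by (simp add: end_conditions_def mem_I del: right_end.simps)
    with that show ?thesis
      by (cases fR) (auto simp: right_letter_def links_def)
  qed
  note gc = graph_component_def mem_I in_K1 in_K2
  have "?A = ?A' \<and> (?A = 0 \<or> c j = lam * c (j + n))"
  proof -
    consider "a \<le> j" "j \<le> b - n" | "j = a - 1" | "j = b - n + 1" | "j < a - 1" | "j > b - n + 1"
      by linarith
    then show ?thesis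
    proof cases
      case 1
      then have "c j = lam * c (j + n)"
        using comp by (intro scalar_period) auto
      with 1 n_pos show ?thesis
        using I_pos[of j] I_pos[of "j + n"] by (simp add: gc)
    next
      case 2
      have "?A = rmul_opt G R ?x fL"
        using 2 winds n_pos fL_None I_pos[of a] by (cases "a - 1 \<in> pos tau") (simp_all add: gc)
      moreover have "?A' = rmul_opt G R ?x fL"
        using 2 winds n_pos I_pos[of "a + n"] by (simp add: gc)
      moreover have "c j = lam * c (j + n)" if "fL \<noteq> None"
      proof (rule scalar_period)
        fix i assume "j \<le> i" "i \<le> j + n"
        then have "a \<le> i \<and> i \<le> b \<or> i = a - 1"
          using 2 winds n_pos by linarith
        then show "component_path i \<noteq> None"
          using comp[of i] that by blast
      qed
      ultimately show ?thesis
        by (cases fL) auto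
    next
      case 3
      have "?A = rmul_opt G R ?x fR"
        using 3 winds n_pos I_pos[of "b - n"] by (simp add: gc)
      moreover have "b + 2 \<notin> pos tau" if "b + 1 \<notin> pos tau"
        using that pos_tau_interval[of b "b + 2" "b + 1"] I_pos[of b] winds n_pos by auto
      then have "?A' = rmul_opt G R ?x fR"
        using 3 winds n_pos fR_None I_pos[of b]
        by (cases "b + 1 \<in> pos tau") (simp_all add: gc)
      moreover have "c j = lam * c (j + n)" if "fR \<noteq> None"
      proof (rule scalar_period)
        fix i assume "j \<le> i" "i \<le> j + n"
        then have "a \<le> i \<and> i \<le> b \<or> i = b + 1"
          using 3 winds n_pos by linarith
        then show "component_path i \<noteq> None"
          using comp[of i] that by blast
      qed
      ultimately show ?thesis
        by (cases fR) auto
    next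
      case 4
      then show ?thesis
        using winds n_pos by (simp add: gc)
    next
      case 5
      then show ?thesis
        using winds n_pos by (simp add: gc)
    qed
  qed
  moreover have "(j + n + s) mod n = (j + s) mod n"
    by (metis add.assoc add.commute mod_add_self2)
  then have "quot m (f m u) j = scale (c j) ?A - scale (lam * c (j + n)) ?A'"
    by (simp add: quot_def f_eq[OF u] graph_component_scale)
  ultimately have "quot m (f m u) j = 0"
    by auto
  then show "quot m (f m u) j = 0 j"
    by (simp only: zero_fun_apply)
qed

lemma turn_props: "turn v \<in> I" "v \<in> {0..<n} \<Longrightarrow> (turn v + s) mod n = v" "b - n < turn v" "turn v \<le> b"
proof -
  have m: "0 \<le> (b + s - v) mod n" "(b + s - v) mod n < n"
    using n_pos by auto
  then show "b - n < turn v" "turn v \<le> b"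
    unfolding turn_def by linarith+
  then show "turn v \<in> I"
    using winds by (simp add: mem_I)
  have "(turn v + s) mod n = (b + s - (b + s - v)) mod n"
    unfolding turn_def by (metis add.commute add_diff_eq mod_diff_right_eq)
  then show "v \<in> {0..<n} \<Longrightarrow> (turn v + s) mod n = v"
    by simp
qed

lemma turn_onto:
  assumes "b - n < j" "j \<le> b"
  shows "turn ((j + s) mod n) = j"
proof -
  have "(b + s - (j + s) mod n) mod n = (b + s - (j + s)) mod n"
    by (simp add: mod_simps)
  also have "\<dots> = b - j"
    using assms by simp
  finally show ?thesis
    by (simp add: turn_def)
qed

lemma retr_linear: "graded_linear (Lam G R) Tc Bc 0 retr"
proof -
  have in_B: "retr m u \<in> cterm Bc (m + 0)" if u: "u \<in> cterm Tc m" for m u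
    unfolding cterm_band_complex[OF band]
  proof
    show "finite {i. retr m u i \<noteq> 0}"
      by (rule finite_subset[of _ "{0..<n}"]) (auto simp: retr_def)
    show "\<forall>v. retr m u v \<in> summand G R {0..<n} (vtx sigma) (deg sigma) (m + 0) v"
    proof
      fix v
      have su: "u (turn v) \<in> summand G R (pos tau) (vtx tau) (deg tau) m (turn v)"
        using u by (simp add: cterm_string_complex)
      show "retr m u v \<in> summand G R {0..<n} (vtx sigma) (deg sigma) (m + 0) v"
      proof (cases "v \<in> {0..<n} \<and> u (turn v) \<noteq> 0")
        case True
        then have v: "vtx tau (turn v) = vtx sigma v" "deg tau (turn v) = deg sigma v"
          using turn_props on_I by (simp_all add: unfold_band_simps)
        have "u (turn v) \<in> proj G R (vtx sigma v)" "deg sigma v = m"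
          using summand_nonzero[OF su] True v by auto
        with True show ?thesis
          by (auto simp: retr_def summand_def intro: proj_scale)
      qed (auto simp: retr_def)
    qed
  qed
  show ?thesis
    unfolding graded_linear_def
  proof (intro allI ballI conjI)
    fix m u v r assume u: "u \<in> cterm Tc m"
    show "retr m u \<in> cterm Bc (m + 0)"
      by (rule in_B[OF u])
    show "retr m (u + v) = retr m u + retr m v"
      by (rule ext) (simp add: retr_def scale_add plus_fun_apply[of _ _ "_::int"] del: plus_fun_apply)
    show "retr m (cact Tc r u) = cact Bc r (retr m u)"
      by (rule ext) (simp add: retr_def string_complex_matrix band_complex_matrix[OF n_pos]
          cact_proj_complex lmult_scale_right)
  qed
qed

lemma retr_f:
  assumes u: "u \<in> cterm Bc m"
  shows "retr m (f m u) = u"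
proof
  fix v
  have "u v = 0" if "v \<notin> {0..<n}"
  proof -
    have "u v \<in> summand G R {0..<n} (vtx sigma) (deg sigma) m v"
      using u by (simp add: cterm_band_complex[OF band])
    with that show ?thesis
      unfolding summand_def by (auto split: if_splits)
  qed
  moreover have "scale (inverse (c (turn v))) (f m u (turn v)) = u v" if "v \<in> {0..<n}"
    using that turn_props c_nonzero by (simp add: f_eq[OF u] graph_component_def)
  ultimately show "retr m (f m u) v = u v"
    by (auto simp: retr_def)
qed

text \<open>
  An element of the complex of \<open>\<tau>\<close> that vanishes on the last turn is determined by its image in
  the cokernel: to the right of the overlap directly, and to the left by descending in steps of \<open>n\<close>.
\<close>

lemma quot_retr_inj:
  assumes u: "u \<in> cterm Tc m" and q: "quot m u = 0" and r: "retr m u = 0"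
  shows "u = 0"
proof -
  have su: "u j = 0" if "j \<notin> pos tau" for j
  proof -
    have "u j \<in> summand G R (pos tau) (vtx tau) (deg tau) m j"
      using u by (simp add: cterm_string_complex)
    with that show ?thesis
      unfolding summand_def by simp
  qed
  have qj: "graph_component G R K1 None fR j (u j) = scale lam (graph_component G R K2 fL None j (u (j + n)))" for j
    using fun_cong[OF q, of j] by (simp add: quot_def)
  have mid: "u j = 0" if j: "b - n < j" "j \<le> b" for j
  proof -
    have "scale (inverse (c j)) (u j) = 0"
      using fun_cong[OF r, of "(j + s) mod n"] n_pos turn_onto[OF j] by (simp add: retr_def)
    then have "scale (c j) (scale (inverse (c j)) (u j)) = scale (c j) 0"
      by (rule arg_cong)
    then show ?thesis
      using c_nonzero[of j] by simp
  qed
  have right: "u j = 0" if j: "b < j" for j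
  proof (cases "j \<in> pos tau")
    case True
    have "u (j - n) = 0 \<or> j - n > b"
      using mid[of "j - n"] j by linarith
    moreover have "graph_component G R K1 None fR (j - n) (u (j - n)) = 0"
      using calculation n_pos by (auto simp: graph_component_def in_K1)
    moreover have "j - n \<in> K2"
      using True j winds by (simp add: in_K2)
    ultimately have "scale lam (u j) = 0"
      using qj[of "j - n"] by (simp add: graph_component_def)
    then have "scale (inverse lam) (scale lam (u j)) = scale (inverse lam) 0"
      by (rule arg_cong)
    then show ?thesis
      using lam by simp
  qed (rule su)
  have left: "u j = 0" if "j \<le> b" for j
    using that
  proof (induction "nat (b - j)" arbitrary: j rule: less_induct)
    case less
    show ?case
    proof (cases "b - n < j \<or> j \<notin> pos tau")
      case True
      then show ?thesis using mid less.prems su by auto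
    next
      case False
      then have "u (j + n) = 0"
        using less.hyps[of "j + n"] n_pos by simp
      with False qj[of j] show ?thesis
        by (simp add: graph_component_def in_K1)
    qed
  qed
  show ?thesis
    using left right by (intro ext[of u 0]) (metis linorder_not_le zero_fun_apply)
qed

text \<open>
  The preimage that vanishes on the last turn is found by the same descent.
\<close>

lemma quot_retr_surj:
  assumes y: "y \<in> cterm Cc m"
  shows "\<exists>u\<in>cterm Tc m. quot m u = y \<and> retr m u = 0"
proof -
  define y' where "y' j = (if j \<le> b - n then y j else if j \<le> b then 0
    else scale (- inverse lam) (y (j - n)))" for j
  define g where "g j x = scale lam (graph_component G R K2 fL None j x)" for j and x :: "_ \<Rightarrow> 'k"
  define u where "u = descend n (b - n) g y'"
  have u_left: "u j = y j + g j (u (j + n))" if "j \<le> b - n" for j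
    using that n_pos descend.simps[of n "b - n" g y' j] by (simp add: u_def y'_def)
  have u_mid: "u j = 0" if "b - n < j" "j \<le> b" for j
    using that descend.simps[of n "b - n" g y' j] by (simp add: u_def y'_def)
  have u_right: "u j = scale (- inverse lam) (y (j - n))" if "b < j" for j
    using that descend.simps[of n "b - n" g y' j] n_pos by (simp add: u_def y'_def)
  have fy: "finite {j. y j \<noteq> 0}" and sy: "y j \<in> summand G R (pos shortened) (vtx shortened) (deg shortened) m j" for j
    using y by (auto simp: cterm_string_complex)
  have su: "u j \<in> summand G R (pos tau) (vtx tau) (deg tau) m j" for j
  proof (induction "nat (b + 1 - j)" arbitrary: j rule: less_induct)
    case less
    consider "j \<le> b - n" | "b - n < j" "j \<le> b" | "b < j"
      by linarith
    then show ?case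
    proof cases
      case 1
      then have "u (j + n) \<in> summand G R (pos tau) (vtx tau) (deg tau) m (j + n)"
        using less n_pos by simp
      then have "g j (u (j + n)) \<in> summand G R (pos shortened) (vtx shortened) (deg shortened) m j"
        unfolding g_def
        by (intro summand_scale graph_component_summand[OF tau_word shortened_word common_K2 ends_K2])
      then have "u j \<in> summand G R (pos shortened) (vtx shortened) (deg shortened) m j"
        unfolding u_left[OF 1] using sy by (intro summand_add)
      then show ?thesis
        using 1 shortened_left[OF 1] pos_shortened[of j] by (simp add: summand_def split: if_splits)
    next
      case 2
      then show ?thesis by (simp add: u_mid)
    next
      case 3
      have "u j \<in> summand G R (pos shortened) (vtx shortened) (deg shortened) m (j - n)"
        unfolding u_right[OF 3] by (intro summand_scale sy)
      then show ?thesis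
        using 3 shortened_right[of "j - n"] winds pos_shortened[of "j - n"] by (simp add: summand_def split: if_splits)
    qed
  qed
  have "{j. u j \<noteq> 0} \<subseteq> {j. y j \<noteq> 0} \<union> {a - 1..b} \<union> (\<lambda>j. j + n) ` {j. y j \<noteq> 0}"
  proof
    fix j assume "j \<in> {j. u j \<noteq> 0}"
    then have nz: "u j \<noteq> 0" by simp
    consider "j < a - 1" | "a - 1 \<le> j" "j \<le> b" | "b < j"
      by linarith
    then show "j \<in> {j. y j \<noteq> 0} \<union> {a - 1..b} \<union> (\<lambda>j. j + n) ` {j. y j \<noteq> 0}"
    proof cases
      case 1
      then have "g j (u (j + n)) = 0"
        by (simp add: g_def graph_component_def in_K2)
      then show ?thesis
        using nz u_left[of j] 1 winds by auto
    next
      case 3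
      then have "y (j - n) \<noteq> 0"
        using nz by (auto simp: u_right)
      then show ?thesis
        by (intro UnI2 image_eqI[of _ _ "j - n"]) auto
    qed auto
  qed
  then have "finite {j. u j \<noteq> 0}"
    by (rule finite_subset) (use fy in auto)
  with su have uT: "u \<in> cterm Tc m"
    by (simp add: cterm_string_complex)
  have "quot m u = y"
  proof
    fix j
    consider "j \<le> b - n" | "b - n < j"
      by linarith
    then show "quot m u j = y j"
    proof cases
      case 1
      have "u j = 0" if "j \<notin> pos tau"
        using su[of j] that unfolding summand_def by simp
      then have "graph_component G R K1 None fR j (u j) = u j"
        using 1 by (auto simp: graph_component_def in_K1)
      then show ?thesis
        using u_left[OF 1] by (simp add: quot_def g_def)
    next
      case 2
      have "graph_component G R K1 None fR j (u j) = 0"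
        using 2 u_mid[of j] n_pos winds by (cases "j \<le> b") (auto simp: graph_component_def in_K1)
      moreover have "graph_component G R K2 fL None j (u (j + n)) = u (j + n)"
      proof (cases "j \<in> K2")
        case False
        then have "u (j + n) = 0"
          using su[of "j + n"] 2 winds unfolding summand_def by (simp add: in_K2)
        then show ?thesis by simp
      qed (simp add: graph_component_def)
      ultimately have "quot m u j = 0 - scale lam (scale (- inverse lam) (y j))"
        using 2 u_right[of "j + n"] by (simp only: quot_def add_diff_cancel_right')
      also have "\<dots> = y j"
        using lam by (intro ext) (simp add: scale_apply)
      finally show ?thesis .
    qed
  qed
  moreover have "retr m u = 0"
  proof
    fix v
    have "retr m u v = 0"
      by (simp add: retr_def u_mid[OF turn_props(3,4)])
    then show "retr m u v = 0 v"
      by (simp only: zero_fun_apply)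
  qed
  ultimately show ?thesis
    using uT by blast
qed

lemma cone_homotopy_iso: "homotopy_iso (Lam G R) (mapping_cone Bc Tc f) Cc"
  by (rule cone_of_split_mono[OF band_complex_dg[OF band] string_complex_dg[OF tau_word]
        string_complex_dg[OF shortened_word] string_diff_diff[OF tau_word] f_chain quot_chain_map
        retr_linear retr_f quot_f quot_retr_surj quot_retr_inj])

lemma shortened_string: "homotopy_string TYPE('k) G R shortened"
proof (cases "finite (pos tau)")
  case True
  have "pos shortened \<subseteq> pos tau \<union> (\<lambda>j. j - n) ` pos tau"
    by (force simp: pos_shortened split: if_splits intro: image_eqI[of _ _ "_ + n"])
  then have "finite (pos shortened)"
    by (rule finite_subset) (use True in auto)
  then show ?thesis
    using shortened_word by (simp add: homotopy_string_def)
next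
  case False
  then have T: "\<And>m. finite {i \<in> pos tau. deg tau i = m}" "right_bounded Tc" "bounded_cohomology Tc"
    using string by (auto simp: homotopy_string_def Let_def)
  have "finite {i \<in> pos shortened. deg shortened i = m}" for m
  proof (rule finite_subset)
    show "{i \<in> pos shortened. deg shortened i = m} \<subseteq>
        {i \<in> pos tau. deg tau i = m} \<union> (\<lambda>j. j - n) ` {i \<in> pos tau. deg tau i = m}"
    proof
      fix i assume i: "i \<in> {i \<in> pos shortened. deg shortened i = m}"
      show "i \<in> {i \<in> pos tau. deg tau i = m} \<union> (\<lambda>j. j - n) ` {i \<in> pos tau. deg tau i = m}"
      proof (cases "i \<le> b - n")
        case True
        then show ?thesis using i shortened_left[of i] by (simp add: pos_shortened)
      next
        case False
        then have "i + n \<in> {i \<in> pos tau. deg tau i = m}"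
          using i shortened_right[of i] winds by (simp add: pos_shortened)
        then show ?thesis
          by (intro UnI2 image_eqI[of _ _ "i + n"]) auto
      qed
    qed
  qed (use T(1) in auto)
  moreover have "right_bounded Cc"
  proof -
    obtain N where N: "\<And>m. m > N \<Longrightarrow> cterm Tc m = {0}"
      using T(2) by (auto simp: right_bounded_def)
    have "cterm Cc m = {0}" if m: "m > N" for m
    proof -
      have "y = 0" if y: "y \<in> cterm Cc m" for y
      proof -
        obtain u where "u \<in> cterm Tc m" "quot m u = y"
          using quot_retr_surj[OF y] by blast
        then have "y = quot m 0"
          using N[OF m] by simp
        also have "\<dots> = 0"
          by (rule ext) (simp add: quot_def zero_fun_apply[of "_::int"] del: zero_fun_apply)
        finally show ?thesis .
      qed
      then show ?thesis
        using dg_moduleD(1)[OF string_complex_dg[OF shortened_word]] by blast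
    qed
    then show ?thesis
      by (auto simp: right_bounded_def)
  qed
  moreover have "bounded_cohomology Cc"
  proof (rule cokernel_bounded_cohomology[OF band_complex_dg[OF band] string_complex_dg[OF tau_word]
        string_complex_dg[OF shortened_word] string_diff_diff[OF tau_word] quot_chain_map
        retr_linear quot_retr_surj quot_retr_inj _ T(3)])
    show "finite {m. cterm Bc m \<noteq> {0}}"
    proof (rule finite_subset)
      show "{m. cterm Bc m \<noteq> {0}} \<subseteq> deg sigma ` {0..<n}"
      proof
        fix m assume "m \<in> {m. cterm Bc m \<noteq> {0}}"
        then obtain u where u: "u \<in> cterm Bc m" "u \<noteq> 0"
          using dg_moduleD(1)[OF band_complex_dg[OF band]] by blast
        then obtain i where "u i \<noteq> 0"
          by (metis ext zero_fun_apply)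
        moreover have "u i \<in> summand G R {0..<n} (vtx sigma) (deg sigma) m i"
          using u by (simp add: cterm_band_complex[OF band])
        ultimately show "m \<in> deg sigma ` {0..<n}"
          using summand_nonzero by (metis image_eqI)
      qed
    qed simp
  qed
  ultimately show ?thesis
    using shortened_word by (simp add: homotopy_string_def Let_def)
qed

end

section \<open>Subwords of homotopy strings\<close>

lemma restrict_word_simps [simp]:
  "pos (restrict_word w L) = pos w \<inter> L" "vtx (restrict_word w L) = vtx w"
  "deg (restrict_word w L) = deg w" "ltr (restrict_word w L) = ltr w"
  by (simp_all add: restrict_word_def)

lemma restrict_restrict: "restrict_word (restrict_word w L) M = restrict_word w (L \<inter> M)"
  by (simp add: restrict_word_def Int_assoc)

lemma links_restrict: "links (restrict_word w L) = {i \<in> links w. i \<in> L \<and> i + 1 \<in> L}"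
  by (auto simp: links_def)

lemma same_word_refl: "same_word w w"
  unfolding same_word_def by (rule exI[of _ 0]) simp

context gentle_algebra
begin

lemma homotopy_word_restrict:
  assumes w: "homotopy_word G R w" and ne: "pos w \<inter> L \<noteq> {}"
    and conv: "\<And>i k. i \<in> L \<Longrightarrow> k \<in> L \<Longrightarrow> {i..k} \<subseteq> L"
  shows "homotopy_word G R (restrict_word w L)"
proof -
  have "int_interval (pos w \<inter> L)"
    using w ne conv unfolding homotopy_word_def int_interval_def by (metis IntE Int_greatest)
  then show ?thesis
    using w by (auto simp: homotopy_word_def links_restrict)
qed

lemma restrict_right_letter:
  "j \<in> L \<Longrightarrow> j + 1 \<in> L \<Longrightarrow> right_letter (restrict_word w L) j = right_letter w j"
  "j \<in> L \<Longrightarrow> j - 1 \<in> L \<Longrightarrow> left_letter (restrict_word w L) j = left_letter w j"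
  "j \<notin> L \<Longrightarrow> right_letter (restrict_word w L) j = None"
  "j \<notin> L \<Longrightarrow> left_letter (restrict_word w L) j = None"
  by (auto simp: right_letter_def left_letter_def links_restrict)

lemma cterm_restrict:
  assumes "u \<in> cterm (string_complex G R (restrict_word w L)) m"
  shows "u \<in> cterm (string_complex G R w) m" "i \<notin> L \<Longrightarrow> u i = 0"
proof -
  have *: "u i \<in> summand G R (pos w \<inter> L) (vtx w) (deg w) m i" for i
    using assms by (simp add: cterm_string_complex)
  have "u i \<in> summand G R (pos w) (vtx w) (deg w) m i" for i
    using *[of i] by (auto simp: summand_def split: if_splits)
  then show "u \<in> cterm (string_complex G R w) m"
    using assms by (simp add: cterm_string_complex)
  show "i \<notin> L \<Longrightarrow> u i = 0"
    using *[of i] by (auto simp: summand_def split: if_splits)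
qed

text \<open>
  Cutting the word at finitely many places leaves the complex unchanged up to a direct summand in
  all degrees that are far enough from those of the cuts.
\<close>

lemma restrict_bounded_cohomology:
  assumes w: "homotopy_word G R w" and W: "homotopy_word G R (restrict_word w L)"
    and cuts: "finite {j. (j \<in> L) \<noteq> (j + 1 \<in> L)}"
    and exact: "bounded_cohomology (string_complex G R w :: (_ \<Rightarrow> 'k::field, _) mod_complex)"
  shows "bounded_cohomology (string_complex G R (restrict_word w L) :: (_ \<Rightarrow> 'k, _) mod_complex)"
proof -
  let ?W = "restrict_word w L"
  let ?T = "string_complex G R w :: (_ \<Rightarrow> 'k, _) mod_complex"
  let ?D = "string_complex G R ?W :: (_ \<Rightarrow> 'k, _) mod_complex"
  let ?F = "{j. (j \<in> L) \<noteq> (j + 1 \<in> L)}"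
  obtain N where N: "\<And>m. \<bar>m\<bar> > N \<Longrightarrow>
      {x \<in> cterm ?T m. cdiff ?T m x = 0} = cdiff ?T (m - 1) ` cterm ?T (m - 1)"
    using exact by (auto simp: bounded_cohomology_def)
  define M where "M = Max (insert 0 ((\<lambda>j. \<bar>deg w j\<bar>) ` (?F \<union> (\<lambda>j. j + 1) ` ?F)))"
  have M: "\<bar>deg w j\<bar> \<le> M \<and> \<bar>deg w (j + 1)\<bar> \<le> M" if "j \<in> ?F" for j
    using cuts that unfolding M_def by (intro conjI Max_ge) auto
  have sum_w: "u j \<in> summand G R (pos w) (vtx w) (deg w) m j" if "u \<in> cterm ?T m" for u m j
    using that by (simp add: cterm_string_complex)
  have cut_zero: "u j = 0 \<and> u (j + 1) = 0" if "u \<in> cterm ?T m" "\<bar>m\<bar> > M" "j \<in> ?F" for u m j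
    using summand_nonzero[OF sum_w[OF that(1), of j]] summand_nonzero[OF sum_w[OF that(1), of "j + 1"]]
      M[OF that(3)] that(2) by force
  define res where "res u j = (if j \<in> L then u j else 0)" for u :: "int \<Rightarrow> ('v, 'a) qpath \<Rightarrow> 'k" and j
  have res_D: "res u \<in> cterm ?D m" if "u \<in> cterm ?T m" for u m
    unfolding cterm_string_complex
  proof
    show "finite {i. res u i \<noteq> 0}"
      by (rule finite_subset[of _ "{i. u i \<noteq> 0}"])
        (use that in \<open>auto simp: cterm_string_complex res_def\<close>)
    show "\<forall>i. res u i \<in> summand G R (pos ?W) (vtx ?W) (deg ?W) m i"
    proof
      fix i
      show "res u i \<in> summand G R (pos ?W) (vtx ?W) (deg ?W) m i"
        using sum_w[OF that, of i] by (auto simp: res_def summand_def split: if_splits)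
    qed
  qed
  have D_sub: "u \<in> cterm ?T m" and D_res: "res u = u" if u: "u \<in> cterm ?D m" for u m
    using cterm_restrict[OF u] by (auto simp: res_def)
  have res_diff: "diff_at G R ?W (res u) = res (diff_at G R w u)"
    if u: "u \<in> cterm ?T m" and m: "\<bar>m\<bar> > M" for u m
  proof
    fix j
    show "diff_at G R ?W (res u) j = res (diff_at G R w u) j"
    proof (cases "j \<in> L")
      case True
      have "incoming G R (right_letter ?W j) (res u (j + 1)) = incoming G R (right_letter w j) (u (j + 1))"
        using True cut_zero[OF u m, of j]
        by (cases "j + 1 \<in> L") (simp_all add: res_def restrict_right_letter)
      moreover have "incoming G R (flipped_left ?W j) (res u (j - 1)) = incoming G R (flipped_left w j) (u (j - 1))"
        using True cut_zero[OF u m, of "j - 1"]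
        by (cases "j - 1 \<in> L") (simp_all add: res_def restrict_right_letter)
      ultimately show ?thesis
        using True by (simp add: diff_at_def res_def[of "diff_at G R w u"])
    next
      case False
      then show ?thesis
        by (simp add: diff_at_def res_def[of "diff_at G R w u"] restrict_right_letter)
    qed
  qed
  have "{x \<in> cterm ?D m. cdiff ?D m x = 0} = cdiff ?D (m - 1) ` cterm ?D (m - 1)"
    if m: "\<bar>m\<bar> > max N (M + 1)" for m
  proof (intro equalityI subsetI)
    fix x assume "x \<in> {x \<in> cterm ?D m. cdiff ?D m x = 0}"
    then have x: "x \<in> cterm ?D m" "diff_at G R ?W x = 0"
      by (auto simp: string_diff_at)
    note xT = D_sub[OF x(1)]
    have "diff_at G R w x j = 0" for j
    proof (cases "j \<in> L")
      case True
      have "\<bar>m\<bar> > M" using m by simp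
      then have "res (diff_at G R w x) = 0"
        using res_diff[OF xT] x(2) D_res[OF x(1)] by simp
      from fun_cong[OF this, of j] show ?thesis
        using True by (simp add: res_def)
    next
      case False
      have "x (j + 1) = 0"
        using cut_zero[OF xT, of j] m False fun_cong[OF D_res[OF x(1)], of "j + 1"]
        by (cases "j + 1 \<in> L") (auto simp: res_def)
      moreover have "x (j - 1) = 0"
        using cut_zero[OF xT, of "j - 1"] m False fun_cong[OF D_res[OF x(1)], of "j - 1"]
        by (cases "j - 1 \<in> L") (auto simp: res_def)
      ultimately show ?thesis
        by (simp add: diff_at_def)
    qed
    then have "cdiff ?T m x = 0"
      unfolding string_diff_at[OF xT] by (intro ext[of _ 0]) (simp only: zero_fun_apply)
    then obtain z where z: "z \<in> cterm ?T (m - 1)" "x = cdiff ?T (m - 1) z"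
      using N[of m] m xT by auto
    have "cdiff ?D (m - 1) (res z) = diff_at G R ?W (res z)"
      using string_diff_at[OF res_D[OF z(1)]] .
    also have "\<dots> = res (diff_at G R w z)"
      using m by (intro res_diff[OF z(1)]) auto
    also have "\<dots> = x"
      using D_res[OF x(1)] z(2) string_diff_at[OF z(1)] by simp
    finally show "x \<in> cdiff ?D (m - 1) ` cterm ?D (m - 1)"
      using res_D[OF z(1)] by (metis image_eqI)
  next
    fix x assume "x \<in> cdiff ?D (m - 1) ` cterm ?D (m - 1)"
    then obtain z where z: "z \<in> cterm ?D (m - 1)" "x = cdiff ?D (m - 1) z"
      by blast
    then show "x \<in> {x \<in> cterm ?D m. cdiff ?D m x = 0}"
      using string_diff_diff[OF W z(1)] graded_linearD(1)[OF dg_moduleD(6)[OF string_complex_dg[OF W]] z(1)]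
      by simp
  qed
  then show ?thesis
    unfolding bounded_cohomology_def by blast
qed

lemma homotopy_string_restrict:
  assumes w: "homotopy_string TYPE('k::field) G R w" and ne: "pos w \<inter> L \<noteq> {}"
    and conv: "\<And>i k. i \<in> L \<Longrightarrow> k \<in> L \<Longrightarrow> {i..k} \<subseteq> L"
    and cuts: "finite {j. (j \<in> L) \<noteq> (j + 1 \<in> L)}"
  shows "homotopy_string TYPE('k) G R (restrict_word w L)"
proof -
  let ?T = "string_complex G R w :: (_ \<Rightarrow> 'k, _) mod_complex"
  let ?D = "string_complex G R (restrict_word w L) :: (_ \<Rightarrow> 'k, _) mod_complex"
  have hw: "homotopy_word G R w"
    using w by (simp add: homotopy_string_def)
  note hW = homotopy_word_restrict[OF hw ne conv]
  show ?thesis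
  proof (cases "finite (pos w)")
    case True
    then show ?thesis
      using hW by (simp add: homotopy_string_def)
  next
    case False
    then have T: "\<And>m. finite {i \<in> pos w. deg w i = m}" "right_bounded ?T" "bounded_cohomology ?T"
      using w by (auto simp: homotopy_string_def Let_def)
    have fin: "finite {i \<in> pos (restrict_word w L). deg (restrict_word w L) i = m}" for m
      by (rule finite_subset[OF _ T(1)[of m]]) auto
    have "cterm ?D m \<subseteq> cterm ?T m" for m
      using cterm_restrict(1) by blast
    then have "right_bounded ?D"
      using T(2) dg_moduleD(1)[OF string_complex_dg[OF hW]] unfolding right_bounded_def by blast
    moreover have "bounded_cohomology ?D"
      by (rule restrict_bounded_cohomology[OF hw hW cuts T(3)])
    ultimately show ?thesis
      using hW fin by (simp add: homotopy_string_def Let_def)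
  qed
qed

lemma homotopy_word_window:
  assumes "homotopy_word G R w" "pos w = UNIV" "0 \<le> n"
  shows "homotopy_word G R (window w k n)"
proof -
  have lk: "links w = UNIV" "links (window w k n) = {0..<n}"
    using assms(2) by (auto simp: links_def window_def)
  show ?thesis
    unfolding homotopy_word_def lk
    using assms homotopy_wordD[OF assms(1), unfolded lk(1), OF UNIV_I]
    by (auto simp: window_def int_interval_def homotopy_word_def add.assoc[symmetric])
qed

lemma concat_four:
  assumes m: "m1 \<in> pos w" "m2 \<in> pos w" "m3 \<in> pos w" "m1 \<le> m2" "m2 \<le> m3"
    and u: "same_word u1 (restrict_word w {..m1})" "same_word u2 (restrict_word w {m1..m2})"
      "same_word u3 (restrict_word w {m2..m3})" "same_word u4 (restrict_word w {m3..})"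
  shows "concat_words G R [u1, u2, u3, u4] w"
proof -
  have "{m2..} \<inter> {..m3} = {m2..m3}" "{m1..} \<inter> {..m2} = {m1..m2}"
    "{m1..} \<inter> {m2..} = {m2..}" "{m2..} \<inter> {m3..} = {m3..}"
    using m by auto
  note [simp] = this restrict_restrict same_word_refl
  have "concat_words G R [u4] (restrict_word w {m3..})"
    using u(4) by simp
  moreover have "concat2 G R u3 (restrict_word w {m3..}) (restrict_word w {m2..})"
    unfolding concat2_def using m u(3) by (intro disjI1 bexI[of _ m3]) auto
  ultimately have "concat_words G R [u3, u4] (restrict_word w {m2..})"
    unfolding concat_words.simps by blast
  moreover have "concat2 G R u2 (restrict_word w {m2..}) (restrict_word w {m1..})"
    unfolding concat2_def using m u(2) by (intro disjI1 bexI[of _ m2]) auto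
  ultimately have "concat_words G R [u2, u3, u4] (restrict_word w {m1..})"
    unfolding concat_words.simps by blast
  moreover have "concat2 G R u1 (restrict_word w {m1..}) w"
    unfolding concat2_def using m u(1) by (intro disjI1 bexI[of _ m1]) auto
  ultimately show ?thesis
    unfolding concat_words.simps by blast
qed

end

lemma same_word_block:
  assumes K: "common_subword U W K t" and xy: "{x..y} \<subseteq> K" "x \<le> y"
    and w: "pos w = {0..y - x}"
      "\<And>i. 0 \<le> i \<Longrightarrow> i \<le> y - x \<Longrightarrow> vtx w i = vtx U (x + t + i) \<and> deg w i = deg U (x + t + i)"
      "\<And>i. 0 \<le> i \<Longrightarrow> i < y - x \<Longrightarrow> ltr w i = ltr U (x + t + i)"
  shows "same_word w (restrict_word W {x..y})"
  unfolding same_word_def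
proof (intro exI[of _ x] conjI ballI)
  have "{x..y} \<subseteq> pos W"
    using K xy by (auto simp: common_subword_def)
  moreover have "(\<lambda>i. i + x) ` {0..y - x} = {x..y}"
    by (auto intro!: image_eqI[of _ _ "_ - x"])
  ultimately show "pos (restrict_word W {x..y}) = (\<lambda>i. i + x) ` pos w"
    using w(1) by auto
next
  fix i assume "i \<in> pos w"
  then have i: "0 \<le> i" "i \<le> y - x" using w(1) by auto
  then have "i + x \<in> K" using xy by auto
  then show "vtx (restrict_word W {x..y}) (i + x) = vtx w i" "deg (restrict_word W {x..y}) (i + x) = deg w i"
    using K w(2)[OF i] by (auto simp: common_subword_def algebra_simps)
next
  fix i assume "i \<in> links w"
  then have i: "0 \<le> i" "i < y - x" using w(1) by (auto simp: links_def)
  then have "i + x \<in> K" "i + x + 1 \<in> K" using xy by auto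
  then show "ltr (restrict_word W {x..y}) (i + x) = ltr w i"
    using K w(3)[OF i] by (auto simp: common_subword_def algebra_simps)
qed

section \<open>The decomposition of the string\<close>

lemma length_rotate_band:
  assumes "word_length w \<ge> 0"
  shows "word_length (rotate_band k w) = word_length w" "pos (rotate_band k w) = {0..word_length w}"
  using assms by (simp_all add: rotate_band_def window_def word_length_def)

context band_graph_map
begin

lemma S_cong:
  assumes "x mod n = y mod n"
  shows "vtx S x = vtx S y" "deg S x = deg S y" "ltr S x = ltr S y"
  using assms by (simp_all add: unfold_band_simps)

abbreviation sigma' :: "('v, 'a) word" where "sigma' \<equiv> rotate_band (a + s) sigma"

lemma sigma'_simps:
  "pos sigma' = {0..n}" "word_length sigma' = n" "vtx sigma' i = vtx S (a + s + i)"
  "deg sigma' i = deg S (a + s + i)" "ltr sigma' i = ltr S (a + s + i)"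
  using n_pos by (simp_all add: length_rotate_band) (simp_all add: rotate_band_def window_def)

lemma sigma'_word: "homotopy_word G R sigma'"
  unfolding rotate_band_def
  by (rule homotopy_word_window) (use S_word n_pos in \<open>auto simp: unfold_band_simps(1)\<close>)

lemma power_simps:
  "pos (band_power sigma' l) = {0..int l * n}"
  "vtx (band_power sigma' l) i = vtx S (a + s + i)" "deg (band_power sigma' l) i = deg S (a + s + i)"
  "ltr (band_power sigma' l) i = ltr S (a + s + i)"
proof -
  show "pos (band_power sigma' l) = {0..int l * n}"
    by (simp add: band_power_def window_def sigma'_simps)
  have "(a + s + i mod n) mod n = (a + s + i) mod n"
    by (simp add: mod_simps)
  from S_cong[OF this]
  show "vtx (band_power sigma' l) i = vtx S (a + s + i)" "deg (band_power sigma' l) i = deg S (a + s + i)"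
    "ltr (band_power sigma' l) i = ltr S (a + s + i)"
    by (simp_all add: band_power_def window_def unfold_band_simps(2-4)[of sigma'] sigma'_simps)
qed

lemma common_shortened: "common_subword S shortened {a..b - n} s"
proof -
  have "j \<in> pos shortened" if "a \<le> j" "j \<le> b - n" for j
    using that I_pos[of j] n_pos by (simp add: pos_shortened)
  moreover have "vtx S (j + s) = vtx shortened j \<and> deg S (j + s) = deg shortened j"
    if "a \<le> j" "j \<le> b - n" for j
    using that shortened_left[of j] on_I[of j] n_pos by (simp add: mem_I)
  moreover have "ltr S (j + s) = ltr shortened j" if "a \<le> j" "j + 1 \<le> b - n" for j
    using that shortened_ltr_left[of j] inside_I[of j] n_pos by (simp add: mem_I)
  ultimately show ?thesis
    using winds by (auto simp: common_subword_def int_interval_def unfold_band_simps(1))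
qed

text \<open>
  All cuts are made at positions of the diagrams of \<open>\<tau>\<close>, \<open>\<sigma>\<close> and the shortened word, so no letters
  merge.  The factor \<open>\<beta>\<close> is what remains of the overlap after \<open>l\<close> turns.
\<close>

lemma decomposition:
  assumes l: "l \<ge> 1" "int l * n \<le> b - a" "b - a < (int l + 1) * n"
  defines "e \<equiv> b - a - int l * n"
  defines "beta \<equiv> restrict_word sigma' {..e}" and "alpha \<equiv> restrict_word sigma' {e..}"
    and "gamma \<equiv> restrict_word tau {b..}" and "delta \<equiv> restrict_word tau {..a}"
  shows "homotopy_string TYPE('k) G R alpha" "homotopy_string TYPE('k) G R beta"
    "homotopy_string TYPE('k) G R gamma" "homotopy_string TYPE('k) G R delta"
    "concat_words G R [beta, alpha] sigma'"
    "concat_words G R [delta, band_power sigma' l, beta, gamma] tau"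
    "concat_words G R [delta, band_power sigma' (l - 1), beta, gamma] shortened"
proof -
  have e: "0 \<le> e" "e < n"
    using l by (auto simp: e_def algebra_simps)
  have ab: "a \<le> b"
    using winds n_pos by simp
  have l1: "int (l - 1) * n = int l * n - n"
    using l(1) by (simp add: of_nat_diff algebra_simps)
  have ln: "0 \<le> int (l - 1) * n" "0 \<le> int l * n"
    using n_pos by auto
  have sigma_string: "homotopy_string TYPE('k) G R sigma'"
    using sigma'_word by (simp add: homotopy_string_def sigma'_simps)
  have cut1: "finite {j. (j \<in> {..x}) \<noteq> (j + 1 \<in> {..x})}" and
    cut2: "finite {j. (j \<in> {x..}) \<noteq> (j + 1 \<in> {x..})}" for x :: int
  proof -
    have "{j. (j \<in> {..x}) \<noteq> (j + 1 \<in> {..x})} \<subseteq> {x}" "{j. (j \<in> {x..}) \<noteq> (j + 1 \<in> {x..})} \<subseteq> {x - 1}"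
      by auto
    then show "finite {j. (j \<in> {..x}) \<noteq> (j + 1 \<in> {..x})}" "finite {j. (j \<in> {x..}) \<noteq> (j + 1 \<in> {x..})}"
      by (meson finite.emptyI finite.insertI finite_subset)+
  qed
  have "e \<in> pos sigma'"
    using e by (simp add: sigma'_simps)
  then show "homotopy_string TYPE('k) G R alpha" "homotopy_string TYPE('k) G R beta"
    unfolding alpha_def beta_def
    by (intro homotopy_string_restrict[OF sigma_string] cut1 cut2; force)+
  show "homotopy_string TYPE('k) G R gamma"
    unfolding gamma_def using I_pos[of b] ab
    by (intro homotopy_string_restrict[OF string] cut1 cut2; force)
  show "homotopy_string TYPE('k) G R delta"
    unfolding delta_def using I_pos[of a] ab
    by (intro homotopy_string_restrict[OF string] cut1 cut2; force)
  have "concat2 G R beta alpha sigma'"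
    unfolding concat2_def using \<open>e \<in> pos sigma'\<close>
    by (intro disjI1 bexI[of _ e]) (auto simp: alpha_def beta_def same_word_refl)
  then show "concat_words G R [beta, alpha] sigma'"
    using same_word_refl[of alpha] by auto
  have beta_block: "same_word beta (restrict_word W {x..x + e})"
    if "common_subword S W K s" "{x..x + e} \<subseteq> K" "x = a + t * n" for W K x t
  proof (rule same_word_block[OF that(1,2)])
    show "x \<le> x + e" "pos beta = {0..x + e - x}"
      using e by (auto simp: beta_def sigma'_simps)
    have "(a + s + i) mod n = (x + s + i) mod n" for i
    proof -
      have "x + s + i = a + s + i + t * n" using that(3) by simp
      then show ?thesis by (simp only: mod_mult_self1)
    qed
    note c = S_cong[OF this]
    show "vtx beta i = vtx S (x + s + i) \<and> deg beta i = deg S (x + s + i)"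
      "ltr beta i = ltr S (x + s + i)" for i
      using c[of i] by (simp_all add: beta_def sigma'_simps)
  qed
  have power_block: "same_word (band_power sigma' k) (restrict_word W {a..a + int k * n})"
    if "common_subword S W K s" "{a..a + int k * n} \<subseteq> K" for W K k
    using n_pos by (intro same_word_block[OF that]) (simp_all add: power_simps)
  show "concat_words G R [delta, band_power sigma' l, beta, gamma] tau"
  proof (rule concat_four)
    let ?m = "a + int l * n"
    have m: "a \<le> ?m" "?m + e = b" "?m \<le> b"
      using ln e by (auto simp: e_def)
    then show "a \<in> pos tau" "?m \<in> pos tau" "b \<in> pos tau" "a \<le> ?m" "?m \<le> b"
      using I_pos ab by auto
    show "same_word delta (restrict_word tau {..a})" "same_word gamma (restrict_word tau {b..})"
      by (simp_all add: delta_def gamma_def same_word_refl)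
    show "same_word (band_power sigma' l) (restrict_word tau {a..?m})"
      by (rule power_block[OF common]) (use m in \<open>auto simp: mem_I\<close>)
    have "{?m..?m + e} \<subseteq> I"
      using m by (auto simp: mem_I)
    from beta_block[OF common this refl]
    show "same_word beta (restrict_word tau {?m..b})"
      using m by simp
  qed
  show "concat_words G R [delta, band_power sigma' (l - 1), beta, gamma] shortened"
  proof (rule concat_four)
    let ?m = "a + int (l - 1) * n"
    have m: "a \<le> ?m" "?m + e = b - n" "?m \<le> b - n" "a \<le> b - n"
      using ln e l1 l(1) winds by (auto simp: e_def)
    have "x \<in> pos shortened" if "a \<le> x" "x \<le> b - n" for x
      using that I_pos[of x] n_pos by (simp add: pos_shortened)
    then show "a \<in> pos shortened" "?m \<in> pos shortened" "b - n \<in> pos shortened"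
      "a \<le> ?m" "?m \<le> b - n"
      using m by auto
    show "same_word (band_power sigma' (l - 1)) (restrict_word shortened {a..?m})"
      by (rule power_block[OF common_shortened]) (use m in auto)
    have "{?m..?m + e} \<subseteq> {a..b - n}"
      using m by auto
    from beta_block[OF common_shortened this refl]
    show "same_word beta (restrict_word shortened {?m..b - n})"
      using m by simp
    show "same_word delta (restrict_word shortened {..a})"
      unfolding same_word_def
    proof (intro exI[of _ 0] conjI ballI)
      show "pos (restrict_word shortened {..a}) = (\<lambda>i. i + 0) ` pos delta"
        using m by (auto simp: delta_def pos_shortened)
    next
      fix i assume "i \<in> pos delta"
      then show "vtx (restrict_word shortened {..a}) (i + 0) = vtx delta i"
        "deg (restrict_word shortened {..a}) (i + 0) = deg delta i"
        using shortened_left[of i] m by (auto simp: delta_def)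
    next
      fix i assume "i \<in> links delta"
      then show "ltr (restrict_word shortened {..a}) (i + 0) = ltr delta i"
        using shortened_ltr_left[of i] m by (auto simp: delta_def links_restrict)
    qed
    show "same_word gamma (restrict_word shortened {b - n..})"
      unfolding same_word_def
    proof (intro exI[of _ "- n"] conjI ballI)
      show "pos (restrict_word shortened {b - n..}) = (\<lambda>i. i + - n) ` pos gamma"
      proof (intro equalityI subsetI)
        fix x assume "x \<in> pos (restrict_word shortened {b - n..})"
        then have "x + n \<in> pos gamma"
          using I_pos[of b] ab by (auto simp: gamma_def pos_shortened split: if_splits)
        then show "x \<in> (\<lambda>i. i + - n) ` pos gamma"
          by (intro image_eqI[of _ _ "x + n"]) auto
      next
        fix x assume "x \<in> (\<lambda>i. i + - n) ` pos gamma"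
        then obtain i where i: "x = i - n" "i \<in> pos tau" "b \<le> i"
          by (auto simp: gamma_def)
        then show "x \<in> pos (restrict_word shortened {b - n..})"
          using I_pos[of "b - n"] n_pos m by (auto simp: pos_shortened)
      qed
    next
      fix i assume "i \<in> pos gamma"
      then show "vtx (restrict_word shortened {b - n..}) (i + - n) = vtx gamma i"
        "deg (restrict_word shortened {b - n..}) (i + - n) = deg gamma i"
        using shortened_right[of "i - n"] m by (auto simp: gamma_def)
    next
      fix i assume "i \<in> links gamma"
      then show "ltr (restrict_word shortened {b - n..}) (i + - n) = ltr gamma i"
        using shortened_ltr_right[of "i - n"] m by (auto simp: gamma_def links_restrict)
    qed
  qed
qed

end

lemma same_word_card: "same_word u w \<Longrightarrow> card (pos w) = card (pos u) \<and> (finite (pos u) \<longleftrightarrow> finite (pos w))"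
  unfolding same_word_def by (auto simp: card_image inj_on_def finite_image_iff)

lemma pos_power_rotate:
  assumes "word_length w \<ge> 0"
  shows "pos (band_power (rotate_band k w) l) = {0..int l * word_length w}"
  by (simp add: band_power_def window_def length_rotate_band[OF assms])

text \<open>Of the two containments of subwords only the comparison of lengths matters here.\<close>

lemma overlap_length:
  assumes n: "word_length w > 0" and I: "int_interval I" "I \<subseteq> pos t"
    and upper: "proper_subword (restrict_word t I) (band_power (rotate_band k w) (l + 1))"
    and lower: "subword (band_power (rotate_band k' w) l) (restrict_word t I)"
  obtains a b where "I = {a..b}" "int l * word_length w \<le> b - a" "b - a < (int l + 1) * word_length w"
proof -
  let ?n = "word_length w"
  have tI: "pos t \<inter> I = I" using I(2) by auto
  obtain J where J: "J \<subset> {0..int (l + 1) * ?n}"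
    "same_word (restrict_word t I) (restrict_word (band_power (rotate_band k w) (l + 1)) J)"
    using upper n unfolding proper_subword_def by (auto simp: pos_power_rotate)
  then have J': "card J = card I" "finite I"
    using same_word_card[OF J(2)] n finite_subset[of J "{0..int (l + 1) * ?n}"]
    by (auto simp: pos_power_rotate tI Int_absorb1 psubset_eq)
  have "card J < card {0..int (l + 1) * ?n}"
    by (rule psubset_card_mono[OF _ J(1)]) simp
  then have up: "int (card I) < int (l + 1) * ?n + 1"
    using J'(1) n by simp
  obtain J2 where J2: "J2 \<subseteq> I"
    "same_word (band_power (rotate_band k' w) l) (restrict_word (restrict_word t I) J2)"
    using lower unfolding subword_def by (auto simp: tI)
  then have "card J2 = card {0..int l * ?n}"
    using same_word_card[OF J2(2)] n by (simp add: pos_power_rotate tI Int_absorb1)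
  moreover have "card J2 \<le> card I"
    by (rule card_mono[OF J'(2) J2(1)])
  ultimately have low: "int l * ?n + 1 \<le> int (card I)"
    using n by simp
  have ne: "I \<noteq> {}"
    using I(1) by (simp add: int_interval_def)
  obtain a b where ab: "a = Min I" "b = Max I" by blast
  have "a \<in> I" "b \<in> I"
    using Min_in[OF J'(2) ne] Max_in[OF J'(2) ne] by (simp_all add: ab)
  then have "{a..b} \<subseteq> I"
    using I(1) unfolding int_interval_def by blast
  moreover have "I \<subseteq> {a..b}"
    using J'(2) by (auto simp: ab)
  ultimately have Iab: "I = {a..b}" by blast
  then have "int (card I) = b - a + 1"
    using ne by simp
  with up low show thesis
    by (intro that[OF Iab]) (simp_all add: algebra_simps)
qed

theorem theorem2p2:
  fixes G :: "('v, 'a) pre_digraph" and R :: "('a \<times> 'a) set"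
    and \<sigma> \<tau> \<rho> :: "('v, 'a) word" and lam :: "'k::field" and d :: int
    and I :: "int set" and s :: int and l :: nat
    and f :: "int \<Rightarrow> (int \<Rightarrow> ('v, 'a) qpath \<Rightarrow> 'k) \<Rightarrow> (int \<Rightarrow> ('v, 'a) qpath \<Rightarrow> 'k)"
  assumes gentle: "gentle_algebra G R"
    and band: "homotopy_band G R \<sigma>"
    and string: "homotopy_string TYPE('k) G R \<tau>"
    and scalar: "lam \<noteq> 0" "d \<in> {0..<word_length \<sigma>}" "is_direct (ltr \<sigma> d)"
    and graph_map: "band_string_graph_map G R \<sigma> lam d \<tau> I s f"
    and rho: "\<rho> = restrict_word \<tau> I"
    and l: "l \<ge> 1"
    and upper: "\<exists>k. proper_subword \<rho> (band_power (rotate_band k \<sigma>) (l + 1))"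
    and lower: "\<exists>k. subword (band_power (rotate_band k \<sigma>) l) \<rho>"
  shows "\<exists>k \<sigma>' \<alpha> \<beta> \<gamma> \<delta> c.
     \<sigma>' = rotate_band k \<sigma> \<and>
     homotopy_string TYPE('k) G R \<alpha> \<and> homotopy_string TYPE('k) G R \<beta> \<and>
     homotopy_string TYPE('k) G R \<gamma> \<and> homotopy_string TYPE('k) G R \<delta> \<and>
     concat_words G R [\<beta>, \<alpha>] \<sigma>' \<and>
     concat_words G R [\<delta>, band_power \<sigma>' l, \<beta>, \<gamma>] \<tau> \<and>
     homotopy_string TYPE('k) G R c \<and>
     concat_words G R [\<delta>, band_power \<sigma>' (l - 1), \<beta>, \<gamma>] c \<and>
     homotopy_iso (Lam G R)
       (mapping_cone (band_complex G R \<sigma> lam d) (string_complex G R \<tau>) f)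
       (string_complex G R c)"
proof -
  interpret gentle_algebra G R
    by (rule gentle)
  let ?n = "word_length \<sigma>"
  have n: "?n > 0"
    by (rule band_basics(1)[OF band])
  obtain fL fR c where gm: "common_subword (unfold_band \<sigma>) \<tau> I s"
    "chain_map (Lam G R) (band_complex G R \<sigma> lam d) (string_complex G R \<tau>) f"
    "end_conditions G R (unfold_band \<sigma>) \<tau> I s fL fR" "\<forall>j. c j \<noteq> 0"
    "\<forall>m. \<forall>u\<in>cterm (band_complex G R \<sigma> lam d) m.
       f m u = mat_map G R (graph_matrix \<tau> I s (\<lambda>i. i mod word_length \<sigma>) fL fR c) u"
    using graph_map unfolding band_string_graph_map_def overlap_def by blast
  have "int_interval I" "I \<subseteq> pos \<tau>"
    using gm(1) by (auto simp: common_subword_def)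
  then obtain a b where ab: "I = {a..b}" "int l * ?n \<le> b - a" "b - a < (int l + 1) * ?n"
    using upper lower overlap_length[OF n] unfolding rho by metis
  have "1 * ?n \<le> int l * ?n"
    using l n by (intro mult_right_mono) auto
  then have winds: "?n \<le> b - a"
    using ab(2) by simp
  interpret band_graph_map G R \<sigma> \<tau> lam d I s fL fR c a b f
    by unfold_locales (use band string scalar gm ab(1) winds in blast)+
  show ?thesis
    using decomposition[OF l ab(2,3)] shortened_string cone_homotopy_iso by blast
qed

end
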